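(* Let $K$ be a field complete with respect to a (possibly trivial) non-Archimedean valuation, let $M\cong\mathbb{Z}^d$ be a lattice with dual $N$, and let $\mathcal{A}=\mathcal{A}(a,r)$ be an affine hyperplane arrangement in $M_{\mathbb{R}}$ defined by a primitive spanning configuration $a\in N^E$ ($E$ a finite set) and $r\in\mathbb{Z}^E$. Let $\mathfrak{M}_{\mathcal{A}}\subseteq\mathfrak{B}_{\mathcal{A}}$ be the hypertoric variety in its Lawrence toric variety. Then, unless $\mathfrak{M}_{\mathcal{A}}\cong\mathbb{A}^{2d}$, the hypertoric variety $\mathfrak{M}_{\mathcal{A}}$ does not meet each torus orbit of $\mathfrak{B}_{\mathcal{A}}$ properly; that is, if $\mathfrak{M}_{\mathcal{A}}\not\cong\mathbb{A}^{2d}$, then there is a cone $\sigma$ of the fan of $\mathfrak{B}_{\mathcal{A}}$ such that $\mathfrak{M}_{\mathcal{A}}\cap O(\sigma)$ is nonempty and $\dim(\mathfrak{M}_{\mathcal{A}}\cap O(\sigma))\ne\dim\mathfrak{M}_{\mathcal{A}}-\dim\sigma$.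
   Context: **Arrangements.** $M\cong\mathbb{Z}^d$, $N=\mathrm{Hom}(M,\mathbb{Z})$, $M_{\mathbb{R}}=M\otimes\mathbb{R}$. A tuple $a=(a_e)_{e\in E}\in N^E$ of nonzero vectors is a primitive spanning configuration if each $a_e$ is primitive and the $a_e$ generate $N$. The arrangement $\mathcal{A}=\mathcal{A}(a,r)$ is the multiset of hyperplanes $H_e=\{m\in M_{\mathbb{R}}: \langle m,a_e\rangle+r_e=0\}$, $e\in E$, with closed halfspaces $H_e^+=\{\langle m,a_e\rangle+r_e\le 0\}$ and $H_e^-=\{\langle m,a_e\rangle+r_e\ge 0\}$. A vertex of $\mathcal{A}$ is a point $\xi\in M_{\mathbb{R}}$ such that $\{\xi\}$ is a fiber of the map sending $m\in M_{\mathbb R}$ to its sign vector in $\{+,0,-\}^E$ (entry $+$ if $m\in H_e^+\setminus H_e$, $0$ if $m\in H_e$, $-$ if $m\in H_e^-\setminus H_e$); put $E^{\pm}(\xi)=\{e\in E:\xi\in H_e^{\pm}\}$. **Lawrence toric variety.** Let $\Lambda=\ker(\mathbb{Z}^E\to N,\ \delta_e\mapsto a_e)$, embedded in $\mathbb{Z}^E\oplus\mathbb{Z}^E$ (with bases $\delta_e^+$, $\delta_e^-$) via $\delta_e\mapsto\delta_e^+-\delta_e^-$. Let $\widetilde N=(\mathbb{Z}^E\oplus\mathbb{Z}^E)/\Lambda$ (free of rank $|E|+d$), $\rho_e^{\pm}$ the image of $\delta_e^{\pm}$, and $\widetilde M$ the dual lattice. The Lawrence toric variety $\mathfrak{B}_{\mathcal{A}}$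 is the toric $K$-variety with dense torus $\widetilde T=\mathrm{Spec}\,K[\widetilde M]$ and fan $\Delta_{\mathcal{A}}$ in $\widetilde N_{\mathbb{R}}$ whose maximal cones are the cones generated by $\{\rho_e^+: e\in E^+(\xi)\}\cup\{\rho_f^-: f\in E^-(\xi)\}$ for $\xi$ a vertex of $\mathcal{A}$. $O(\sigma)$ denotes the torus orbit corresponding to a cone $\sigma\in\Delta_{\mathcal{A}}$. **Hypertoric variety.** The map $\widetilde N\to\mathbb{Z}^E$, $\rho_e^{\pm}\mapsto\delta_e$, induces a surjective toric morphism $\Phi:\mathfrak{B}_{\mathcal{A}}\to\mathbb{A}^E$. Let $L_{\mathcal{A}_0}\subseteq\mathbb{A}^E=\mathrm{Spec}\,K[x_e: e\in E]$ be the linear subspace cut out by the forms $\sum_e c_e x_e$ for all relations $\sum_e c_e a_e=0$ in $N$. The hypertoric variety is $\mathfrak{M}_{\mathcal{A}}=\Phi^{-1}(L_{\mathcal{A}_0})$; it is irreducible of dimension $2d$. **Proper intersection.** A subvariety $X$ of a toric variety intersects the torus orbit $O(\sigma)$ properly if $X\cap O(\sigma)$ has the expected dimension $\dim X-\dim\sigma$. Orbits that $X$ does not meet at all are not counted as violations. *)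

theory Defs
  imports
    "HOL-Analysis.Analysis"
    "HOL-Analysis.Finite_Function_Topology"
    "HOL-Library.Poly_Mapping"
    "HOL-Library.Extended_Real"
    "HOL-Algebra.QuotRing"
begin

section \<open>Complete non-Archimedean fields\<close>

text \<open>Valuations are written additively with values in the reals extended by \<open>\<infinity>\<close>;
  the trivial valuation (value 0 on all nonzero elements) is allowed.\<close>

definition nonarch_valuation :: "('k::field \<Rightarrow> ereal) \<Rightarrow> bool" where
  "nonarch_valuation v \<longleftrightarrow>
     (\<forall>x. v x \<noteq> -\<infinity>) \<and> (\<forall>x. v x = \<infinity> \<longleftrightarrow> x = 0) \<and>
     (\<forall>x y. v (x * y) = v x + v y) \<and> (\<forall>x y. min (v x) (v y) \<le> v (x + y))"

definition valuation_complete :: "('k::field \<Rightarrow> ereal) \<Rightarrow> bool" where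
  "valuation_complete v \<longleftrightarrow>
     (\<forall>X :: nat \<Rightarrow> 'k.
        (\<forall>c::real. \<exists>n0. \<forall>m\<ge>n0. \<forall>n\<ge>n0. ereal c < v (X m - X n)) \<longrightarrow>
        (\<exists>l. \<forall>c::real. \<exists>n0. \<forall>n\<ge>n0. ereal c < v (X n - l)))"


section \<open>Krull dimension of a topological space\<close>

definition irreducible_closed :: "'p topology \<Rightarrow> 'p set \<Rightarrow> bool" where
  "irreducible_closed X Z \<longleftrightarrow>
     closedin X Z \<and> Z \<noteq> {} \<and>
     (\<forall>C D. closedin X C \<and> closedin X D \<and> Z = C \<union> D \<longrightarrow> Z = C \<or> Z = D)"

definition krull_dim :: "'p topology \<Rightarrow> enat" where
  "krull_dim X =
     Sup {enat n | n. \<exists>Z :: nat \<Rightarrow> 'p set.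
            (\<forall>i\<le>n. irreducible_closed X (Z i)) \<and> (\<forall>i<n. Z i \<subset> Z (Suc i))}"


section \<open>Ringed spaces over a field and their isomorphisms\<close>

text \<open>Sections over an open set are functions from its points to the stalks (extensional
  outside the open set), so that the restriction maps of the sheaf are restrictions of functions.
  The component \<open>const\<close> is the structure map from the base field.\<close>

record ('p, 's, 'k) k_space =
  topo :: "'p topology"
  sheaf :: "'p set \<Rightarrow> ('p \<Rightarrow> 's) ring"
  const :: "'p set \<Rightarrow> 'k \<Rightarrow> 'p \<Rightarrow> 's"

definition k_isomorphic ::
  "('p, 's, 'k) k_space \<Rightarrow> ('q, 't, 'k) k_space \<Rightarrow> bool" where
  "k_isomorphic X Y \<longleftrightarrow>
     (\<exists>\<phi> \<theta>. homeomorphic_map (topo X) (topo Y) \<phi> \<and>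
       (\<forall>V. openin (topo Y) V \<longrightarrow>
          (let U = {x \<in> topspace (topo X). \<phi> x \<in> V} in
             \<theta> V \<in> ring_iso (sheaf Y V) (sheaf X U) \<and>
             (\<forall>c. \<theta> V (const Y V c) = const X U c) \<and>
             (\<forall>V' s. openin (topo Y) V' \<and> V' \<subseteq> V \<and> s \<in> carrier (sheaf Y V) \<longrightarrow>
                \<theta> V' (restrict s V') =
                restrict (\<theta> V s) {x \<in> topspace (topo X). \<phi> x \<in> V'}))))"


section \<open>Schemes glued from spectra of quotients of monoid algebras\<close>

definition monoid_algebra :: "'m::comm_monoid_add set \<Rightarrow> ('m \<Rightarrow>\<^sub>0 'k::field) ring" where
  "monoid_algebra S =
     \<lparr>carrier = {f. Poly_Mapping.keys f \<subseteq> S}, mult = (*), one = 1, zero = 0, add = (+)\<rparr>"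

lemma cring_monoid_algebra:
  assumes "0 \<in> S" and "\<And>x y. x \<in> S \<Longrightarrow> y \<in> S \<Longrightarrow> x + y \<in> S"
  shows "cring (monoid_algebra S :: ('m::comm_monoid_add \<Rightarrow>\<^sub>0 'k::field) ring)"
proof (rule cringI)
  let ?R = "monoid_algebra S :: ('m \<Rightarrow>\<^sub>0 'k) ring"
  have mult: "Poly_Mapping.keys (f * g) \<subseteq> S"
    if "Poly_Mapping.keys f \<subseteq> S" "Poly_Mapping.keys g \<subseteq> S" for f g :: "'m \<Rightarrow>\<^sub>0 'k"
    using keys_mult[of f g] that assms(2) by blast
  have add: "Poly_Mapping.keys (f + g) \<subseteq> S"
    if "Poly_Mapping.keys f \<subseteq> S" "Poly_Mapping.keys g \<subseteq> S" for f g :: "'m \<Rightarrow>\<^sub>0 'k"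
    using keys_add[of f g] that by blast
  show "abelian_group ?R"
  proof (rule abelian_groupI)
    fix f assume "f \<in> carrier ?R"
    then show "\<exists>g\<in>carrier ?R. g \<oplus>\<^bsub>?R\<^esub> f = \<zero>\<^bsub>?R\<^esub>"
      by (intro bexI[of _ "- f"]) (auto simp: monoid_algebra_def)
  qed (use add in \<open>auto simp: monoid_algebra_def add_ac\<close>)
  show "comm_monoid ?R"
    by (rule comm_monoidI) (use mult assms(1) in \<open>auto simp: monoid_algebra_def mult_ac\<close>)
qed (auto simp: monoid_algebra_def distrib_right)

abbreviation monomial :: "'m \<Rightarrow> ('m \<Rightarrow>\<^sub>0 'k::field)" where
  "monomial u \<equiv> Poly_Mapping.single u 1"

text \<open>The chart with index \<open>i\<close> is \<open>Spec (K[S i] / I i)\<close>, where \<open>S = mon X\<close> and \<open>I = van X\<close>.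
  The relation \<open>sub X j i\<close> says that chart \<open>j\<close> is an open subscheme of chart \<open>i\<close>; then
  \<open>S i \<subseteq> S j\<close>, and the inclusion of charts is given by contraction of prime ideals along
  \<open>K[S i] \<subseteq> K[S j]\<close>. Every point of the glued scheme is listed exactly once, as a pair of one
  chart containing it and the corresponding prime ideal of that chart.\<close>

record (overloaded) ('i, 'm, 'k) atlas =
  charts :: "'i set"
  sub :: "'i \<Rightarrow> 'i \<Rightarrow> bool"
  mon :: "'i \<Rightarrow> 'm set"
  van :: "'i \<Rightarrow> ('m \<Rightarrow>\<^sub>0 'k::zero) set"
  pts :: "('i \<times> ('m \<Rightarrow>\<^sub>0 'k::zero) set) set"

definition chart_open ::
  "('i, 'm, 'k) atlas \<Rightarrow> 'i \<Rightarrow> ('i \<times> ('m \<Rightarrow>\<^sub>0 'k::zero) set) set" where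
  "chart_open X i = {x \<in> pts X. sub X (fst x) i}"

definition zariski ::
  "('i, 'm::comm_monoid_add, 'k::field) atlas \<Rightarrow> ('i \<times> ('m \<Rightarrow>\<^sub>0 'k) set) topology" where
  "zariski X = topology_generated_by
     {{x \<in> chart_open X i. f \<notin> snd x} | i f.
        i \<in> charts X \<and> f \<in> carrier (monoid_algebra (mon X i))}"

text \<open>The class of the fraction \<open>f / g\<close> in the localization of \<open>K[S] / I\<close> at the prime \<open>q\<close>.\<close>

definition germ ::
  "'m::comm_monoid_add set \<Rightarrow> ('m \<Rightarrow>\<^sub>0 'k::field) set \<Rightarrow> ('m \<Rightarrow>\<^sub>0 'k) set \<Rightarrow>
   ('m \<Rightarrow>\<^sub>0 'k) \<Rightarrow> ('m \<Rightarrow>\<^sub>0 'k) \<Rightarrow> (('m \<Rightarrow>\<^sub>0 'k) \<times> ('m \<Rightarrow>\<^sub>0 'k)) set" where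
  "germ S I q f g =
     {(f', g'). f' \<in> carrier (monoid_algebra S) \<and> g' \<in> carrier (monoid_algebra S) - q \<and>
        (\<exists>h \<in> carrier (monoid_algebra S) - q. h * (f * g' - f' * g) \<in> I)}"

abbreviation germ_at ::
  "('i, 'm::comm_monoid_add, 'k::field) atlas \<Rightarrow> 'i \<times> ('m \<Rightarrow>\<^sub>0 'k) set \<Rightarrow>
   ('m \<Rightarrow>\<^sub>0 'k) \<Rightarrow> ('m \<Rightarrow>\<^sub>0 'k) \<Rightarrow> (('m \<Rightarrow>\<^sub>0 'k) \<times> ('m \<Rightarrow>\<^sub>0 'k)) set" where
  "germ_at X x \<equiv> germ (mon X (fst x)) (van X (fst x)) (snd x)"

definition germ_add ::
  "('i, 'm::comm_monoid_add, 'k::field) atlas \<Rightarrow> 'i \<times> ('m \<Rightarrow>\<^sub>0 'k) set \<Rightarrow>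
   (('m \<Rightarrow>\<^sub>0 'k) \<times> ('m \<Rightarrow>\<^sub>0 'k)) set \<Rightarrow> (('m \<Rightarrow>\<^sub>0 'k) \<times> ('m \<Rightarrow>\<^sub>0 'k)) set \<Rightarrow>
   (('m \<Rightarrow>\<^sub>0 'k) \<times> ('m \<Rightarrow>\<^sub>0 'k)) set" where
  "germ_add X x G H =
     (\<Union>(f, g) \<in> G. \<Union>(f', g') \<in> H. germ_at X x (f * g' + f' * g) (g * g'))"

definition germ_mult ::
  "('i, 'm::comm_monoid_add, 'k::field) atlas \<Rightarrow> 'i \<times> ('m \<Rightarrow>\<^sub>0 'k) set \<Rightarrow>
   (('m \<Rightarrow>\<^sub>0 'k) \<times> ('m \<Rightarrow>\<^sub>0 'k)) set \<Rightarrow> (('m \<Rightarrow>\<^sub>0 'k) \<times> ('m \<Rightarrow>\<^sub>0 'k)) set \<Rightarrow>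
   (('m \<Rightarrow>\<^sub>0 'k) \<times> ('m \<Rightarrow>\<^sub>0 'k)) set" where
  "germ_mult X x G H =
     (\<Union>(f, g) \<in> G. \<Union>(f', g') \<in> H. germ_at X x (f * f') (g * g'))"

definition structure_sheaf ::
  "('i, 'm::comm_monoid_add, 'k::field) atlas \<Rightarrow> ('i \<times> ('m \<Rightarrow>\<^sub>0 'k) set) set \<Rightarrow>
   ('i \<times> ('m \<Rightarrow>\<^sub>0 'k) set \<Rightarrow> (('m \<Rightarrow>\<^sub>0 'k) \<times> ('m \<Rightarrow>\<^sub>0 'k)) set) ring" where
  "structure_sheaf X W =
     \<lparr>carrier = {s \<in> extensional W.
        \<forall>x \<in> W. \<exists>i \<in> charts X. \<exists>f \<in> carrier (monoid_algebra (mon X i)).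
          \<exists>g \<in> carrier (monoid_algebra (mon X i)). \<exists>V.
            openin (zariski X) V \<and> x \<in> V \<and> V \<subseteq> W \<inter> chart_open X i \<and>
            (\<forall>y \<in> V. g \<notin> snd y \<and> s y = germ_at X y f g)},
      mult = (\<lambda>s t. \<lambda>x \<in> W. germ_mult X x (s x) (t x)),
      one = (\<lambda>x \<in> W. germ_at X x 1 1),
      zero = (\<lambda>x \<in> W. germ_at X x 0 1),
      add = (\<lambda>s t. \<lambda>x \<in> W. germ_add X x (s x) (t x))\<rparr>"

definition scheme_of ::
  "('i, 'm::comm_monoid_add, 'k::field) atlas \<Rightarrow>
   ('i \<times> ('m \<Rightarrow>\<^sub>0 'k) set, (('m \<Rightarrow>\<^sub>0 'k) \<times> ('m \<Rightarrow>\<^sub>0 'k)) set, 'k) k_space" where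
  "scheme_of X =
     \<lparr>topo = zariski X, sheaf = structure_sheaf X,
      const = (\<lambda>W c. \<lambda>x \<in> W. germ_at X x (Poly_Mapping.single 0 c) 1)\<rparr>"

definition closed_subatlas ::
  "('i, 'm, 'k::zero) atlas \<Rightarrow> ('i \<Rightarrow> ('m \<Rightarrow>\<^sub>0 'k) set) \<Rightarrow> ('i, 'm, 'k) atlas" where
  "closed_subatlas X I = X\<lparr>van := I, pts := {x \<in> pts X. I (fst x) \<subseteq> snd x}\<rparr>"

text \<open>Affine \<open>n\<close>-space: a single chart, the spectrum of the polynomial ring in the variables
  with indices below \<open>n\<close>.\<close>

definition affine_atlas :: "nat \<Rightarrow> (unit, nat \<Rightarrow>\<^sub>0 nat, 'k::field) atlas" where
  "affine_atlas n =
     (let S = {u. Poly_Mapping.keys u \<subseteq> {..<n}} in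
       \<lparr>charts = UNIV, sub = (\<lambda>_ _. True), mon = (\<lambda>_. S), van = (\<lambda>_. {0}),
        pts = {x. primeideal (snd x) (monoid_algebra S)}\<rparr>)"

abbreviation affine_space ::
  "nat \<Rightarrow> (unit \<times> ((nat \<Rightarrow>\<^sub>0 nat) \<Rightarrow>\<^sub>0 'k) set,
            (((nat \<Rightarrow>\<^sub>0 nat) \<Rightarrow>\<^sub>0 'k) \<times> ((nat \<Rightarrow>\<^sub>0 nat) \<Rightarrow>\<^sub>0 'k)) set,
            'k::field) k_space" where
  "affine_space n \<equiv> scheme_of (affine_atlas n)"


section \<open>Arrangements\<close>

text \<open>\<open>M\<close> and \<open>N\<close> are \<open>\<int>^d\<close> with \<open>d = rk A\<close>, in dual bases, and \<open>M\<^sub>\<real>\<close> is \<open>\<real>^d\<close>; vectors are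
  functions on \<open>nat\<close> that vanish from \<open>d\<close> on.\<close>

record 'e arrangement =
  rk :: nat
  idx :: "'e set"
  normal :: "'e \<Rightarrow> nat \<Rightarrow> int"
  shift :: "'e \<Rightarrow> int"

definition coord_space :: "nat \<Rightarrow> (nat \<Rightarrow> 'a::zero) set" where
  "coord_space d = {m. \<forall>i\<ge>d. m i = 0}"

definition primitive_vector :: "nat \<Rightarrow> (nat \<Rightarrow> int) \<Rightarrow> bool" where
  "primitive_vector d v \<longleftrightarrow>
     v \<in> coord_space d \<and> v \<noteq> (\<lambda>_. 0) \<and>
     (\<forall>k. \<forall>w \<in> coord_space d. v = (\<lambda>i. k * w i) \<longrightarrow> \<bar>k\<bar> = 1)"

definition primitive_spanning :: "'e arrangement \<Rightarrow> bool" where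
  "primitive_spanning A \<longleftrightarrow>
     finite (idx A) \<and>
     (\<forall>e \<in> idx A. primitive_vector (rk A) (normal A e)) \<and>
     (\<forall>w \<in> coord_space (rk A). \<exists>c :: 'e \<Rightarrow> int. w = (\<lambda>i. \<Sum>e\<in>idx A. c e * normal A e i))"

definition aff :: "'e arrangement \<Rightarrow> 'e \<Rightarrow> (nat \<Rightarrow> real) \<Rightarrow> real" where
  "aff A e m = (\<Sum>i<rk A. m i * real_of_int (normal A e i)) + real_of_int (shift A e)"

text \<open>The positive halfspace of \<open>e\<close> is \<open>aff A e m \<le> 0\<close>, hence the minus sign in the sign vector.\<close>

definition sign_vector :: "'e arrangement \<Rightarrow> (nat \<Rightarrow> real) \<Rightarrow> 'e \<Rightarrow> real" where
  "sign_vector A m = (\<lambda>e \<in> idx A. - sgn (aff A e m))"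

definition vertices :: "'e arrangement \<Rightarrow> (nat \<Rightarrow> real) set" where
  "vertices A =
     {\<xi>. {m \<in> coord_space (rk A). sign_vector A m = sign_vector A \<xi>} = {\<xi>}}"

definition E_pos :: "'e arrangement \<Rightarrow> (nat \<Rightarrow> real) \<Rightarrow> 'e set" where
  "E_pos A \<xi> = {e \<in> idx A. aff A e \<xi> \<le> 0}"

definition E_neg :: "'e arrangement \<Rightarrow> (nat \<Rightarrow> real) \<Rightarrow> 'e set" where
  "E_neg A \<xi> = {e \<in> idx A. aff A e \<xi> \<ge> 0}"


section \<open>The Lawrence fan\<close>

datatype sign = Pos | Neg

text \<open>\<open>\<Lambda>\<close>, as a sublattice of \<open>\<int>^E\<close>, and the image of one of its elements in \<open>\<real>^E \<oplus> \<real>^E\<close>.\<close>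

definition relations :: "'e arrangement \<Rightarrow> ('e \<Rightarrow>\<^sub>0 int) set" where
  "relations A =
     {c. Poly_Mapping.keys c \<subseteq> idx A \<and>
         (\<forall>i. (\<Sum>e\<in>idx A. Poly_Mapping.lookup c e * normal A e i) = 0)}"

definition relation_vec :: "'e arrangement \<Rightarrow> ('e \<Rightarrow>\<^sub>0 int) \<Rightarrow> ('e \<times> sign \<Rightarrow>\<^sub>0 real)" where
  "relation_vec A c =
     (\<Sum>e\<in>idx A. real_of_int (Poly_Mapping.lookup c e) *\<^sub>R
        (Poly_Mapping.single (e, Pos) 1 - Poly_Mapping.single (e, Neg) 1))"

definition Lam_real :: "'e arrangement \<Rightarrow> ('e \<times> sign \<Rightarrow>\<^sub>0 real) set" where
  "Lam_real A = span (relation_vec A ` relations A)"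

definition pairing :: "('e \<times> sign \<Rightarrow>\<^sub>0 int) \<Rightarrow> ('e \<times> sign \<Rightarrow>\<^sub>0 real) \<Rightarrow> real" where
  "pairing u v =
     (\<Sum>x\<in>Poly_Mapping.keys u. real_of_int (Poly_Mapping.lookup u x) * Poly_Mapping.lookup v x)"

text \<open>The dual of the quotient lattice \<open>(\<int>^E \<oplus> \<int>^E) / \<Lambda>\<close> consists of the integral functionals
  on \<open>\<int>^E \<oplus> \<int>^E\<close>, given by their values on the basis, that vanish on \<open>\<Lambda>\<close>.\<close>

definition M_tilde :: "'e arrangement \<Rightarrow> ('e \<times> sign \<Rightarrow>\<^sub>0 int) set" where
  "M_tilde A =
     {u. Poly_Mapping.keys u \<subseteq> idx A \<times> UNIV \<and>
         (\<forall>c \<in> relations A. pairing u (relation_vec A c) = 0)}"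

text \<open>A cone in the quotient space \<open>(\<real>^E \<oplus> \<real>^E) / \<Lambda>\<^sub>\<real>\<close> is represented by its preimage in
  \<open>\<real>^E \<oplus> \<real>^E\<close>, a cone that contains the subspace \<open>\<Lambda>\<^sub>\<real>\<close>. This is a bijection which is compatible
  with passing to nonempty faces; the dimension of the cone in the quotient is that of
  its preimage minus that of \<open>\<Lambda>\<^sub>\<real>\<close>.\<close>

definition vertex_cone :: "'e arrangement \<Rightarrow> (nat \<Rightarrow> real) \<Rightarrow> ('e \<times> sign \<Rightarrow>\<^sub>0 real) set" where
  "vertex_cone A \<xi> =
     convex_cone hull
       ((\<lambda>e. Poly_Mapping.single (e, Pos) 1) ` E_pos A \<xi> \<union>
        (\<lambda>e. Poly_Mapping.single (e, Neg) 1) ` E_neg A \<xi> \<union> Lam_real A)"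

definition lawrence_fan :: "'e arrangement \<Rightarrow> ('e \<times> sign \<Rightarrow>\<^sub>0 real) set set" where
  "lawrence_fan A = {\<sigma>. \<sigma> \<noteq> {} \<and> (\<exists>\<xi> \<in> vertices A. \<sigma> face_of vertex_cone A \<xi>)}"

definition cone_dim :: "'e arrangement \<Rightarrow> ('e \<times> sign \<Rightarrow>\<^sub>0 real) set \<Rightarrow> nat" where
  "cone_dim A \<sigma> = dim \<sigma> - dim (Lam_real A)"

definition dual_monoid ::
  "'e arrangement \<Rightarrow> ('e \<times> sign \<Rightarrow>\<^sub>0 real) set \<Rightarrow> ('e \<times> sign \<Rightarrow>\<^sub>0 int) set" where
  "dual_monoid A \<sigma> = {u \<in> M_tilde A. \<forall>v\<in>\<sigma>. pairing u v \<ge> 0}"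

lemma pairing_add: "pairing (u + w) v = pairing u v + pairing w v"
proof -
  have "pairing x v =
      (\<Sum>z\<in>Poly_Mapping.keys u \<union> Poly_Mapping.keys w.
        real_of_int (Poly_Mapping.lookup x z) * Poly_Mapping.lookup v z)"
    if "Poly_Mapping.keys x \<subseteq> Poly_Mapping.keys u \<union> Poly_Mapping.keys w" for x
    unfolding pairing_def
    by (rule sum.mono_neutral_left) (use that in \<open>auto simp: in_keys_iff\<close>)
  then show ?thesis
    using keys_add[of u w]
    by (simp add: Poly_Mapping.lookup_add distrib_right sum.distrib)
qed

lemma cring_dual_monoid: "cring (monoid_algebra (dual_monoid A \<sigma>) :: (_ \<Rightarrow>\<^sub>0 'k::field) ring)"
proof (rule cring_monoid_algebra)
  show "0 \<in> dual_monoid A \<sigma>"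
    by (simp add: dual_monoid_def M_tilde_def pairing_def)
  fix x y assume "x \<in> dual_monoid A \<sigma>" "y \<in> dual_monoid A \<sigma>"
  then show "x + y \<in> dual_monoid A \<sigma>"
    using keys_add[of x y] by (auto simp: dual_monoid_def M_tilde_def pairing_add)
qed

definition perp_lattice ::
  "'e arrangement \<Rightarrow> ('e \<times> sign \<Rightarrow>\<^sub>0 real) set \<Rightarrow> ('e \<times> sign \<Rightarrow>\<^sub>0 int) set" where
  "perp_lattice A \<sigma> = {u \<in> M_tilde A. \<forall>v\<in>\<sigma>. pairing u v = 0}"


section \<open>Lawrence toric varieties and hypertoric varieties\<close>

text \<open>The toric variety is glued from the charts \<open>U\<^sub>\<sigma> = Spec K[\<sigma>\<^sup>\<or> \<inter> M]\<close> along faces. It is the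
  disjoint union of the orbits \<open>O(\<sigma>)\<close>, and \<open>O(\<sigma>)\<close> is the closed subset of \<open>U\<^sub>\<sigma>\<close> on which all
  characters in \<open>\<sigma>\<^sup>\<or>\<close> outside \<open>\<sigma>\<^sup>\<bottom>\<close> vanish; a point of \<open>O(\<sigma>)\<close> is listed in the chart \<open>U\<^sub>\<sigma>\<close>.\<close>

definition lawrence_atlas ::
  "'e arrangement \<Rightarrow>
   (('e \<times> sign \<Rightarrow>\<^sub>0 real) set, 'e \<times> sign \<Rightarrow>\<^sub>0 int, 'k::field) atlas" where
  "lawrence_atlas A =
     \<lparr>charts = lawrence_fan A, sub = (face_of), mon = dual_monoid A, van = (\<lambda>_. {0}),
      pts = {(\<sigma>, q). \<sigma> \<in> lawrence_fan A \<and> primeideal q (monoid_algebra (dual_monoid A \<sigma>)) \<and>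
               (\<forall>u \<in> dual_monoid A \<sigma> - perp_lattice A \<sigma>. monomial u \<in> q)}\<rparr>"

definition orbit ::
  "'e arrangement \<Rightarrow> ('e \<times> sign \<Rightarrow>\<^sub>0 real) set \<Rightarrow>
   (('e \<times> sign \<Rightarrow>\<^sub>0 real) set \<times> (('e \<times> sign \<Rightarrow>\<^sub>0 int) \<Rightarrow>\<^sub>0 'k::field) set) set" where
  "orbit A \<sigma> = {x \<in> pts (lawrence_atlas A). fst x = \<sigma>}"

text \<open>\<open>\<Phi>\<^sup>* x\<^sub>e\<close> is the character of the functional taking the value 1 on \<open>\<rho>\<^sub>e\<^sup>+\<close> and \<open>\<rho>\<^sub>e\<^sup>-\<close> and 0 on the
  other generators, that is, the composite of the lattice map underlying \<open>\<Phi>\<close> with the \<open>e\<close>-th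
  coordinate.\<close>

definition Phi_pullback :: "'e \<Rightarrow> (('e \<times> sign \<Rightarrow>\<^sub>0 int) \<Rightarrow>\<^sub>0 'k::field)" where
  "Phi_pullback e = monomial (Poly_Mapping.single (e, Pos) 1 + Poly_Mapping.single (e, Neg) 1)"

definition hypertoric_ideal ::
  "'e arrangement \<Rightarrow> ('e \<times> sign \<Rightarrow>\<^sub>0 real) set \<Rightarrow> (('e \<times> sign \<Rightarrow>\<^sub>0 int) \<Rightarrow>\<^sub>0 'k::field) set" where
  "hypertoric_ideal A \<sigma> =
     genideal (monoid_algebra (dual_monoid A \<sigma>))
       {\<Sum>e\<in>idx A. of_int (Poly_Mapping.lookup c e) * Phi_pullback e | c. c \<in> relations A}"

definition hypertoric_atlas ::
  "'e arrangement \<Rightarrow>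
   (('e \<times> sign \<Rightarrow>\<^sub>0 real) set, 'e \<times> sign \<Rightarrow>\<^sub>0 int, 'k::field) atlas" where
  "hypertoric_atlas A = closed_subatlas (lawrence_atlas A) (hypertoric_ideal A)"

abbreviation hypertoric ::
  "'e arrangement \<Rightarrow>
   (('e \<times> sign \<Rightarrow>\<^sub>0 real) set \<times> (('e \<times> sign \<Rightarrow>\<^sub>0 int) \<Rightarrow>\<^sub>0 'k) set,
    ((('e \<times> sign \<Rightarrow>\<^sub>0 int) \<Rightarrow>\<^sub>0 'k) \<times> (('e \<times> sign \<Rightarrow>\<^sub>0 int) \<Rightarrow>\<^sub>0 'k)) set,
    'k::field) k_space" where
  "hypertoric A \<equiv> scheme_of (hypertoric_atlas A)"

end

theory Submission
  imports Defs "HOL-Computational_Algebra.Polynomial_Factorial"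
begin

text \<open>If the \<open>a\<^sub>e\<close> are linearly independent, they form a basis of \<open>N\<close>, the Lawrence fan consists of the
  faces of an orthant, and the hypertoric variety is affine space.

  Otherwise let \<open>n = |E| + d\<close> be the dimension of the Lawrence toric variety, and suppose that all orbits
  are met properly. The orbit of the cone of a vertex is a point, it lies on the hypertoric variety since
  all \<open>x\<^sub>e\<close> vanish there, and the cone has dimension \<open>n\<close>; hence the hypertoric variety has
  dimension \<open>n\<close>. The intersection with the dense torus is nonempty, so that it has dimension \<open>n\<close> as
  well. But it is the zero locus of a nonzero ideal of the coordinate ring of an \<open>n\<close>-dimensional torus,
  whose dimension is less than \<open>n\<close>: elements \<open>g\<^sub>i \<in> P\<^sub>i - P\<^sub>i\<^sub>-\<^sub>1\<close> taken from a chain of prime ideals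
  are algebraically independent, and counting monomials in a box shows that at most \<open>n\<close> Laurent
  polynomials in \<open>n\<close> variables are.\<close>

abbreviation "keys \<equiv> Poly_Mapping.keys"
abbreviation "lookup \<equiv> Poly_Mapping.lookup"
abbreviation "single \<equiv> Poly_Mapping.single"

section \<open>Finitely supported functions\<close>

lemma poly_mapping_sum_single: "f = (\<Sum>u\<in>keys f. single u (lookup f u))"
  by (rule poly_mapping_eqI) (simp add: lookup_sum lookup_single when_def in_keys_iff)

lemma poly_mapping_eq_onI:
  assumes "keys u \<subseteq> Y" "keys v \<subseteq> Y" "\<And>x. x \<in> Y \<Longrightarrow> lookup u x = lookup v x"
  shows "u = v"
  using assms by (intro poly_mapping_eqI) (metis in_keys_iff subsetD)

definition poly_mapping_on :: "'x set \<Rightarrow> ('x \<Rightarrow> 'b::comm_monoid_add) \<Rightarrow> ('x \<Rightarrow>\<^sub>0 'b)" where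
  "poly_mapping_on Y h = (\<Sum>y\<in>Y. single y (h y))"

lemma lookup_poly_mapping_on:
  assumes "finite Y"
  shows "lookup (poly_mapping_on Y h) y = (if y \<in> Y then h y else 0)"
  using assms by (simp add: poly_mapping_on_def lookup_sum lookup_single when_def)

lemma keys_poly_mapping_on: "finite Y \<Longrightarrow> keys (poly_mapping_on Y h) \<subseteq> Y"
  by (auto simp: in_keys_iff lookup_poly_mapping_on split: if_splits)

definition relabel ::
  "('y \<Rightarrow> 'x) \<Rightarrow> 'y set \<Rightarrow> ('b::zero \<Rightarrow> 'c::comm_monoid_add) \<Rightarrow> ('x \<Rightarrow>\<^sub>0 'b) \<Rightarrow> ('y \<Rightarrow>\<^sub>0 'c)" where
  "relabel b Y h u = poly_mapping_on Y (\<lambda>y. h (lookup u (b y)))"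

lemma lookup_relabel:
  "finite Y \<Longrightarrow> lookup (relabel b Y h u) y = (if y \<in> Y then h (lookup u (b y)) else 0)"
  by (simp add: relabel_def lookup_poly_mapping_on)

lemma keys_relabel: "finite Y \<Longrightarrow> keys (relabel b Y h u) \<subseteq> Y"
  unfolding relabel_def by (rule keys_poly_mapping_on)

lemma relabel_0: "h 0 = 0 \<Longrightarrow> relabel b Y h 0 = 0"
  by (simp add: relabel_def poly_mapping_on_def)

lemma relabel_add:
  assumes "\<And>a b. h (a + b) = h a + h b"
  shows "relabel b Y h (u + v) = relabel b Y h u + relabel b Y h v"
  by (simp add: relabel_def poly_mapping_on_def lookup_add assms single_add sum.distrib)

lemma relabel_relabel_inverse:
  assumes finite_Y: "finite Y" "keys u \<subseteq> Y" and "finite X" "bij_betw b Y X"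
    and inverse: "\<And>y. y \<in> Y \<Longrightarrow> h (h' (lookup u y)) = lookup u y"
  shows "relabel b Y h (relabel (inv_into Y b) X h' u) = u"
  using assms bij_betw_apply[OF \<open>bij_betw b Y X\<close>]
  by (intro poly_mapping_eq_onI[of _ Y])
    (simp_all add: keys_relabel lookup_relabel bij_betw_inv_into_left)

section \<open>Monoid algebras\<close>

lemma monomial_add: "monomial (u + v) = monomial u * (monomial v :: _ \<Rightarrow>\<^sub>0 'k::field)"
  by (simp add: mult_single)

definition add_submonoid :: "'m::comm_monoid_add set \<Rightarrow> bool" where
  "add_submonoid S \<longleftrightarrow> 0 \<in> S \<and> (\<forall>x\<in>S. \<forall>y\<in>S. x + y \<in> S)"

lemma add_submonoid_keys_subset: "add_submonoid {u :: 'x \<Rightarrow>\<^sub>0 'b::comm_monoid_add. keys u \<subseteq> Y}"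
  unfolding add_submonoid_def
proof (intro conjI ballI)
  fix u v :: "'x \<Rightarrow>\<^sub>0 'b" assume "u \<in> {u. keys u \<subseteq> Y}" "v \<in> {u. keys u \<subseteq> Y}"
  then show "u + v \<in> {u. keys u \<subseteq> Y}" using keys_add[of u v] by blast
qed simp

lemma carrier_monoid_algebra: "f \<in> carrier (monoid_algebra S) \<longleftrightarrow> keys f \<subseteq> S"
  by (simp add: monoid_algebra_def)

lemma cring_add_submonoid: "add_submonoid S \<Longrightarrow> cring (monoid_algebra S :: (_ \<Rightarrow>\<^sub>0 'k::field) ring)"
  unfolding add_submonoid_def by (rule cring_monoid_algebra) auto

lemma keys_add_subset: "keys f \<subseteq> S \<Longrightarrow> keys g \<subseteq> S \<Longrightarrow> keys (f + g) \<subseteq> S"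
  using keys_add[of f g] by blast

lemma keys_diff_subset: "keys f \<subseteq> S \<Longrightarrow> keys g \<subseteq> S \<Longrightarrow> keys (f - g) \<subseteq> S"
  using keys_diff[of f g] by blast

lemma keys_sum_subset:
  assumes "\<And>i. i \<in> I \<Longrightarrow> keys (F i) \<subseteq> S"
  shows "keys (sum F I) \<subseteq> S"
  using keys_sum[of F I] assms by blast

context
  fixes S :: "'m::comm_monoid_add set"
  assumes submonoid: "add_submonoid S"
begin

lemma keys_const_subset: "keys (single 0 c :: _ \<Rightarrow>\<^sub>0 'k::field) \<subseteq> S"
  using submonoid by (simp add: add_submonoid_def)

lemma keys_mult_subset: "keys f \<subseteq> S \<Longrightarrow> keys g \<subseteq> S \<Longrightarrow> keys (f * g :: _ \<Rightarrow>\<^sub>0 'k::field) \<subseteq> S"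
  using keys_mult[of f g] submonoid unfolding add_submonoid_def by blast

lemma keys_power_subset: "keys f \<subseteq> S \<Longrightarrow> keys (f ^ n :: _ \<Rightarrow>\<^sub>0 'k::field) \<subseteq> S"
  by (induction n) (use keys_const_subset[of 1] in \<open>simp_all add: keys_mult_subset\<close>)

end

definition lin_ext :: "('k::zero \<Rightarrow> 'r::comm_ring_1) \<Rightarrow> ('m \<Rightarrow> 'r) \<Rightarrow> ('m \<Rightarrow>\<^sub>0 'k) \<Rightarrow> 'r" where
  "lin_ext s w f = (\<Sum>u\<in>keys f. s (lookup f u) * w u)"

locale algebra_hom =
  fixes S :: "'m::comm_monoid_add set" and s :: "'k::field \<Rightarrow> 'r::comm_ring_1" and w :: "'m \<Rightarrow> 'r"
  assumes submonoid: "add_submonoid S"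
    and s_0: "s 0 = 0" and s_1: "s 1 = 1" and s_add: "\<And>a b. s (a + b) = s a + s b"
    and s_mult: "\<And>a b. s (a * b) = s a * s b"
    and w_0: "w 0 = 1" and w_add: "\<And>u v. u \<in> S \<Longrightarrow> v \<in> S \<Longrightarrow> w (u + v) = w u * w v"
begin

lemma lin_ext_superset:
  assumes "finite Y" "keys f \<subseteq> Y"
  shows "lin_ext s w f = (\<Sum>u\<in>Y. s (lookup f u) * w u)"
  unfolding lin_ext_def
  by (rule sum.mono_neutral_left) (use assms in \<open>auto simp: in_keys_iff s_0\<close>)

lemma lin_ext_add: "lin_ext s w (f + g) = lin_ext s w f + lin_ext s w g"
  using keys_add[of f g]
  by (simp add: lin_ext_superset[of "keys f \<union> keys g"] lookup_add s_add distrib_right sum.distrib)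

lemma lin_ext_0: "lin_ext s w 0 = 0"
  by (simp add: lin_ext_def)

lemma lin_ext_single: "lin_ext s w (single u c) = s c * w u"
  by (simp add: lin_ext_def s_0)

lemma lin_ext_1: "lin_ext s w 1 = 1"
  using lin_ext_single[of 0 1] by (simp add: s_1 w_0)

lemma lin_ext_sum: "lin_ext s w (sum f I) = (\<Sum>i\<in>I. lin_ext s w (f i))"
  by (induction I rule: infinite_finite_induct) (auto simp: lin_ext_0 lin_ext_add)

lemma lin_ext_mult:
  assumes "keys f \<subseteq> S" "keys g \<subseteq> S"
  shows "lin_ext s w (f * g) = lin_ext s w f * lin_ext s w g"
proof -
  have "f * g = (\<Sum>u\<in>keys f. single u (lookup f u)) * (\<Sum>v\<in>keys g. single v (lookup g v))"
    by (simp flip: poly_mapping_sum_single)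
  also have "\<dots> = (\<Sum>u\<in>keys f. \<Sum>v\<in>keys g. single (u + v) (lookup f u * lookup g v))"
    by (simp add: sum_product mult_single)
  finally have "lin_ext s w (f * g) =
      (\<Sum>u\<in>keys f. \<Sum>v\<in>keys g. s (lookup f u * lookup g v) * w (u + v))"
    by (simp add: lin_ext_sum lin_ext_single)
  also have "\<dots> = (\<Sum>u\<in>keys f. \<Sum>v\<in>keys g. (s (lookup f u) * w u) * (s (lookup g v) * w v))"
    using assms[THEN subsetD] by (intro sum.cong refl) (simp add: s_mult w_add mult_ac)
  also have "\<dots> = lin_ext s w f * lin_ext s w g"
    by (simp add: lin_ext_def sum_product)
  finally show ?thesis .
qed

end

definition map_exponents :: "('m \<Rightarrow> 'n) \<Rightarrow> ('m \<Rightarrow>\<^sub>0 'k::comm_monoid_add) \<Rightarrow> ('n \<Rightarrow>\<^sub>0 'k)" where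
  "map_exponents r f = (\<Sum>u\<in>keys f. single (r u) (lookup f u))"

lemma map_exponents_superset:
  assumes "finite Y" "keys f \<subseteq> Y"
  shows "map_exponents r f = (\<Sum>u\<in>Y. single (r u) (lookup f u))"
  unfolding map_exponents_def
  by (rule sum.mono_neutral_left) (use assms in \<open>auto simp: in_keys_iff\<close>)

lemma map_exponents_0: "map_exponents r 0 = 0"
  by (simp add: map_exponents_def)

lemma map_exponents_single: "map_exponents r (single u c) = single (r u) c"
  by (simp add: map_exponents_def)

lemma map_exponents_add: "map_exponents r (f + g) = map_exponents r f + map_exponents r g"
  using keys_add[of f g]
  by (simp add: map_exponents_superset[of "keys f \<union> keys g"] lookup_add single_add sum.distrib)

lemma map_exponents_sum: "map_exponents r (sum f I) = (\<Sum>i\<in>I. map_exponents r (f i))"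
  by (induction I rule: infinite_finite_induct) (simp_all add: map_exponents_0 map_exponents_add)

lemma map_exponents_inverse:
  assumes "\<And>u. u \<in> keys f \<Longrightarrow> r' (r u) = u"
  shows "map_exponents r' (map_exponents r f) = f"
proof -
  have "map_exponents r' (map_exponents r f) = (\<Sum>u\<in>keys f. single u (lookup f u))"
    unfolding map_exponents_def[of r] using assms
    by (simp add: map_exponents_sum map_exponents_single)
  then show ?thesis by (simp flip: poly_mapping_sum_single)
qed

lemma keys_map_exponents: "keys (map_exponents r f) \<subseteq> r ` keys f"
  unfolding map_exponents_def by (rule keys_sum_subset) auto

lemma map_exponents_mult:
  fixes f g :: "'m::comm_monoid_add \<Rightarrow>\<^sub>0 'k::field" and r :: "'m \<Rightarrow> 'n::comm_monoid_add"
  assumes "add_submonoid S" "r 0 = 0" "\<And>u v. u \<in> S \<Longrightarrow> v \<in> S \<Longrightarrow> r (u + v) = r u + r v"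
    and "keys f \<subseteq> S" "keys g \<subseteq> S"
  shows "map_exponents r (f * g) = map_exponents r f * map_exponents r g"
proof -
  interpret algebra_hom S "single 0" "\<lambda>u. monomial (r u) :: 'n \<Rightarrow>\<^sub>0 'k"
    using assms(1-3) by unfold_locales (simp_all add: single_add mult_single)
  have "map_exponents r h = lin_ext (single 0) (\<lambda>u. monomial (r u)) h" for h :: "'m \<Rightarrow>\<^sub>0 'k"
    by (simp add: map_exponents_def lin_ext_def mult_single)
  then show ?thesis using lin_ext_mult[OF assms(4,5)] by simp
qed

lemma group_algebra_no_zero_divisors:
  fixes f g :: "('x \<Rightarrow>\<^sub>0 int) \<Rightarrow>\<^sub>0 'k::field"
  assumes "finite Y" and keys_f: "keys f \<subseteq> {u. keys u \<subseteq> Y}" and keys_g: "keys g \<subseteq> {u. keys u \<subseteq> Y}"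
    and "f * g = 0"
  shows "f = 0 \<or> g = 0"
proof -
  obtain b where bij_b: "bij_betw b Y {0..<card Y}"
    using ex_bij_betw_finite_nat[OF \<open>finite Y\<close>] by blast
  let ?r = "relabel (inv_into Y b) {0..<card Y} id :: ('x \<Rightarrow>\<^sub>0 int) \<Rightarrow> (nat \<Rightarrow>\<^sub>0 int)"
  have inverse: "map_exponents (relabel b Y id) (map_exponents ?r h) = h"
    if "keys h \<subseteq> {u. keys u \<subseteq> Y}" for h :: "('x \<Rightarrow>\<^sub>0 int) \<Rightarrow>\<^sub>0 'k"
    using that
    by (intro map_exponents_inverse relabel_relabel_inverse[OF \<open>finite Y\<close> _ _ bij_b]) auto
  have "map_exponents ?r f * map_exponents ?r g = 0"
    using map_exponents_mult[OF add_submonoid_keys_subset _ _ keys_f keys_g, of ?r] \<open>f * g = 0\<close>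
    by (simp add: relabel_0 relabel_add map_exponents_0)
  then have "map_exponents ?r f = 0 \<or> map_exponents ?r g = 0" by simp
  then show ?thesis using inverse[OF keys_f] inverse[OF keys_g] by (metis map_exponents_0)
qed

section \<open>Ideals of monoid algebras\<close>

locale monoid_algebra_ideal =
  fixes S :: "'m::comm_monoid_add set" and q :: "('m \<Rightarrow>\<^sub>0 'k::field) set"
  assumes submonoid: "add_submonoid S" and ideal: "ideal q (monoid_algebra S)"
begin

interpretation ideal q "monoid_algebra S" by (rule ideal)

lemma keys_subset: "f \<in> q \<Longrightarrow> keys f \<subseteq> S"
  using a_subset by (auto simp: monoid_algebra_def)

lemma zero_mem: "0 \<in> q"
  using additive_subgroup.zero_closed[OF additive_subgroup_axioms] by (simp add: monoid_algebra_def)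

lemma add_mem: "f \<in> q \<Longrightarrow> g \<in> q \<Longrightarrow> f + g \<in> q"
  using additive_subgroup.a_closed[OF additive_subgroup_axioms, of f g]
  by (simp add: monoid_algebra_def)

lemma mult_mem: "f \<in> q \<Longrightarrow> keys g \<subseteq> S \<Longrightarrow> g * f \<in> q"
  using I_l_closed[of f g] by (simp add: monoid_algebra_def)

lemma diff_mem:
  assumes "f \<in> q" "g \<in> q"
  shows "f - g \<in> q"
  using add_mem[OF assms(1) mult_mem[OF assms(2), of "- 1"]] submonoid
  by (simp add: add_submonoid_def)

lemma sum_mem: "(\<And>i. i \<in> I \<Longrightarrow> F i \<in> q) \<Longrightarrow> sum F I \<in> q"
  by (induction I rule: infinite_finite_induct) (simp_all add: zero_mem add_mem)

lemma mem_if_monomials_mem: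
  assumes "\<And>u. u \<in> keys f \<Longrightarrow> monomial u \<in> q"
  shows "f \<in> q"
proof -
  have "single 0 (lookup f u) * monomial u \<in> q" if "u \<in> keys f" for u
    by (intro mult_mem assms that keys_const_subset submonoid)
  then have "(\<Sum>u\<in>keys f. single u (lookup f u)) \<in> q"
    by (intro sum_mem) (simp add: mult_single)
  then show ?thesis by (simp flip: poly_mapping_sum_single)
qed

end

locale monoid_algebra_prime =
  fixes S :: "'m::comm_monoid_add set" and q :: "('m \<Rightarrow>\<^sub>0 'k::field) set"
  assumes submonoid: "add_submonoid S" and primeideal: "primeideal q (monoid_algebra S)"

lemma monoid_algebra_prime_imp_ideal: "monoid_algebra_prime S q \<Longrightarrow> monoid_algebra_ideal S q"
  unfolding monoid_algebra_prime_def monoid_algebra_ideal_def by (blast intro: primeideal.axioms(1))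

sublocale monoid_algebra_prime \<subseteq> monoid_algebra_ideal
  by (rule monoid_algebra_prime_imp_ideal, rule monoid_algebra_prime_axioms)

context monoid_algebra_prime
begin

lemma one_notin: "1 \<notin> q"
  using primeideal.I_notcarr[OF primeideal] ideal.one_imp_carrier[OF ideal]
  by (auto simp: monoid_algebra_def)

lemma nonzero_if_notin: "f \<notin> q \<Longrightarrow> f \<noteq> 0"
  using zero_mem by blast

lemma mult_mem_iff:
  assumes "keys f \<subseteq> S" "keys g \<subseteq> S"
  shows "f * g \<in> q \<longleftrightarrow> f \<in> q \<or> g \<in> q"
  using primeideal.I_prime[OF primeideal, of f g] mult_mem[of f g] mult_mem[of g f] assms
  by (auto simp: monoid_algebra_def mult.commute[of g f])

lemma power_notin: "keys f \<subseteq> S \<Longrightarrow> f \<notin> q \<Longrightarrow> f ^ n \<notin> q"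
  by (induction n) (simp_all add: one_notin mult_mem_iff keys_power_subset[OF submonoid])

lemma prod_mem_imp:
  assumes "finite I" "\<And>i. i \<in> I \<Longrightarrow> keys (F i) \<subseteq> S" "prod F I \<in> q"
  obtains i where "i \<in> I" "F i \<in> q"
proof -
  have "keys (prod F I) \<subseteq> S \<and> (prod F I \<in> q \<longrightarrow> (\<exists>i\<in>I. F i \<in> q))"
    using assms(1,2)
    by (induction I) (simp_all add: one_notin keys_const_subset[OF submonoid, of 1, simplified]
        keys_mult_subset[OF submonoid] mult_mem_iff)
  then show thesis using assms(3) that by blast
qed

lemma const_mem_iff: "single 0 c \<in> q \<longleftrightarrow> c = 0"
proof
  assume "single 0 c \<in> q"
  then have "single 0 (inverse c) * single 0 c \<in> q"
    by (intro mult_mem keys_const_subset submonoid)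
  then have "single 0 (inverse c * c) \<in> q"
    by (simp add: mult_single)
  then show "c = 0"
    using one_notin by (cases "c = 0") auto
qed (simp add: zero_mem)

lemma invertible_monomial_notin:
  assumes "u \<in> S" "v \<in> S" "u + v = 0"
  shows "monomial u \<notin> q"
proof -
  have "monomial u * monomial v \<notin> q"
    using assms(3) one_notin by (simp add: mult_single)
  then show ?thesis
    using mult_mem_iff[of "monomial u" "monomial v"] assms by simp
qed

end

lemma monoid_algebra_primeI:
  fixes q :: "('m::comm_monoid_add \<Rightarrow>\<^sub>0 'k::field) set"
  assumes submonoid: "add_submonoid S" and subset: "\<And>f. f \<in> q \<Longrightarrow> keys f \<subseteq> S" and "0 \<in> q"
    and add: "\<And>f g. f \<in> q \<Longrightarrow> g \<in> q \<Longrightarrow> f + g \<in> q"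
    and mult: "\<And>f g. f \<in> q \<Longrightarrow> keys g \<subseteq> S \<Longrightarrow> g * f \<in> q"
    and one: "1 \<notin> q"
    and prime: "\<And>f g. keys f \<subseteq> S \<Longrightarrow> keys g \<subseteq> S \<Longrightarrow> f * g \<in> q \<Longrightarrow> f \<in> q \<or> g \<in> q"
  shows "monoid_algebra_prime S q"
proof (rule monoid_algebra_prime.intro[OF submonoid])
  interpret R: cring "monoid_algebra S :: ('m \<Rightarrow>\<^sub>0 'k) ring"
    by (rule cring_add_submonoid[OF submonoid])
  have "subgroup q (add_monoid (monoid_algebra S))"
  proof (rule R.add.subgroupI)
    fix f assume f_in_q: "f \<in> q"
    have minus: "- f \<in> q"
      using mult[OF f_in_q, of "- 1"] submonoid by (simp add: add_submonoid_def)
    then have "\<ominus>\<^bsub>monoid_algebra S\<^esub> f = - f"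
      using f_in_q subset by (intro R.minus_equality) (auto simp: monoid_algebra_def)
    then show "\<ominus>\<^bsub>monoid_algebra S\<^esub> f \<in> q" using minus by simp
  qed (use subset \<open>0 \<in> q\<close> add in \<open>auto simp: monoid_algebra_def\<close>)
  then have "ideal q (monoid_algebra S)"
    using mult by (intro idealI R.ring_axioms) (simp_all add: monoid_algebra_def mult.commute)
  moreover have "carrier (monoid_algebra S) \<noteq> q"
    using one submonoid by (auto simp: monoid_algebra_def add_submonoid_def)
  ultimately show "primeideal q (monoid_algebra S)"
    by (rule primeidealI[OF _ R.is_cring]) (use prime in \<open>simp add: monoid_algebra_def\<close>)
qed

lemma (in algebra_hom) monoid_algebra_prime_kernel:
  assumes "\<And>x y :: 'r. x * y = 0 \<Longrightarrow> x = 0 \<or> y = 0" and "(1 :: 'r) \<noteq> 0"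
  shows "monoid_algebra_prime S {f. keys f \<subseteq> S \<and> lin_ext s w f = 0}"
  by (rule monoid_algebra_primeI[OF submonoid])
    (use assms in \<open>auto simp: lin_ext_0 lin_ext_1 lin_ext_add lin_ext_mult
      keys_mult_subset[OF submonoid] keys_add_subset\<close>)

lemma monoid_algebra_prime_zero:
  fixes S :: "('x \<Rightarrow>\<^sub>0 int) set"
  assumes submonoid: "add_submonoid S" "S \<subseteq> {u. keys u \<subseteq> Y}" and "finite Y"
  shows "monoid_algebra_prime S ({0} :: (_ \<Rightarrow>\<^sub>0 'k::field) set)"
proof (rule monoid_algebra_primeI[OF submonoid(1)])
  fix f g :: "_ \<Rightarrow>\<^sub>0 'k"
  assume "keys f \<subseteq> S" "keys g \<subseteq> S" "f * g \<in> {0}"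
  then show "f \<in> {0} \<or> g \<in> {0}"
    using group_algebra_no_zero_divisors[OF \<open>finite Y\<close>, of f g] submonoid(2) by auto
qed auto

lemma monoid_algebra_prime_vimage:
  fixes r :: "'m::comm_monoid_add \<Rightarrow> 'n::comm_monoid_add" and q :: "('n \<Rightarrow>\<^sub>0 'k::field) set"
  assumes submonoid: "add_submonoid S"
    and additive: "r 0 = 0" "\<And>u v. u \<in> S \<Longrightarrow> v \<in> S \<Longrightarrow> r (u + v) = r u + r v"
    and prime_q: "monoid_algebra_prime T q" and subset: "r ` S \<subseteq> T"
  shows "monoid_algebra_prime S {f. keys f \<subseteq> S \<and> map_exponents r f \<in> q}"
proof -
  interpret q: monoid_algebra_prime T q by (rule prime_q)
  have keys: "keys (map_exponents r f) \<subseteq> T" if "keys f \<subseteq> S" for f :: "'m \<Rightarrow>\<^sub>0 'k"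
    using keys_map_exponents[of r f] subset that by blast
  have mult: "map_exponents r (f * g) = map_exponents r f * map_exponents r g"
    if "keys f \<subseteq> S" "keys g \<subseteq> S" for f g :: "'m \<Rightarrow>\<^sub>0 'k"
    using submonoid additive that by (rule map_exponents_mult)
  have one: "map_exponents r 1 = (1 :: _ \<Rightarrow>\<^sub>0 'k)"
    by (simp add: map_exponents_def additive(1))
  show ?thesis
    by (rule monoid_algebra_primeI[OF submonoid])
      (auto simp: map_exponents_0 map_exponents_add mult one keys q.zero_mem q.one_notin
        q.add_mem q.mult_mem q.mult_mem_iff keys_add_subset keys_mult_subset[OF submonoid])
qed

definition augmentation_ideal :: "'m::comm_monoid_add set \<Rightarrow> ('m \<Rightarrow>\<^sub>0 'k::field) set" where
  "augmentation_ideal S = {f. keys f \<subseteq> S - {0}}"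

lemma monoid_algebra_prime_augmentation_ideal:
  fixes S :: "'m::comm_monoid_add set"
  assumes submonoid: "add_submonoid S" and pointed: "\<And>u v. u \<in> S \<Longrightarrow> v \<in> S \<Longrightarrow> u + v = 0 \<Longrightarrow> u = 0"
  shows "monoid_algebra_prime S (augmentation_ideal S :: (_ \<Rightarrow>\<^sub>0 'k::field) set)"
proof -
  let ?w = "\<lambda>u :: 'm. if u = 0 then 1 else 0 :: 'k"
  interpret algebra_hom S id ?w
  proof
    show "?w (u + v) = ?w u * ?w v" if "u \<in> S" "v \<in> S" for u v
      using pointed[OF that] pointed[OF that(2,1)] by (auto simp: add.commute)
  qed (simp_all add: submonoid)
  have "lin_ext id ?w f = lookup f 0" for f
    by (simp add: lin_ext_def in_keys_iff if_distrib cong: if_cong)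
  then have "augmentation_ideal S = {f. keys f \<subseteq> S \<and> lin_ext id ?w f = 0}"
    by (auto simp: augmentation_ideal_def in_keys_iff)
  then show ?thesis
    using monoid_algebra_prime_kernel by simp
qed

lemma (in monoid_algebra_prime) eq_augmentation_idealI:
  assumes "\<And>u. u \<in> S - {0} \<Longrightarrow> monomial u \<in> q"
  shows "q = augmentation_ideal S"
proof
  show sub: "augmentation_ideal S \<subseteq> q"
    by (rule subsetI, rule mem_if_monomials_mem) (use assms in \<open>auto simp: augmentation_ideal_def\<close>)
  show "q \<subseteq> augmentation_ideal S"
  proof
    fix f assume f_in_q: "f \<in> q"
    let ?f = "f - single 0 (lookup f 0)"
    have keys: "keys ?f \<subseteq> S - {0}"
      using keys_diff_subset[OF keys_subset[OF f_in_q]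
        keys_const_subset[OF submonoid, of "lookup f 0"]]
      by (auto simp: in_keys_iff lookup_minus)
    have "f - ?f \<in> q"
      by (rule diff_mem[OF f_in_q]) (use sub keys in \<open>auto simp: augmentation_ideal_def\<close>)
    then have "lookup f 0 = 0"
      by (simp add: const_mem_iff)
    then show "f \<in> augmentation_ideal S"
      using keys by (simp add: augmentation_ideal_def)
  qed
qed

section \<open>Monomial localizations\<close>

locale monoid_localization =
  fixes S U S' :: "'m::comm_monoid_add set"
  assumes submonoid: "add_submonoid S" and submonoid': "add_submonoid S'"
    and submonoid_units: "add_submonoid U" and U_subset: "U \<subseteq> S" and S_subset: "S \<subseteq> S'"
    and units: "\<And>u. u \<in> U \<Longrightarrow> \<exists>v\<in>S'. u + v = 0"
    and denominators: "\<And>v. v \<in> S' \<Longrightarrow> \<exists>u\<in>U. u + v \<in> S"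
begin

lemma common_denominator: "finite V \<Longrightarrow> V \<subseteq> S' \<Longrightarrow> \<exists>u\<in>U. \<forall>v\<in>V. u + v \<in> S"
proof (induction V rule: finite_induct)
  case empty
  then show ?case using submonoid_units by (auto simp: add_submonoid_def)
next
  case (insert v V)
  then obtain u u' where clears_V: "u \<in> U" "\<forall>v\<in>V. u + v \<in> S" and clears_u'v: "u' \<in> U" "u' + v \<in> S"
    using denominators[of v] by auto
  have "u' + (u + x) \<in> S" if "x \<in> V" for x
    using clears_V clears_u'v that U_subset submonoid by (auto simp: add_submonoid_def)
  moreover have "u + (u' + v) \<in> S"
    using clears_V clears_u'v U_subset submonoid by (auto simp: add_submonoid_def)
  moreover have "u + u' \<in> U"
    using clears_V clears_u'v submonoid_units by (auto simp: add_submonoid_def)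
  ultimately show ?case
    by (intro bexI[of _ "u + u'"]) (auto simp: add_ac)
qed

lemma clear_denominators:
  fixes f g :: "'m \<Rightarrow>\<^sub>0 'k::field"
  assumes "keys f \<subseteq> S'" "keys g \<subseteq> S'"
  obtains u where "u \<in> U" "keys (monomial u * f) \<subseteq> S" "keys (monomial u * g) \<subseteq> S"
proof -
  obtain u where clears: "u \<in> U" "\<forall>v\<in>keys f \<union> keys g. u + v \<in> S"
    using common_denominator[of "keys f \<union> keys g"] assms by auto
  have "keys (monomial u * h) \<subseteq> S" if "keys h \<subseteq> keys f \<union> keys g" for h :: "'m \<Rightarrow>\<^sub>0 'k"
    using keys_mult[of "monomial u :: _ \<Rightarrow>\<^sub>0 'k" h] clears that by fastforce
  then show thesis using that clears by blast
qed

lemma monomial_notin: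
  assumes "monoid_algebra_prime S' (q :: (_ \<Rightarrow>\<^sub>0 'k::field) set)" "u \<in> U"
  shows "monomial u \<notin> q"
  using monoid_algebra_prime.invertible_monomial_notin[OF assms(1)] units[OF assms(2)] assms(2)
    U_subset S_subset by blast

lemma monomial_mult_mem_iff:
  assumes "monoid_algebra_prime S' (q :: (_ \<Rightarrow>\<^sub>0 'k::field) set)" "u \<in> U" "keys f \<subseteq> S'"
  shows "monomial u * f \<in> q \<longleftrightarrow> f \<in> q"
  using monoid_algebra_prime.mult_mem_iff[OF assms(1), of "monomial u" f]
    monomial_notin[OF assms(1,2)]
    assms U_subset S_subset by auto

lemma prime_eqI:
  fixes q q' :: "('m \<Rightarrow>\<^sub>0 'k::field) set"
  assumes prime_q: "monoid_algebra_prime S' q" and prime_q': "monoid_algebra_prime S' q'"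
    and eq: "\<And>f. keys f \<subseteq> S \<Longrightarrow> f \<in> q \<longleftrightarrow> f \<in> q'"
  shows "q = q'"
proof -
  interpret q: monoid_algebra_prime S' q by (rule prime_q)
  interpret q': monoid_algebra_prime S' q' by (rule prime_q')
  have "f \<in> q \<longleftrightarrow> f \<in> q'" if keys_f: "keys f \<subseteq> S'" for f
  proof -
    obtain u where clears: "u \<in> U" "keys (monomial u * f) \<subseteq> S"
      by (rule clear_denominators[OF keys_f keys_f])
    have "f \<in> q \<longleftrightarrow> monomial u * f \<in> q"
      using monomial_mult_mem_iff[OF prime_q clears(1) keys_f] by simp
    also have "\<dots> \<longleftrightarrow> monomial u * f \<in> q'" by (rule eq[OF clears(2)])
    also have "\<dots> \<longleftrightarrow> f \<in> q'" by (rule monomial_mult_mem_iff[OF prime_q' clears(1) keys_f])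
    finally show ?thesis .
  qed
  then show ?thesis
    using q.keys_subset q'.keys_subset by blast
qed

lemma monomial_mult_product:
  "(monomial u * f) * (monomial u * g) = monomial (u + u) * (f * (g :: 'm \<Rightarrow>\<^sub>0 'k::field))"
  by (simp only: monomial_add mult_ac)

lemma double_unit: "u \<in> U \<Longrightarrow> u + u \<in> U"
  using submonoid_units by (simp add: add_submonoid_def)

definition extension :: "('m \<Rightarrow>\<^sub>0 'k::field) set \<Rightarrow> ('m \<Rightarrow>\<^sub>0 'k) set" where
  "extension p = {f. keys f \<subseteq> S' \<and> (\<exists>u\<in>U. monomial u * f \<in> p)}"

context
  fixes p :: "('m \<Rightarrow>\<^sub>0 'k::field) set"
  assumes prime: "monoid_algebra_prime S p" and units_notin: "\<And>u. u \<in> U \<Longrightarrow> monomial u \<notin> p"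
begin

interpretation p: monoid_algebra_prime S p by (rule prime)

lemma mem_extension_iff:
  assumes "keys f \<subseteq> S"
  shows "f \<in> extension p \<longleftrightarrow> f \<in> p"
proof
  assume "f \<in> extension p"
  then obtain u where "u \<in> U" "monomial u * f \<in> p" by (auto simp: extension_def)
  then show "f \<in> p"
    using p.mult_mem_iff[of "monomial u" f] units_notin[of u] subsetD[OF U_subset, of u] assms
    by simp
next
  assume "f \<in> p"
  moreover have "0 \<in> U" using submonoid_units by (simp add: add_submonoid_def)
  ultimately show "f \<in> extension p"
    using assms S_subset by (auto simp: extension_def intro!: bexI[of _ 0])
qed

lemma monomial_mult_extensionD:
  assumes "f \<in> extension p" "keys (monomial v * f) \<subseteq> S" "v \<in> U"
  shows "monomial v * f \<in> p"
proof -
  obtain u where witness: "u \<in> U" "monomial u * f \<in> p"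
    using assms(1) by (auto simp: extension_def)
  have "monomial v * (monomial u * f) \<in> p"
    by (rule p.mult_mem[OF witness(2)]) (use assms(3) U_subset in auto)
  then have "monomial u * (monomial v * f) \<in> p"
    by (simp add: mult.left_commute)
  then show ?thesis
    using p.mult_mem_iff[of "monomial u" "monomial v * f"] units_notin[OF witness(1)]
      subsetD[OF U_subset witness(1)] assms(2)
    by simp
qed

lemma monoid_algebra_prime_extension: "monoid_algebra_prime S' (extension p)"
proof (rule monoid_algebra_primeI[OF submonoid'])
  fix f g :: "'m \<Rightarrow>\<^sub>0 'k"
  show "f + g \<in> extension p" if "f \<in> extension p" "g \<in> extension p"
  proof -
    have keys: "keys f \<subseteq> S'" "keys g \<subseteq> S'" using that by (auto simp: extension_def)
    then obtain u where clears: "u \<in> U" "keys (monomial u * f) \<subseteq> S" "keys (monomial u * g) \<subseteq> S"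
      by (rule clear_denominators)
    then have "monomial u * f + monomial u * g \<in> p"
      using that by (intro p.add_mem monomial_mult_extensionD)
    then show ?thesis
      using clears(1) keys
      by (auto simp: extension_def keys_add_subset distrib_left intro!: bexI[of _ u])
  qed
  show "g * f \<in> extension p" if f_in_extension: "f \<in> extension p" and keys_g: "keys g \<subseteq> S'"
  proof -
    have keys: "keys f \<subseteq> S'" using f_in_extension by (auto simp: extension_def)
    then obtain u where clears: "u \<in> U" "keys (monomial u * f) \<subseteq> S" "keys (monomial u * g) \<subseteq> S"
      using clear_denominators[OF _ keys_g] by blast
    then have "(monomial u * g) * (monomial u * f) \<in> p"
      using f_in_extension by (intro p.mult_mem monomial_mult_extensionD)
    then show ?thesis
      using keys keys_g double_unit[OF clears(1)]
      by (auto simp: extension_def keys_mult_subset[OF submonoid'] monomial_mult_product)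
  qed
  show "f \<in> extension p \<or> g \<in> extension p"
    if keys_f: "keys f \<subseteq> S'" and keys_g: "keys g \<subseteq> S'"
      and product_in_extension: "f * g \<in> extension p"
  proof -
    obtain u where clears: "u \<in> U" "keys (monomial u * f) \<subseteq> S" "keys (monomial u * g) \<subseteq> S"
      using clear_denominators[OF keys_f keys_g] by blast
    have "(monomial u * f) * (monomial u * g) \<in> p"
      using monomial_mult_extensionD[OF product_in_extension _ double_unit[OF clears(1)]]
        keys_mult_subset[OF submonoid clears(2,3)] by (simp only: monomial_mult_product)
    then show ?thesis
      using p.mult_mem_iff[OF clears(2,3)] clears(1) keys_f keys_g by (auto simp: extension_def)
  qed
qed (use mem_extension_iff[of 0] mem_extension_iff[of 1] p.zero_mem p.one_notin submonoid in
    \<open>auto simp: add_submonoid_def extension_def\<close>)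

end

end

section \<open>Chains of prime ideals\<close>

lemma (in vector_space) independent_family:
  assumes "finite I"
    and zero: "\<And>c i. (\<Sum>i\<in>I. scale (c i) (F i)) = 0 \<Longrightarrow> i \<in> I \<Longrightarrow> c i = 0"
  shows "inj_on F I" and "independent (F ` I)"
proof -
  show inj: "inj_on F I"
  proof (rule inj_onI, rule ccontr)
    fix i j assume collision: "i \<in> I" "j \<in> I" "F i = F j" "i \<noteq> j"
    let ?c = "\<lambda>k. if k = i then 1 else if k = j then - 1 else (0 :: 'a)"
    have "(\<Sum>k\<in>I. scale (?c k) (F k)) = (\<Sum>k\<in>{i, j}. scale (?c k) (F k))"
      by (rule sum.mono_neutral_right) (use collision \<open>finite I\<close> in auto)
    also have "\<dots> = 0" using collision by simp
    finally have "?c i = 0" by (rule zero[of ?c, OF _ collision(1)])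
    then show False by simp
  qed
  show "independent (F ` I)"
  proof (rule independent_if_scalars_zero)
    fix c x assume "(\<Sum>x\<in>F ` I. scale (c x) x) = 0" and x_in_image: "x \<in> F ` I"
    then have "(\<Sum>i\<in>I. scale (c (F i)) (F i)) = 0"
      by (simp add: sum.reindex[OF inj])
    then show "c x = 0" using zero[of "\<lambda>i. c (F i)"] x_in_image by blast
  qed (simp add: \<open>finite I\<close>)
qed

interpretation monoid_algebra: vector_space
  "\<lambda>c (f :: 'm::comm_monoid_add \<Rightarrow>\<^sub>0 'k::field). single 0 c * f"
  by unfold_locales
    (simp_all add: distrib_left distrib_right single_add mult_single flip: mult.assoc)

lemma in_span_monomials:
  fixes f :: "'m::comm_monoid_add \<Rightarrow>\<^sub>0 'k::field"
  assumes "keys f \<subseteq> T"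
  shows "f \<in> monoid_algebra.span (monomial ` T)"
proof -
  have "(\<Sum>u\<in>keys f. single 0 (lookup f u) * monomial u) \<in> monoid_algebra.span (monomial ` T)"
    by (intro monoid_algebra.span_sum monoid_algebra.span_scale monoid_algebra.span_base)
      (use assms in auto)
  then show ?thesis by (simp add: mult_single flip: poly_mapping_sum_single)
qed

definition power_product :: "'a::comm_ring_1 list \<Rightarrow> nat list \<Rightarrow> 'a" where
  "power_product gs as = prod_list (map2 (^) gs as)"

lemma power_product_Nil [simp]: "power_product [] as = 1" "power_product gs [] = 1"
  by (simp_all add: power_product_def)

lemma power_product_Cons [simp]: "power_product (g # gs) (a # as) = g ^ a * power_product gs as"
  by (simp add: power_product_def)

lemma keys_power_product_subset:
  assumes "add_submonoid S" "\<And>g. g \<in> set gs \<Longrightarrow> keys (g :: _ \<Rightarrow>\<^sub>0 'k::field) \<subseteq> S"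
  shows "keys (power_product gs as) \<subseteq> S"
  using assms(2) keys_const_subset[OF assms(1), of 1]
  by (induction gs as rule: list_induct2')
    (simp_all add: keys_mult_subset[OF assms(1)] keys_power_subset[OF assms(1)])

definition exponents :: "nat \<Rightarrow> nat \<Rightarrow> nat list set" where
  "exponents D m = {as. set as \<subseteq> {..<D} \<and> length as = m}"

lemma finite_exponents: "finite (exponents D m)" and card_exponents: "card (exponents D m) = D ^ m"
  unfolding exponents_def by (simp_all add: finite_lists_length_eq card_lists_length_eq)

lemma exponents_0: "exponents D 0 = {[]}"
  by (auto simp: exponents_def)

lemma sum_exponents_Suc:
  "(\<Sum>as\<in>exponents D (Suc m). F as) = (\<Sum>a<D. \<Sum>as\<in>exponents D m. F (a # as))"
proof -
  have "exponents D (Suc m) = (\<lambda>(a, as). a # as) ` ({..<D} \<times> exponents D m)"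
    by (auto simp: exponents_def length_Suc_conv image_iff)
  moreover have "inj_on (\<lambda>(a, as). a # as) ({..<D} \<times> exponents D m)"
    by (auto simp: inj_on_def)
  ultimately show ?thesis
    by (simp add: sum.reindex sum.cartesian_product case_prod_unfold)
qed

fun prime_chain :: "'m::comm_monoid_add set \<Rightarrow> ('m \<Rightarrow>\<^sub>0 'k::field) set \<Rightarrow> ('m \<Rightarrow>\<^sub>0 'k) list \<Rightarrow> bool"
  where
  "prime_chain S P [] \<longleftrightarrow> monoid_algebra_prime S P"
| "prime_chain S P (g # gs) \<longleftrightarrow> monoid_algebra_prime S P \<and> keys g \<subseteq> S \<and> g \<notin> P \<and>
     (\<exists>Q. P \<subseteq> Q \<and> g \<in> Q \<and> prime_chain S Q gs)"

lemma prime_chain_prime: "prime_chain S P gs \<Longrightarrow> monoid_algebra_prime S P"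
  by (cases gs) auto

lemma prime_chain_keys_subset: "prime_chain S P gs \<Longrightarrow> g \<in> set gs \<Longrightarrow> keys g \<subseteq> S"
  by (induction gs arbitrary: P) auto

lemma lowest_coefficient_mem:
  fixes P Q :: "('m::comm_monoid_add \<Rightarrow>\<^sub>0 'k::field) set"
  assumes "monoid_algebra_prime S P" "monoid_algebra_ideal S Q" "P \<subseteq> Q"
    and new_element: "keys g \<subseteq> S" "g \<in> Q" "g \<notin> P" and keys_h: "\<And>a. keys (h a) \<subseteq> S"
    and sum: "(\<Sum>b<D. g ^ b * h b) \<in> P" and "a < D" and zero: "\<And>b. b < a \<Longrightarrow> h b = 0"
  shows "h a \<in> Q"
proof -
  interpret P: monoid_algebra_prime S P by fact
  interpret Q: monoid_algebra_ideal S Q by fact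
  define r where "r = (\<Sum>b\<in>{Suc a..<D}. g ^ (b - Suc a) * h b)"
  have keys_r: "keys r \<subseteq> S"
    unfolding r_def
    by (intro keys_sum_subset keys_mult_subset keys_power_subset P.submonoid new_element keys_h)
  have "(\<Sum>b<D. g ^ b * h b) = (\<Sum>b\<in>{a..<D}. g ^ b * h b)"
    by (rule sum.mono_neutral_right) (use zero in \<open>auto simp: not_le\<close>)
  also have "\<dots> = g ^ a * h a + (\<Sum>b\<in>{Suc a..<D}. g ^ b * h b)"
    using \<open>a < D\<close> by (simp add: sum.atLeast_Suc_lessThan)
  also have "(\<Sum>b\<in>{Suc a..<D}. g ^ b * h b) = g ^ a * (g * r)"
    unfolding r_def sum_distrib_left
  proof (rule sum.cong)
    fix b assume "b \<in> {Suc a..<D}"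
    then have "g ^ b = g ^ a * (g * g ^ (b - Suc a))"
      by (simp flip: power_Suc power_add)
    then show "g ^ b * h b = g ^ a * (g * (g ^ (b - Suc a) * h b))" by (simp add: mult.assoc)
  qed simp
  finally have "g ^ a * (h a + g * r) \<in> P"
    using sum by (simp add: distrib_left)
  moreover have "keys (h a + g * r) \<subseteq> S"
    by (intro keys_add_subset keys_mult_subset P.submonoid keys_h new_element keys_r)
  ultimately have "h a + g * r \<in> P"
    using P.mult_mem_iff[OF keys_power_subset[OF P.submonoid new_element(1)]]
      P.power_notin[OF new_element(1,3)] by blast
  moreover have "r * g \<in> Q"
    by (rule Q.mult_mem[OF new_element(2) keys_r])
  ultimately show "h a \<in> Q"
    using Q.diff_mem[of "h a + g * r" "r * g"] \<open>P \<subseteq> Q\<close> by (auto simp: mult.commute)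
qed

text \<open>In a relation among power products, collect the powers of the first element and reduce the
  coefficients modulo the next prime, starting with the lowest one.\<close>

lemma prime_chain_coefficients_zero:
  fixes c :: "nat list \<Rightarrow> 'k::field"
  assumes submonoid: "add_submonoid S" and "prime_chain S P gs"
    and "(\<Sum>as\<in>exponents D (length gs). single 0 (c as) * power_product gs as) \<in> P"
    and "as \<in> exponents D (length gs)"
  shows "c as = 0"
  using assms(2-)
proof (induction gs arbitrary: P c as)
  case Nil
  then show ?case
    using monoid_algebra_prime.const_mem_iff[of S P "c []"] by (simp add: exponents_0)
next
  case (Cons g gs)
  let ?E = "exponents D (length gs)"
  define h where "h a = (\<Sum>as\<in>?E. single 0 (c (a # as)) * power_product gs as)" for a
  obtain Q where prime_P: "monoid_algebra_prime S P" and new_element: "keys g \<subseteq> S" "g \<notin> P"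
    and chain_Q: "P \<subseteq> Q" "g \<in> Q" "prime_chain S Q gs"
    using Cons.prems(1) by auto
  interpret Q: monoid_algebra_prime S Q by (rule prime_chain_prime[OF chain_Q(3)])
  have keys_h: "keys (h a) \<subseteq> S" for a
    unfolding h_def
    by (intro keys_sum_subset keys_mult_subset keys_const_subset keys_power_product_subset
        submonoid prime_chain_keys_subset[OF chain_Q(3)])
  have sum: "(\<Sum>a<D. g ^ a * h a) \<in> P"
    using Cons.prems(2) by (simp add: sum_exponents_Suc h_def sum_distrib_left mult_ac)
  have zero: "\<forall>bs\<in>?E. c (a # bs) = 0" if "a < D" for a
    using that
  proof (induction a rule: less_induct)
    case (less a)
    have "h b = 0" if "b < a" for b
      using less.IH[of b] that less.prems by (simp add: h_def)
    then have "h a \<in> Q"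
      by (rule lowest_coefficient_mem[OF prime_P Q.monoid_algebra_ideal_axioms chain_Q(1)
        new_element(1) chain_Q(2) new_element(2) keys_h
            sum less.prems])
    then show ?case
      using Cons.IH[OF chain_Q(3), of "\<lambda>bs. c (a # bs)"] unfolding h_def by blast
  qed
  obtain a bs where "as = a # bs" "a < D" "bs \<in> ?E"
    using Cons.prems(3) by (auto simp: exponents_def length_Suc_conv)
  then show ?case using zero by blast
qed

lemma prime_chain_independent:
  fixes gs :: "('m::comm_monoid_add \<Rightarrow>\<^sub>0 'k::field) list"
  assumes chain: "prime_chain S P gs"
  shows "inj_on (power_product gs) (exponents D (length gs))"
    and "monoid_algebra.independent (power_product gs ` exponents D (length gs))"
proof -
  interpret P: monoid_algebra_prime S P by (rule prime_chain_prime[OF chain])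
  have zero: "c as = 0"
    if "(\<Sum>as\<in>exponents D (length gs). single 0 (c as) * power_product gs as) = 0"
      "as \<in> exponents D (length gs)" for c :: "nat list \<Rightarrow> 'k" and as
    using prime_chain_coefficients_zero[OF P.submonoid chain] that P.zero_mem by metis
  show "inj_on (power_product gs) (exponents D (length gs))"
    by (rule monoid_algebra.independent_family(1)[OF finite_exponents]) (rule zero)
  show "monoid_algebra.independent (power_product gs ` exponents D (length gs))"
    by (rule monoid_algebra.independent_family(2)[OF finite_exponents]) (rule zero)
qed

definition lattice_box :: "('x \<Rightarrow>\<^sub>0 int) set \<Rightarrow> 'x set \<Rightarrow> nat \<Rightarrow> ('x \<Rightarrow>\<^sub>0 int) set" where
  "lattice_box S J N = {u \<in> S. \<forall>x\<in>J. \<bar>lookup u x\<bar> \<le> int N}"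

lemma card_lattice_box_le:
  assumes "finite J" and inj: "inj_on (\<lambda>u. restrict (lookup u) J) S"
  shows "finite (lattice_box S J N)" and "card (lattice_box S J N) \<le> (2 * N + 1) ^ card J"
proof -
  let ?r = "\<lambda>u. restrict (lookup u) J" and ?T = "J \<rightarrow>\<^sub>E {- int N..int N}"
  have "finite ?T" using assms(1) by (simp add: finite_PiE)
  moreover have "inj_on ?r (lattice_box S J N)"
    by (rule inj_on_subset[OF inj]) (auto simp: lattice_box_def)
  moreover have "?r ` lattice_box S J N \<subseteq> ?T" by (auto simp: lattice_box_def abs_le_iff)
  ultimately show "finite (lattice_box S J N)" "card (lattice_box S J N) \<le> (2 * N + 1) ^ card J"
    using inj_on_finite[of ?r _ ?T] card_inj_on_le[of ?r _ ?T] assms(1)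
    by (auto simp: card_PiE nat_add_distrib nat_mult_distrib)
qed

lemma lookup_bounded:
  fixes F :: "(('x \<Rightarrow>\<^sub>0 int) \<Rightarrow>\<^sub>0 'k::zero) set"
  assumes "finite F" "finite J"
  obtains B where "\<And>g u x. g \<in> F \<Longrightarrow> u \<in> keys g \<Longrightarrow> x \<in> J \<Longrightarrow> \<bar>lookup u x\<bar> \<le> int B"
proof -
  define V where "V = (\<Union>g\<in>F. \<Union>u\<in>keys g. (\<lambda>x. nat \<bar>lookup u x\<bar>) ` J)"
  have "finite V" unfolding V_def using assms by simp
  then obtain B where "\<forall>v\<in>V. v \<le> B"
    using finite_nat_set_iff_bounded_le by blast
  then have "nat \<bar>lookup u x\<bar> \<le> B" if "g \<in> F" "u \<in> keys g" "x \<in> J" for g u x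
    using that unfolding V_def by blast
  then have "\<bar>lookup u x\<bar> \<le> int B" if "g \<in> F" "u \<in> keys g" "x \<in> J" for g u x
    using that by (metis nat_le_iff)
  then show thesis by (rule that)
qed

lemma lookup_keys_power_le:
  fixes g :: "('x \<Rightarrow>\<^sub>0 int) \<Rightarrow>\<^sub>0 'k::field"
  assumes "\<And>u. u \<in> keys g \<Longrightarrow> \<bar>lookup u x\<bar> \<le> int B" and "v \<in> keys (g ^ n)"
  shows "\<bar>lookup v x\<bar> \<le> int (B * n)"
  using assms(2)
proof (induction n arbitrary: v)
  case (Suc n)
  then obtain v1 v2 where "v = v1 + v2" "v1 \<in> keys g" "v2 \<in> keys (g ^ n)"
    using keys_mult[of g "g ^ n"] by auto
  then show ?case
    using Suc.IH[of v2] assms(1)[of v1] by (simp add: lookup_add)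
qed simp

lemma lookup_keys_power_product_le:
  fixes gs :: "(('x \<Rightarrow>\<^sub>0 int) \<Rightarrow>\<^sub>0 'k::field) list"
  assumes "\<And>g u. g \<in> set gs \<Longrightarrow> u \<in> keys g \<Longrightarrow> \<bar>lookup u x\<bar> \<le> int B"
    and "u \<in> keys (power_product gs as)"
  shows "\<bar>lookup u x\<bar> \<le> int (B * sum_list as)"
  using assms
proof (induction gs as arbitrary: u rule: list_induct2')
  case (4 g gs a as)
  obtain v w where summands: "u = v + w" "v \<in> keys (g ^ a)" "w \<in> keys (power_product gs as)"
    using "4.prems"(2) keys_mult[of "g ^ a" "power_product gs as"] by auto
  have "\<bar>lookup v x\<bar> \<le> int (B * a)"
    by (rule lookup_keys_power_le[OF "4.prems"(1)[of g] summands(2)]) simp_all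
  moreover have "\<bar>lookup w x\<bar> \<le> int (B * sum_list as)"
    by (rule "4.IH"[OF "4.prems"(1) summands(3)]) simp_all
  ultimately show ?case
    using summands(1) by (simp add: lookup_add algebra_simps)
qed simp_all

lemma keys_power_product_lattice_box:
  fixes gs :: "(('x \<Rightarrow>\<^sub>0 int) \<Rightarrow>\<^sub>0 'k::field) list"
  assumes "add_submonoid S" "\<And>g. g \<in> set gs \<Longrightarrow> keys g \<subseteq> S"
    and degree_bound: "\<And>g u x. g \<in> set gs \<Longrightarrow> u \<in> keys g \<Longrightarrow> x \<in> J \<Longrightarrow> \<bar>lookup u x\<bar> \<le> int B"
    and exponents: "as \<in> exponents D (length gs)"
  shows "keys (power_product gs as) \<subseteq> lattice_box S J (B * (length gs * D))"
proof
  fix u assume in_keys: "u \<in> keys (power_product gs as)"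
  have "sum_list as \<le> sum_list (map (\<lambda>_. D) as)"
    using sum_list_mono[of as "\<lambda>a. a" "\<lambda>_. D"] exponents by (force simp: exponents_def)
  then have "sum_list as \<le> length gs * D"
    using exponents by (simp add: sum_list_triv exponents_def)
  then have "int (B * sum_list as) \<le> int (B * (length gs * D))"
    by (intro of_nat_mono mult_le_mono2)
  moreover have "\<bar>lookup u x\<bar> \<le> int (B * sum_list as)" if "x \<in> J" for x
    by (rule lookup_keys_power_product_le[OF degree_bound in_keys]) (simp_all add: that)
  ultimately have "\<bar>lookup u x\<bar> \<le> int (B * (length gs * D))" if "x \<in> J" for x
    using that by fastforce
  then show "u \<in> lattice_box S J (B * (length gs * D))"
    using keys_power_product_subset[OF assms(1,2)] in_keys by (auto simp: lattice_box_def)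
qed

lemma prime_chain_power_le:
  fixes gs :: "(('x \<Rightarrow>\<^sub>0 int) \<Rightarrow>\<^sub>0 'k::field) list"
  assumes chain: "prime_chain S P gs" and "finite J" "inj_on (\<lambda>u. restrict (lookup u) J) S"
    and degree_bound: "\<And>g u x. g \<in> set gs \<Longrightarrow> u \<in> keys g \<Longrightarrow> x \<in> J \<Longrightarrow> \<bar>lookup u x\<bar> \<le> int B"
  shows "D ^ length gs \<le> (2 * (B * (length gs * D)) + 1) ^ card J"
proof -
  let ?E = "exponents D (length gs)" and ?box = "lattice_box S J (B * (length gs * D))"
  let ?monomials = "monomial ` ?box :: (('x \<Rightarrow>\<^sub>0 int) \<Rightarrow>\<^sub>0 'k) set"
  note box = card_lattice_box_le[OF assms(2,3), of "B * (length gs * D)"]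
  note chain_indep = prime_chain_independent[OF chain, of D]
  have "add_submonoid S"
    by (rule monoid_algebra_prime.submonoid[OF prime_chain_prime[OF chain]])
  then have "power_product gs ` ?E \<subseteq> monoid_algebra.span ?monomials"
    by (intro image_subsetI in_span_monomials keys_power_product_lattice_box
        prime_chain_keys_subset[OF chain] degree_bound)
  then have "card (power_product gs ` ?E) \<le> card ?monomials"
    using monoid_algebra.independent_span_bound chain_indep(2) box(1) by blast
  also have "\<dots> \<le> card ?box" by (rule card_image_le[OF box(1)])
  also have "\<dots> \<le> (2 * (B * (length gs * D)) + 1) ^ card J" by (rule box(2))
  finally show ?thesis
    using card_image[OF chain_indep(1)] by (simp add: card_exponents)
qed

lemma exponent_le_if_power_le:
  fixes C m n :: nat
  assumes "\<And>D. D > 0 \<Longrightarrow> D ^ m \<le> (C * D) ^ n"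
  shows "m \<le> n"
proof (rule ccontr)
  assume "\<not> m \<le> n"
  then have "Suc n \<le> m" by simp
  let ?D = "C ^ n + 1"
  have "?D * ?D ^ n \<le> ?D ^ m"
    using power_increasing[OF \<open>Suc n \<le> m\<close>, of ?D] by simp
  also have "\<dots> \<le> C ^ n * ?D ^ n"
    using assms[of ?D] by (simp only: power_mult_distrib)
  finally show False by simp
qed

lemma prime_chain_length_le:
  fixes gs :: "(('x \<Rightarrow>\<^sub>0 int) \<Rightarrow>\<^sub>0 'k::field) list"
  assumes "prime_chain S P gs" "finite J" "inj_on (\<lambda>u. restrict (lookup u) J) S"
  shows "length gs \<le> card J"
proof -
  obtain B where degree_bound: "\<And>g u x. g \<in> set gs \<Longrightarrow> u \<in> keys g \<Longrightarrow> x \<in> J \<Longrightarrow> \<bar>lookup u x\<bar> \<le> int B"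
    using lookup_bounded[of "set gs" J] \<open>finite J\<close> by blast
  have "D ^ length gs \<le> ((2 * (B * length gs) + 1) * D) ^ card J" if "D > 0" for D
  proof -
    have "D ^ length gs \<le> (2 * (B * (length gs * D)) + 1) ^ card J"
      by (rule prime_chain_power_le[OF assms degree_bound])
    also have "\<dots> \<le> ((2 * (B * length gs) + 1) * D) ^ card J"
      by (rule power_mono) (use that in \<open>auto simp: algebra_simps\<close>)
    finally show ?thesis .
  qed
  then show ?thesis by (rule exponent_le_if_power_le)
qed

section \<open>Krull dimension\<close>

lemma irreducible_closed_subset_topspace: "irreducible_closed X Z \<Longrightarrow> Z \<subseteq> topspace X"
  using closedin_subset unfolding irreducible_closed_def by blast

lemma irreducible_closed_meets:
  assumes "irreducible_closed X Z" "openin X U" "openin X V" "Z \<inter> U \<noteq> {}" "Z \<inter> V \<noteq> {}"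
  shows "Z \<inter> U \<inter> V \<noteq> {}"
proof
  assume "Z \<inter> U \<inter> V = {}"
  then have "Z = (Z - U) \<union> (Z - V)" by blast
  moreover have "closedin X (Z - U)" "closedin X (Z - V)"
    using assms unfolding irreducible_closed_def by (auto intro: closedin_diff)
  ultimately have "Z = Z - U \<or> Z = Z - V"
    using assms(1) unfolding irreducible_closed_def by blast
  then show False using assms by blast
qed

lemma krull_dim_le:
  assumes "\<And>n Z. (\<And>i. i \<le> n \<Longrightarrow> irreducible_closed X (Z i)) \<Longrightarrow> (\<And>i. i < n \<Longrightarrow> Z i \<subset> Z (Suc i)) \<Longrightarrow>
    n \<le> N"
  shows "krull_dim X \<le> enat N"
  unfolding krull_dim_def by (rule Sup_least) (use assms in \<open>auto, blast\<close>)

lemma krull_dim_singleton: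
  assumes "topspace X \<subseteq> {x}"
  shows "krull_dim X = 0"
proof -
  have "krull_dim X \<le> enat 0"
  proof (rule krull_dim_le, rule ccontr)
    fix n and Z :: "nat \<Rightarrow> 'a set"
    assume irred: "\<And>i. i \<le> n \<Longrightarrow> irreducible_closed X (Z i)"
      and less: "\<And>i. i < n \<Longrightarrow> Z i \<subset> Z (Suc i)" and "\<not> n \<le> 0"
    then have "Z 0 \<subset> Z 1" by simp
    moreover have "Z 0 \<noteq> {}"
      using irred[of 0] unfolding irreducible_closed_def by simp
    moreover have "Z 1 \<subseteq> {x}"
      using irreducible_closed_subset_topspace[OF irred[of 1]] \<open>\<not> n \<le> 0\<close> assms by auto
    ultimately show False by blast
  qed
  then show ?thesis by (simp flip: zero_enat_def)
qed

locale zariski_spectrum =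
  fixes S :: "'m::comm_monoid_add set" and X :: "'p topology" and p :: "'p \<Rightarrow> ('m \<Rightarrow>\<^sub>0 'k::field) set"
  assumes prime: "\<And>x. x \<in> topspace X \<Longrightarrow> monoid_algebra_prime S (p x)"
    and openin_nonvanishing: "\<And>f. keys f \<subseteq> S \<Longrightarrow> openin X {x \<in> topspace X. f \<notin> p x}"
    and nonvanishing_basis: "\<And>W y. openin X W \<Longrightarrow> y \<in> W \<Longrightarrow>
      \<exists>f. keys f \<subseteq> S \<and> f \<notin> p y \<and> {x \<in> topspace X. f \<notin> p x} \<subseteq> W"
begin

definition vanishing_ideal :: "'p set \<Rightarrow> ('m \<Rightarrow>\<^sub>0 'k) set" where
  "vanishing_ideal Z = {f. keys f \<subseteq> S \<and> (\<forall>x\<in>Z. f \<in> p x)}"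

lemma monoid_algebra_prime_vanishing_ideal:
  assumes irred: "irreducible_closed X Z"
  shows "monoid_algebra_prime S (vanishing_ideal Z)"
proof -
  have prime_p: "monoid_algebra_prime S (p x)" if "x \<in> Z" for x
    using prime irreducible_closed_subset_topspace[OF irred] that by blast
  note p_ideal = monoid_algebra_prime_imp_ideal[OF prime_p]
  obtain y where y_in_Z: "y \<in> Z" using irred by (auto simp: irreducible_closed_def)
  note S = monoid_algebra_prime.submonoid[OF prime_p[OF y_in_Z]]
  show ?thesis
  proof (rule monoid_algebra_primeI[OF S])
    show "1 \<notin> vanishing_ideal Z"
      using y_in_Z monoid_algebra_prime.one_notin[OF prime_p[OF y_in_Z]]
      by (auto simp: vanishing_ideal_def)
    fix f g :: "'m \<Rightarrow>\<^sub>0 'k"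
    show "f + g \<in> vanishing_ideal Z" if "f \<in> vanishing_ideal Z" "g \<in> vanishing_ideal Z"
      using that monoid_algebra_ideal.add_mem[OF p_ideal]
      by (auto simp: vanishing_ideal_def keys_add_subset)
    show "g * f \<in> vanishing_ideal Z" if "f \<in> vanishing_ideal Z" "keys g \<subseteq> S"
      using that monoid_algebra_ideal.mult_mem[OF p_ideal]
      by (auto simp: vanishing_ideal_def keys_mult_subset[OF S])
    assume keys_f: "keys f \<subseteq> S" and keys_g: "keys g \<subseteq> S"
      and product_vanishes: "f * g \<in> vanishing_ideal Z"
    show "f \<in> vanishing_ideal Z \<or> g \<in> vanishing_ideal Z"
    proof (rule ccontr)
      assume "\<not> ?thesis"
      then have "Z \<inter> {x \<in> topspace X. f \<notin> p x} \<inter> {x \<in> topspace X. g \<notin> p x} \<noteq> {}"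
        using keys_f keys_g irreducible_closed_subset_topspace[OF irred]
        by (intro irreducible_closed_meets[OF irred] openin_nonvanishing)
          (auto simp: vanishing_ideal_def)
      then show False
        using product_vanishes monoid_algebra_prime.mult_mem_iff[OF prime keys_f keys_g]
        by (auto simp: vanishing_ideal_def)
    qed
  qed (use monoid_algebra_ideal.zero_mem[OF p_ideal] in \<open>auto simp: vanishing_ideal_def\<close>)
qed

lemma exists_vanishing_separating:
  assumes "closedin X Z" "y \<in> topspace X" "y \<notin> Z"
  obtains f where "f \<in> vanishing_ideal Z" "f \<notin> p y"
proof -
  have "openin X (topspace X - Z)" using assms(1) by blast
  then obtain f where "keys f \<subseteq> S" "f \<notin> p y" "{x \<in> topspace X. f \<notin> p x} \<subseteq> topspace X - Z"
    using nonvanishing_basis assms(2,3) by blast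
  then show thesis
    using closedin_subset[OF assms(1)] by (intro that[of f]) (auto simp: vanishing_ideal_def)
qed

lemma prime_chain_vanishing_ideal:
  assumes irred: "\<And>i. i \<le> n \<Longrightarrow> irreducible_closed X (Z i)" and less: "\<And>i. i < n \<Longrightarrow> Z i \<subset> Z (Suc i)"
  shows "\<exists>gs. prime_chain S (vanishing_ideal (Z n)) gs \<and> length gs = n"
  using assms
proof (induction n)
  case 0
  then show ?case
    by (intro exI[of _ "[]"]) (simp add: monoid_algebra_prime_vanishing_ideal)
next
  case (Suc n)
  then obtain gs where chain: "prime_chain S (vanishing_ideal (Z n)) gs" "length gs = n"
    by auto
  have irred: "irreducible_closed X (Z n)" "irreducible_closed X (Z (Suc n))"
    and less: "Z n \<subset> Z (Suc n)" using Suc.prems by simp_all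
  obtain y where new_point: "y \<in> Z (Suc n)" "y \<notin> Z n" using less by blast
  moreover have "y \<in> topspace X"
    using new_point(1) irreducible_closed_subset_topspace[OF irred(2)] by blast
  ultimately obtain f where separating_f: "f \<in> vanishing_ideal (Z n)" "f \<notin> p y"
    using exists_vanishing_separating irred(1) unfolding irreducible_closed_def by metis
  have "f \<notin> vanishing_ideal (Z (Suc n))" using separating_f new_point
    by (auto simp: vanishing_ideal_def)
  moreover have "vanishing_ideal (Z (Suc n)) \<subseteq> vanishing_ideal (Z n)"
    using less by (auto simp: vanishing_ideal_def)
  ultimately show ?case
    using chain separating_f(1) monoid_algebra_prime_vanishing_ideal[OF irred(2)]
    by (intro exI[of _ "f # gs"]) (auto simp: vanishing_ideal_def)
qed

end

lemma krull_dim_zero_locus_less: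
  fixes S :: "('x \<Rightarrow>\<^sub>0 int) set" and p :: "'p \<Rightarrow> (('x \<Rightarrow>\<^sub>0 int) \<Rightarrow>\<^sub>0 'k::field) set"
  assumes "zariski_spectrum S X p" and submonoid: "add_submonoid S" "S \<subseteq> {u. keys u \<subseteq> Y}" "finite Y"
    and coordinates: "finite J" "inj_on (\<lambda>u. restrict (lookup u) J) S"
    and vanishing_g: "keys g \<subseteq> S" "g \<noteq> 0" "\<And>x. x \<in> topspace X \<Longrightarrow> g \<in> p x"
  shows "krull_dim X \<le> enat (card J - 1)"
proof (rule krull_dim_le)
  interpret zariski_spectrum S X p by fact
  fix n and Z :: "nat \<Rightarrow> 'p set"
  assume irred: "\<And>i. i \<le> n \<Longrightarrow> irreducible_closed X (Z i)" and less: "\<And>i. i < n \<Longrightarrow> Z i \<subset> Z (Suc i)"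
  obtain gs where chain: "prime_chain S (vanishing_ideal (Z n)) gs" "length gs = n"
    using prime_chain_vanishing_ideal[of n Z] irred less by blast
  interpret I: monoid_algebra_prime S "vanishing_ideal (Z n)"
    by (rule prime_chain_prime[OF chain(1)])
  have "g \<in> vanishing_ideal (Z n)"
    using vanishing_g(1,3) irreducible_closed_subset_topspace[OF irred[OF order_refl]]
    by (auto simp: vanishing_ideal_def)
  then have "prime_chain S {0} (g # gs)"
    using monoid_algebra_prime_zero[OF submonoid] vanishing_g(1,2) I.zero_mem chain(1) by auto
  then have "length (g # gs) \<le> card J"
    by (rule prime_chain_length_le[OF _ coordinates])
  then show "n \<le> card J - 1" using chain(2) by simp
qed

section \<open>Zariski topology of an atlas\<close>

definition basic_open ::
  "('i, 'm, 'k) atlas \<Rightarrow> 'i \<Rightarrow> ('m \<Rightarrow>\<^sub>0 'k) \<Rightarrow> ('i \<times> ('m \<Rightarrow>\<^sub>0 'k::zero) set) set" where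
  "basic_open X i f = {x \<in> chart_open X i. f \<notin> snd x}"

lemma zariski_basic_open:
  "zariski X = topology_generated_by {basic_open X i f | i f. i \<in> charts X \<and> keys f \<subseteq> mon X i}"
  by (simp add: zariski_def basic_open_def carrier_monoid_algebra)

lemma openin_basic_open:
  "i \<in> charts X \<Longrightarrow> keys f \<subseteq> mon X i \<Longrightarrow> openin (zariski X) (basic_open X i f)"
  unfolding zariski_basic_open by (rule topology_generated_by_Basis) blast

lemma continuous_map_into_zariski:
  assumes "\<And>x. x \<in> topspace T \<Longrightarrow> \<phi> x \<in> topspace (zariski X)"
    and "\<And>i f. i \<in> charts X \<Longrightarrow> keys f \<subseteq> mon X i \<Longrightarrow> openin T {x \<in> topspace T. \<phi> x \<in> basic_open X i f}"
  shows "continuous_map T (zariski X) \<phi>"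
  unfolding zariski_basic_open
proof (rule continuous_on_generated_topo)
  fix V assume "V \<in> {basic_open X i f | i f. i \<in> charts X \<and> keys f \<subseteq> mon X i}"
  then obtain i f where V_basic: "V = basic_open X i f" "i \<in> charts X" "keys f \<subseteq> mon X i" by blast
  have "\<phi> -` V \<inter> topspace T = {x \<in> topspace T. \<phi> x \<in> basic_open X i f}"
    using V_basic(1) by blast
  then show "openin T (\<phi> -` V \<inter> topspace T)" using assms(2)[OF V_basic(2,3)] by simp
next
  show "\<phi> ` topspace T \<subseteq> \<Union> {basic_open X i f | i f. i \<in> charts X \<and> keys f \<subseteq> mon X i}"
    using assms(1) unfolding zariski_basic_open topology_generated_by_topspace
    by (rule image_subsetI)
qed

lemma topo_scheme_of: "topo (scheme_of X) = zariski X"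
  and sheaf_scheme_of: "sheaf (scheme_of X) = structure_sheaf X"
  by (simp_all add: scheme_of_def)

locale prime_atlas =
  fixes X :: "('i, 'm::comm_monoid_add, 'k::field) atlas"
  assumes point_chart: "\<And>x. x \<in> pts X \<Longrightarrow> fst x \<in> charts X"
    and sub_refl: "\<And>i. i \<in> charts X \<Longrightarrow> sub X i i"
    and submonoid: "\<And>i. i \<in> charts X \<Longrightarrow> add_submonoid (mon X i)"
    and point_primeideal: "\<And>x. x \<in> pts X \<Longrightarrow> primeideal (snd x) (monoid_algebra (mon X (fst x)))"
begin

lemma point_prime: "x \<in> pts X \<Longrightarrow> monoid_algebra_prime (mon X (fst x)) (snd x)"
  by (intro monoid_algebra_prime.intro submonoid point_chart point_primeideal)

lemma point_in_chart_open: "x \<in> pts X \<Longrightarrow> x \<in> chart_open X (fst x)"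
  by (simp add: chart_open_def sub_refl point_chart)

lemma basic_open_one: "basic_open X i 1 = chart_open X i"
  using monoid_algebra_prime.one_notin[OF point_prime] by (auto simp: basic_open_def chart_open_def)

lemma openin_chart_open:
  assumes "i \<in> charts X"
  shows "openin (zariski X) (chart_open X i)"
  using openin_basic_open[OF assms keys_const_subset[OF submonoid[OF assms], of 1]]
  by (simp add: basic_open_one)

lemma topspace_zariski: "topspace (zariski X) = pts X"
proof
  show "topspace (zariski X) \<subseteq> pts X"
    by (auto simp: zariski_basic_open basic_open_def chart_open_def)
  show "pts X \<subseteq> topspace (zariski X)"
    using openin_subset[OF openin_chart_open[OF point_chart]] point_in_chart_open by blast
qed

text \<open>A basic open set of a chart \<open>j\<close> contains points listed in \<open>i\<close> only if \<open>i\<close> is contained in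
  \<open>j\<close>, and then its equation is also defined on \<open>i\<close>.\<close>

lemma openin_zariski_nonvanishing_basis:
  assumes chart: "i \<in> charts X"
    and mono: "\<And>j. j \<in> charts X \<Longrightarrow> sub X i j \<Longrightarrow> mon X j \<subseteq> mon X i"
    and "openin (zariski X) V" "y \<in> V" and y_point: "y \<in> pts X" "fst y = i"
  shows "\<exists>f. keys f \<subseteq> mon X i \<and> f \<notin> snd y \<and> {x \<in> pts X. fst x = i \<and> f \<notin> snd x} \<subseteq> V"
proof -
  have "generate_topology_on {basic_open X i f | i f. i \<in> charts X \<and> keys f \<subseteq> mon X i} V"
    using assms(3) unfolding zariski_basic_open by (rule openin_topology_generated_by)
  then show ?thesis using \<open>y \<in> V\<close>
  proof induction
    case (Int V V')
    then obtain f g where nbhd_f: "keys f \<subseteq> mon X i" "f \<notin> snd y"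
        "{x \<in> pts X. fst x = i \<and> f \<notin> snd x} \<subseteq> V"
      and nbhd_g: "keys g \<subseteq> mon X i" "g \<notin> snd y" "{x \<in> pts X. fst x = i \<and> g \<notin> snd x} \<subseteq> V'"
      by blast
    have "f * g \<in> snd x \<longleftrightarrow> f \<in> snd x \<or> g \<in> snd x" if "x \<in> pts X" "fst x = i" for x
      using monoid_algebra_prime.mult_mem_iff[OF point_prime[OF that(1)]] that(2) nbhd_f(1)
        nbhd_g(1) by blast
    then show ?case
      using nbhd_f nbhd_g y_point keys_mult_subset[OF submonoid[OF chart] nbhd_f(1) nbhd_g(1)]
      by (intro exI[of _ "f * g"]) blast
  next
    case (Basis D)
    then obtain j f where D_basic: "D = basic_open X j f" "j \<in> charts X" "keys f \<subseteq> mon X j"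
      by blast
    then have "sub X i j" "f \<notin> snd y"
      using Basis.prems y_point by (auto simp: basic_open_def chart_open_def)
    then show ?case
      using mono D_basic
      by (intro exI[of _ f]) (auto simp: basic_open_def chart_open_def)
  qed blast+
qed

lemma zariski_spectrum_minimal_chart:
  assumes chart: "i \<in> charts X" and P_subset: "P \<subseteq> {x \<in> pts X. fst x = i}"
    and mono: "\<And>j. j \<in> charts X \<Longrightarrow> sub X i j \<Longrightarrow> mon X j \<subseteq> mon X i"
  shows "zariski_spectrum (mon X i) (subtopology (zariski X) P) snd"
proof -
  have top: "topspace (subtopology (zariski X) P) = P"
    using P_subset topspace_zariski by auto
  show ?thesis
  proof (rule zariski_spectrum.intro, unfold top)
    show "monoid_algebra_prime (mon X i) (snd x)" if "x \<in> P" for x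
      using point_prime[of x] P_subset that by auto
  next
    fix f :: "'m \<Rightarrow>\<^sub>0 'k" assume keys_f: "keys f \<subseteq> mon X i"
    have "{x \<in> P. f \<notin> snd x} = basic_open X i f \<inter> P"
      using P_subset sub_refl[OF chart] by (force simp: basic_open_def chart_open_def)
    then show "openin (subtopology (zariski X) P) {x \<in> P. f \<notin> snd x}"
      using openin_basic_open[OF chart keys_f] unfolding openin_subtopology by blast
  next
    fix W y assume "openin (subtopology (zariski X) P) W" "y \<in> W"
    then obtain V where nbhd: "openin (zariski X) V" "W = V \<inter> P" "y \<in> V" "y \<in> P"
      unfolding openin_subtopology by blast
    then have "y \<in> pts X" "fst y = i" using P_subset by auto
    then obtain f where "keys f \<subseteq> mon X i" "f \<notin> snd y" "{x \<in> pts X. fst x = i \<and> f \<notin> snd x} \<subseteq> V"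
      using openin_zariski_nonvanishing_basis[OF chart mono nbhd(1,3)] by blast
    then show "\<exists>f. keys f \<subseteq> mon X i \<and> f \<notin> snd y \<and> {x \<in> P. f \<notin> snd x} \<subseteq> W"
      using P_subset nbhd(2) by (intro exI[of _ f]) auto
  qed
qed

end

section \<open>Real vector spaces\<close>

lemma exists_separating_functional:
  fixes x :: "'a::real_vector"
  assumes "x \<notin> span C"
  obtains f :: "'a \<Rightarrow> real" where "linear f" "\<And>v. v \<in> span C \<Longrightarrow> f v = 0" "f x = 1"
proof -
  obtain D where basis_D: "D \<subseteq> span C" "independent D" "span C \<subseteq> span D"
    by (rule basis_exists[of "span C"])
  have span_D: "span D = span C"
    using basis_D(3) span_mono[OF basis_D(1)] by (simp add: span_span subset_antisym)
  have "independent (insert x D)"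
    using basis_D(2) assms span_D by (simp add: independent_insertI)
  from linear_independent_extend[OF this, of "\<lambda>y. if y = x then 1 else 0"]
  obtain f :: "'a \<Rightarrow> real" where dual_f: "linear f" "\<forall>y\<in>insert x D. f y = (if y = x then 1 else 0)"
    by blast
  have "x \<notin> D" using assms basis_D(1) by blast
  then have "f y = 0" if "y \<in> D" for y using dual_f(2) that by auto
  then have "f v = 0" if "v \<in> span C" for v
    using linear_eq_0_on_span[OF dual_f(1), of D v] that span_D by blast
  then show thesis using dual_f that by auto
qed

lemma independent_Un_span_disjoint:
  fixes B D :: "'a::real_vector set"
  assumes "independent B" "independent D" and disjoint: "span B \<inter> span D \<subseteq> {0}"
  shows "independent (B \<union> D)"
proof -
  have "v \<notin> span (B \<union> D - {v})"
    if v_in_B: "v \<in> B" and "independent B" and disjoint: "span B \<inter> span D \<subseteq> {0}"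
    for v and B D :: "'a set"
  proof
    assume "v \<in> span (B \<union> D - {v})"
    then have "v \<in> span ((B - {v}) \<union> D)"
      using span_mono[of "B \<union> D - {v}" "(B - {v}) \<union> D"] by blast
    then obtain x y where decomposition: "v = x + y" "x \<in> span (B - {v})" "y \<in> span D"
      unfolding span_Un by blast
    have "x \<in> span B" using decomposition(2) span_mono[of "B - {v}" B] by blast
    then have "y \<in> span B" using decomposition(1) span_diff[OF span_base[OF v_in_B]]
      by (metis add_diff_cancel_left')
    then have "y = 0" using decomposition(3) disjoint by blast
    then show False using decomposition(1,2) v_in_B \<open>independent B\<close> by (simp add: dependent_def)
  qed
  from this[of _ B D] this[of _ D B] show ?thesis
    using assms unfolding dependent_def by (metis Int_commute Un_commute Un_iff)
qed

lemma card_le_dim_diff: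
  fixes B L C :: "'a::real_vector set"
  assumes "independent B" "span B \<inter> span L \<subseteq> {0}" "B \<union> L \<subseteq> span C"
    and finite_dim: "C \<subseteq> span U" "finite U"
  shows "card B \<le> dim C - dim L"
proof -
  obtain D where basis_L: "D \<subseteq> L" "independent D" "L \<subseteq> span D" "card D = dim L"
    using basis_exists[of L] by blast
  obtain F where basis_C: "F \<subseteq> C" "independent F" "C \<subseteq> span F" "card F = dim C"
    using basis_exists[of C] by blast
  have "finite F"
    using independent_span_bound[OF \<open>finite U\<close> basis_C(2)] basis_C(1) finite_dim(1) by blast
  have "span B \<inter> span D \<subseteq> {0}"
    using assms(2) span_mono[OF basis_L(1)] by blast
  then have indep: "independent (B \<union> D)"
    by (rule independent_Un_span_disjoint[OF assms(1) basis_L(2)])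
  have "span C \<subseteq> span F" using span_mono[OF basis_C(3)] by (simp only: span_span)
  then have "B \<union> D \<subseteq> span F" using assms(3) basis_L(1) by blast
  then have "finite (B \<union> D)" "card (B \<union> D) \<le> card F"
    using independent_span_bound[OF \<open>finite F\<close> indep] by blast+
  moreover have "B \<inter> D = {}"
  proof -
    have "B \<inter> D \<subseteq> {0}"
      using assms(2) basis_L(1) span_superset[of B] span_superset[of L] by blast
    then show ?thesis
      using assms(1) dependent_zero by blast
  qed
  ultimately show ?thesis
    using basis_L(4) basis_C(4) by (simp add: card_Un_disjoint)
qed

lemma face_of_Int_kernel:
  fixes f :: "'a::real_vector \<Rightarrow> real"
  assumes "convex C" "linear f" and nonneg: "\<And>v. v \<in> C \<Longrightarrow> f v \<ge> 0"
  shows "{v \<in> C. f v = 0} face_of C"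
  unfolding face_of_def
proof (intro conjI ballI impI)
  show "convex {v \<in> C. f v = 0}"
    using assms(1) unfolding convex_def
    by (auto simp: linear_add[OF \<open>linear f\<close>] linear_scale[OF \<open>linear f\<close>])
  fix a b x assume a_in_C: "a \<in> C" and b_in_C: "b \<in> C" and x_in_kernel: "x \<in> {v \<in> C. f v = 0}"
    and "x \<in> open_segment a b"
  then obtain t where convex_combination: "0 < t" "t < 1" "x = (1 - t) *\<^sub>R a + t *\<^sub>R b"
    by (auto simp: in_segment)
  have "(1 - t) * f a + t * f b = 0"
    using x_in_kernel convex_combination(3)
    by (simp add: linear_add[OF \<open>linear f\<close>] linear_scale[OF \<open>linear f\<close>])
  moreover have "(1 - t) * f a \<ge> 0" "t * f b \<ge> 0" using convex_combination nonneg a_in_C b_in_C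
    by auto
  ultimately have "(1 - t) * f a = 0" "t * f b = 0" by linarith+
  then show "a \<in> {v \<in> C. f v = 0}" "b \<in> {v \<in> C. f v = 0}" using convex_combination a_in_C b_in_C
    by auto
qed blast

lemma convex_cone_sum:
  assumes "convex_cone C" "finite I" "\<And>i. i \<in> I \<Longrightarrow> f i \<in> C"
  shows "sum f I \<in> C"
  using assms(2,3)
  by (induction I) (auto simp: convex_cone_contains_0[OF assms(1)] convex_cone_add[OF assms(1)])

lemma lookup_scaleR [simp]: "lookup (c *\<^sub>R v) x = c *\<^sub>R lookup v x"
  by (simp add: scaleR_poly_mapping_def Poly_Mapping.map.rep_eq when_def)

lemma linear_lookup: "linear (\<lambda>v. lookup v x)"
  by (rule linearI) (simp_all add: lookup_add)

lemma poly_mapping_sum_scaleR: "v = (\<Sum>x\<in>keys v. lookup v x *\<^sub>R single x (1::real))"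
  by (rule poly_mapping_eqI)
    (simp add: lookup_sum lookup_single when_def if_distrib[of "(*) _"] in_keys_iff cong: if_cong)

lemma span_singles: "span ((\<lambda>x. single x 1) ` Y) = {v :: 'x \<Rightarrow>\<^sub>0 real. keys v \<subseteq> Y}"
proof
  have "subspace {v :: 'x \<Rightarrow>\<^sub>0 real. keys v \<subseteq> Y}"
    by (rule subspaceI) (auto simp: in_keys_iff keys_add_subset[THEN subsetD])
  then show "span ((\<lambda>x. single x 1) ` Y) \<subseteq> {v :: 'x \<Rightarrow>\<^sub>0 real. keys v \<subseteq> Y}"
    by (rule span_minimal[rotated]) auto
  show "{v. keys v \<subseteq> Y} \<subseteq> span ((\<lambda>x. single x (1::real)) ` Y)"
  proof
    fix v :: "'x \<Rightarrow>\<^sub>0 real" assume "v \<in> {v. keys v \<subseteq> Y}"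
    then have "(\<Sum>x\<in>keys v. lookup v x *\<^sub>R single x (1::real)) \<in> span ((\<lambda>x. single x 1) ` Y)"
      by (intro span_sum span_scale span_base) auto
    then show "v \<in> span ((\<lambda>x. single x 1) ` Y)" by (simp flip: poly_mapping_sum_scaleR)
  qed
qed

lemma independent_singles:
  assumes "finite Y"
  shows "independent ((\<lambda>x. single x (1::real)) ` Y)"
proof (rule real_vector.independent_family(2)[OF assms])
  fix c :: "'a \<Rightarrow> real" and x
  assume "(\<Sum>x\<in>Y. c x *\<^sub>R single x (1::real)) = 0" "x \<in> Y"
  then have "lookup (\<Sum>x\<in>Y. c x *\<^sub>R single x (1::real)) x = 0" by simp
  then show "c x = 0"
    using assms \<open>x \<in> Y\<close>
    by (simp add: lookup_sum lookup_single when_def if_distrib[of "(*) _"] cong: if_cong)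
qed

section \<open>Orthants\<close>

definition orthant :: "'x set \<Rightarrow> ('x \<Rightarrow>\<^sub>0 real) set" where
  "orthant G = {v. keys v \<subseteq> G \<and> (\<forall>x. lookup v x \<ge> 0)}"

lemma orthantI: "(\<And>x. x \<notin> G \<Longrightarrow> lookup v x = 0) \<Longrightarrow> (\<And>x. lookup v x \<ge> 0) \<Longrightarrow> v \<in> orthant G"
  by (auto simp: orthant_def in_keys_iff)

lemma orthantD: "v \<in> orthant G \<Longrightarrow> x \<notin> G \<Longrightarrow> lookup v x = 0" "v \<in> orthant G \<Longrightarrow> lookup v x \<ge> 0"
  by (auto simp: orthant_def in_keys_iff)

lemma single_in_orthant: "single x 1 \<in> orthant G \<longleftrightarrow> x \<in> G"
  by (auto simp: orthant_def lookup_single when_def)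

lemma orthant_subset_iff: "orthant G \<subseteq> orthant H \<longleftrightarrow> G \<subseteq> H"
proof
  assume "orthant G \<subseteq> orthant H"
  then show "G \<subseteq> H" using single_in_orthant subset_iff by metis
qed (auto simp: orthant_def)

lemma convex_cone_orthant: "convex_cone (orthant G)"
  unfolding convex_cone_iff
  by (auto intro!: orthantI simp: lookup_add orthantD)

lemma convex_cone_hull_singles: "convex_cone hull ((\<lambda>x. single x 1) ` G) = orthant G"
proof (rule hull_unique)
  show "(\<lambda>x. single x 1) ` G \<subseteq> orthant G" by (simp add: image_subset_iff single_in_orthant)
  show "convex_cone (orthant G)" by (rule convex_cone_orthant)
  fix C :: "('a \<Rightarrow>\<^sub>0 real) set"
  assume cone_C: "(\<lambda>x. single x 1) ` G \<subseteq> C" "convex_cone C"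
  show "orthant G \<subseteq> C"
  proof
    fix v assume "v \<in> orthant G"
    then have "(\<Sum>x\<in>keys v. lookup v x *\<^sub>R single x 1) \<in> C"
      using cone_C by (intro convex_cone_sum convex_cone_scaleR) (auto simp: orthant_def)
    then show "v \<in> C" by (simp flip: poly_mapping_sum_scaleR)
  qed
qed

lemma orthant_face_of:
  assumes "G \<subseteq> H" "finite H"
  shows "orthant G face_of orthant H"
proof -
  let ?f = "\<lambda>v :: 'a \<Rightarrow>\<^sub>0 real. \<Sum>x\<in>H - G. lookup v x"
  have "?f v = 0 \<longleftrightarrow> (\<forall>x\<in>H - G. lookup v x = 0)" if "v \<in> orthant H" for v
    using assms(2) that by (simp add: sum_nonneg_eq_0_iff orthantD)
  then have "{v \<in> orthant H. ?f v = 0} = {v \<in> orthant H. \<forall>x\<in>H - G. lookup v x = 0}"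
    by blast
  also have "\<dots> = orthant G"
    using assms(1) unfolding orthant_def by (fastforce simp: in_keys_iff)
  finally have "orthant G = {v \<in> orthant H. ?f v = 0}" ..
  moreover have "linear ?f" by (intro linear_compose_sum ballI linear_lookup)
  ultimately show ?thesis
    using face_of_Int_kernel[of "orthant H" ?f] convex_cone_orthant[of H]
    by (simp add: convex_cone_def sum_nonneg orthantD)
qed

lemma face_of_orthant:
  assumes face_F: "F face_of orthant Y" and "F \<noteq> {}"
  obtains G where "G \<subseteq> Y" "F = orthant G"
proof
  let ?G = "{x. single x 1 \<in> F}"
  have subset: "F \<subseteq> orthant Y" by (rule face_of_imp_subset[OF face_F])
  then show "?G \<subseteq> Y" by (auto simp flip: single_in_orthant[of _ Y])
  have "conic F"
    using face_of_conic[OF _ face_F] convex_cone_orthant[of Y] by (simp add: convex_cone_def)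
  then have cone: "convex_cone F"
    using \<open>F \<noteq> {}\<close> face_of_imp_convex[OF face_F] by (simp add: convex_cone_def)
  have ray: "single x 1 \<in> F" if v_in_F: "v \<in> F" and x_in_keys: "x \<in> keys v" for v x
  proof -
    define a where "a = (2 * lookup v x) *\<^sub>R single x (1::real)"
    define b where "b = 2 *\<^sub>R v - a"
    have v_in_orthant: "v \<in> orthant Y" using v_in_F subset by blast
    have pos: "lookup v x > 0"
      using orthantD(2)[OF v_in_orthant, of x] x_in_keys by (simp add: in_keys_iff)
    have endpoints: "a \<in> orthant Y" "b \<in> orthant Y"
      using orthantD[OF v_in_orthant] pos
      by (auto intro!: orthantI simp: a_def b_def lookup_minus lookup_single when_def)
    have "lookup a x \<noteq> lookup b x"
      using pos by (simp add: a_def b_def lookup_minus)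
    moreover have "v = (1 - 1 / 2) *\<^sub>R a + (1 / 2) *\<^sub>R b"
      by (simp add: b_def scaleR_diff_right)
    ultimately have "v \<in> open_segment a b"
      unfolding in_segment by (intro conjI exI[of _ "1 / 2 :: real"]) auto
    then have "a \<in> F" using face_ofD[OF face_F _ endpoints v_in_F] by blast
    then have "(1 / (2 * lookup v x)) *\<^sub>R a \<in> F"
      using pos by (intro convex_cone_scaleR[OF cone]) simp_all
    then show ?thesis using pos by (simp add: a_def)
  qed
  show "F = orthant ?G"
  proof
    show "F \<subseteq> orthant ?G" using ray subset by (auto simp: orthant_def)
    have "convex_cone hull ((\<lambda>x. single x 1) ` ?G) \<subseteq> F"
      by (rule hull_minimal) (auto simp: cone)
    then show "orthant ?G \<subseteq> F" by (simp add: convex_cone_hull_singles)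
  qed
qed

section \<open>Vertices of arrangements\<close>

definition slope :: "'e arrangement \<Rightarrow> 'e \<Rightarrow> (nat \<Rightarrow> real) \<Rightarrow> real" where
  "slope A e m = (\<Sum>i<rk A. m i * real_of_int (normal A e i))"

lemma slope_0: "slope A e (\<lambda>_. 0) = 0"
  by (simp add: slope_def)

lemma slope_diff: "slope A e (\<lambda>i. m i - m' i) = slope A e m - slope A e m'"
  by (simp add: slope_def left_diff_distrib sum_subtractf)

lemma aff_slope: "aff A e m = slope A e m + real_of_int (shift A e)"
  by (simp add: aff_def slope_def)

lemma aff_translate: "aff A e (\<lambda>i. m i + t * w i) = aff A e m + t * slope A e w"
  by (simp add: aff_def slope_def distrib_right sum.distrib sum_distrib_left mult.assoc)

lemma sum_mult_slope:
  "(\<Sum>e\<in>F. c e * slope A e m) = (\<Sum>i<rk A. m i * (\<Sum>e\<in>F. c e * real_of_int (normal A e i)))"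
  unfolding slope_def sum_distrib_left by (subst sum.swap) (simp add: mult_ac)

definition hyperplanes_at :: "'e arrangement \<Rightarrow> (nat \<Rightarrow> real) \<Rightarrow> 'e set" where
  "hyperplanes_at A m = {e \<in> idx A. aff A e m = 0}"

definition separating :: "'e arrangement \<Rightarrow> 'e set \<Rightarrow> bool" where
  "separating A B \<longleftrightarrow> B \<subseteq> idx A \<and>
     (\<forall>m\<in>coord_space (rk A). (\<forall>e\<in>B. slope A e m = 0) \<longrightarrow> m = (\<lambda>_. 0))"

lemma separatingD:
  assumes "separating A B" "m \<in> coord_space (rk A)" "\<And>e. e \<in> B \<Longrightarrow> slope A e m = 0"
  shows "m = (\<lambda>_. 0)"
  using assms by (simp add: separating_def)

text \<open>A minimal separating set indexes a basis of the space spanned by the normals.\<close>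

definition normal_basis :: "'e arrangement \<Rightarrow> 'e set \<Rightarrow> bool" where
  "normal_basis A B \<longleftrightarrow> separating A B \<and>
     (\<forall>b\<in>B. \<exists>m. slope A b m \<noteq> 0 \<and> (\<forall>e\<in>B - {b}. slope A e m = 0))"

lemma normal_basis_subset: "normal_basis A B \<Longrightarrow> B \<subseteq> idx A"
  by (simp add: normal_basis_def separating_def)

lemma normal_basis_exists:
  assumes "finite (idx A)" "separating A (idx A)"
  obtains B where "normal_basis A B"
proof -
  obtain B where separating: "separating A B" and min: "\<And>B'. separating A B' \<Longrightarrow> card B \<le> card B'"
    using ex_has_least_nat[of "separating A" "idx A" card] assms(2) by blast
  have "finite B" using separating assms(1) by (auto simp: separating_def intro: finite_subset)
  have "\<exists>m. slope A b m \<noteq> 0 \<and> (\<forall>e\<in>B - {b}. slope A e m = 0)" if "b \<in> B" for b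
  proof (rule ccontr)
    assume "\<not> ?thesis"
    then have "separating A (B - {b})" using separating by (auto simp: separating_def)
    then have "card B \<le> card (B - {b})" by (rule min)
    then show False using that \<open>finite B\<close> card_Diff1_less by (metis leD)
  qed
  then show thesis using that[of B] separating unfolding normal_basis_def by blast
qed

lemma normal_basis_independent:
  assumes basis: "normal_basis A B" and "finite (idx A)" and supp: "\<And>e. e \<notin> B \<Longrightarrow> c e = (0::real)"
    and zero: "\<And>i. (\<Sum>e\<in>idx A. c e * real_of_int (normal A e i)) = 0"
  shows "c e = 0"
proof (cases "e \<in> B")
  case True
  then obtain m where dual_m: "slope A e m \<noteq> 0" "\<And>e'. e' \<in> B - {e} \<Longrightarrow> slope A e' m = 0"
    using basis unfolding normal_basis_def by blast
  have "0 = (\<Sum>e'\<in>idx A. c e' * slope A e' m)"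
    by (simp add: sum_mult_slope zero)
  also have "\<dots> = (\<Sum>e'\<in>idx A. if e' = e then c e * slope A e m else 0)"
    by (rule sum.cong) (use dual_m supp in auto)
  also have "\<dots> = c e * slope A e m"
    using True normal_basis_subset[OF basis] \<open>finite (idx A)\<close> by auto
  finally show ?thesis using dual_m(1) by simp
qed (rule supp)

lemma eventually_sgn_aff_translate:
  assumes "aff A e \<xi> = 0 \<Longrightarrow> slope A e w = 0"
  shows "\<forall>\<^sub>F t in at_right 0. sgn (aff A e (\<lambda>i. \<xi> i + t * w i)) = sgn (aff A e \<xi>)"
proof -
  have lim: "((\<lambda>t. aff A e (\<lambda>i. \<xi> i + t * w i)) \<longlongrightarrow> aff A e \<xi>) (at_right 0)"
    unfolding aff_translate by (auto intro!: tendsto_eq_intros)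
  consider (zero) "aff A e \<xi> = 0" | (pos) "aff A e \<xi> > 0" | (neg) "aff A e \<xi> < 0" by linarith
  then show ?thesis
  proof cases
    case zero
    then show ?thesis using assms by (simp add: aff_translate)
  next
    case pos
    with order_tendstoD(1)[OF lim, of 0] show ?thesis by (auto elim!: eventually_mono)
  next
    case neg
    with order_tendstoD(2)[OF lim, of 0] show ?thesis by (auto elim!: eventually_mono)
  qed
qed

lemma sign_vector_translate:
  assumes "finite (idx A)" and "\<And>e. e \<in> hyperplanes_at A \<xi> \<Longrightarrow> slope A e w = 0"
  obtains t where "t > 0" "sign_vector A (\<lambda>i. \<xi> i + t * w i) = sign_vector A \<xi>"
proof -
  have "\<forall>\<^sub>F t in at_right 0. \<forall>e\<in>idx A. sgn (aff A e (\<lambda>i. \<xi> i + t * w i)) = sgn (aff A e \<xi>)"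
    using assms
    by (intro eventually_ball_finite ballI eventually_sgn_aff_translate)
      (auto simp: hyperplanes_at_def)
  then have "\<forall>\<^sub>F t in at_right 0. t > 0 \<and>
      (\<forall>e\<in>idx A. sgn (aff A e (\<lambda>i. \<xi> i + t * w i)) = sgn (aff A e \<xi>))"
    using eventually_at_right_less by (rule eventually_conj[rotated])
  then obtain t :: real where "t > 0"
    "\<forall>e\<in>idx A. sgn (aff A e (\<lambda>i. \<xi> i + t * w i)) = sgn (aff A e \<xi>)"
    using eventually_happens'[OF trivial_limit_at_right_real] by blast
  then show thesis
    by (intro that) (auto simp: sign_vector_def intro!: restrict_ext)
qed

lemma vertex_iff_separating:
  assumes "finite (idx A)"
  shows "\<xi> \<in> vertices A \<longleftrightarrow> \<xi> \<in> coord_space (rk A) \<and> separating A (hyperplanes_at A \<xi>)"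
proof (intro iffI conjI)
  assume "\<xi> \<in> vertices A"
  then have fiber: "{m \<in> coord_space (rk A). sign_vector A m = sign_vector A \<xi>} = {\<xi>}"
    by (simp add: vertices_def)
  then show coords: "\<xi> \<in> coord_space (rk A)" by blast
  have "w = (\<lambda>_. 0)"
    if w_coords: "w \<in> coord_space (rk A)" and zero: "\<forall>e\<in>hyperplanes_at A \<xi>. slope A e w = 0" for w
  proof -
    obtain t where translate: "t > 0" "sign_vector A (\<lambda>i. \<xi> i + t * w i) = sign_vector A \<xi>"
      using sign_vector_translate[OF assms] zero by blast
    have "(\<lambda>i. \<xi> i + t * w i) \<in> {m \<in> coord_space (rk A). sign_vector A m = sign_vector A \<xi>}"
      using w_coords coords translate(2) by (simp add: coord_space_def)
    then have "(\<lambda>i. \<xi> i + t * w i) = \<xi>" unfolding fiber by blast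
    then have "t * w i = 0" for i by (metis add_cancel_left_right)
    then show ?thesis using translate(1) by auto
  qed
  then show "separating A (hyperplanes_at A \<xi>)"
    by (auto simp: separating_def hyperplanes_at_def)
next
  assume separated: "\<xi> \<in> coord_space (rk A) \<and> separating A (hyperplanes_at A \<xi>)"
  have "m = \<xi>" if m_coords: "m \<in> coord_space (rk A)"
    and sgn: "sign_vector A m = sign_vector A \<xi>" for m
  proof -
    have "slope A e (\<lambda>i. m i - \<xi> i) = 0" if hyperplane: "e \<in> hyperplanes_at A \<xi>" for e
    proof -
      have "sgn (aff A e m) = sgn (aff A e \<xi>)"
        using fun_cong[OF sgn, of e] hyperplane by (simp add: sign_vector_def hyperplanes_at_def)
      then show ?thesis using hyperplane
        by (simp add: slope_diff hyperplanes_at_def aff_slope sgn_zero_iff)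
    qed
    moreover have "(\<lambda>i. m i - \<xi> i) \<in> coord_space (rk A)" using m_coords separated
      by (simp add: coord_space_def)
    ultimately have "(\<lambda>i. m i - \<xi> i) = (\<lambda>_. 0)" using separated separatingD by blast
    then show ?thesis by (auto simp: fun_eq_iff)
  qed
  then show "\<xi> \<in> vertices A" using separated unfolding vertices_def by blast
qed

lemma exists_more_hyperplanes_at:
  assumes "\<xi> \<in> coord_space (rk A)" "w \<in> coord_space (rk A)"
    and zero: "\<And>e. e \<in> hyperplanes_at A \<xi> \<Longrightarrow> slope A e w = 0"
    and moving_e: "e \<in> idx A" "slope A e w \<noteq> 0"
  obtains m where "m \<in> coord_space (rk A)" "hyperplanes_at A \<xi> \<subset> hyperplanes_at A m"
proof
  let ?m = "\<lambda>i. \<xi> i + (- aff A e \<xi> / slope A e w) * w i"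
  show "?m \<in> coord_space (rk A)" using assms by (simp add: coord_space_def)
  have "e \<in> hyperplanes_at A ?m"
    using moving_e unfolding hyperplanes_at_def mem_Collect_eq aff_translate by simp
  moreover have "e \<notin> hyperplanes_at A \<xi>" using zero moving_e(2) by blast
  moreover have "hyperplanes_at A \<xi> \<subseteq> hyperplanes_at A ?m"
    using zero unfolding hyperplanes_at_def aff_translate by auto
  ultimately show "hyperplanes_at A \<xi> \<subset> hyperplanes_at A ?m" by blast
qed

lemma vertex_exists:
  assumes "finite (idx A)" "separating A (idx A)"
  obtains \<xi> where "\<xi> \<in> vertices A"
proof -
  let ?H = "hyperplanes_at A ` coord_space (rk A)"
  have "?H \<subseteq> Pow (idx A)" by (auto simp: hyperplanes_at_def)
  then have "finite ?H" using assms(1) finite_subset by blast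
  moreover have "?H \<noteq> {}" by (auto simp: coord_space_def)
  ultimately obtain H where "H \<in> ?H" and max: "\<forall>H'\<in>?H. H \<subseteq> H' \<longrightarrow> H = H'"
    using finite_has_maximal[of ?H] by blast
  then obtain \<xi> where coords: "\<xi> \<in> coord_space (rk A)" and H_eq: "H = hyperplanes_at A \<xi>" by blast
  have "w = (\<lambda>_. 0)"
    if invisible_w: "w \<in> coord_space (rk A)" "\<forall>e\<in>hyperplanes_at A \<xi>. slope A e w = 0" for w
  proof (rule separatingD[OF assms(2) invisible_w(1)], rule ccontr)
    fix e assume moving_e: "e \<in> idx A" "slope A e w \<noteq> 0"
    obtain m where "m \<in> coord_space (rk A)" "hyperplanes_at A \<xi> \<subset> hyperplanes_at A m"
      using exists_more_hyperplanes_at[OF coords invisible_w(1) _ moving_e] invisible_w(2) by blast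
    then show False using max H_eq by blast
  qed
  then have "separating A (hyperplanes_at A \<xi>)"
    by (auto simp: separating_def hyperplanes_at_def)
  then show thesis using that coords vertex_iff_separating[OF assms(1)] by blast
qed

section \<open>The Lawrence lattice and the Lawrence fan\<close>

lemma UNIV_sign: "UNIV = {Pos, Neg}"
  using sign.exhaust by blast

lemma finite_sign [simp]: "finite (UNIV :: sign set)"
  by (subst UNIV_sign) simp

lemma sum_sign: "(\<Sum>x\<in>E \<times> (UNIV :: sign set). F x) = (\<Sum>e\<in>E. F (e, Pos) + F (e, Neg))"
proof -
  have "(\<Sum>s\<in>UNIV. F (e, s)) = F (e, Pos) + F (e, Neg)" for e
    by (subst UNIV_sign) simp
  then show ?thesis
    using sum.cartesian_product[of "\<lambda>e s. F (e, s)" UNIV E] by simp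
qed

lemma linear_pairing: "linear (pairing u)"
  by (rule linearI)
    (simp_all add: pairing_def lookup_add distrib_left sum.distrib sum_distrib_left mult_ac)

lemma pairing_single: "pairing u (single x 1) = real_of_int (lookup u x)"
proof -
  have "pairing u (single x 1) = (\<Sum>z\<in>keys u. if z = x then real_of_int (lookup u x) else 0)"
    unfolding pairing_def by (rule sum.cong) (auto simp: lookup_single when_def)
  then show ?thesis by (simp add: in_keys_iff)
qed

locale spanning_arrangement =
  fixes A :: "'e arrangement"
  assumes primitive_spanning: "primitive_spanning A"
begin

abbreviation "E \<equiv> idx A"
abbreviation "d \<equiv> rk A"

lemma finite_E [simp]: "finite E"
  using primitive_spanning by (simp add: primitive_spanning_def)

lemma finite_EU [simp]: "finite (E \<times> (UNIV :: sign set))"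
  by simp

lemma normal_beyond: "e \<in> E \<Longrightarrow> j \<ge> d \<Longrightarrow> normal A e j = 0"
  using primitive_spanning
  by (auto simp: primitive_spanning_def primitive_vector_def coord_space_def)

text \<open>Lifts of the unit vectors of \<open>N\<close> along \<open>\<delta>\<^sub>e \<mapsto> a\<^sub>e\<close>.\<close>

definition unit_lift :: "nat \<Rightarrow> 'e \<Rightarrow> int" where
  "unit_lift i = (SOME c. \<forall>j. (\<Sum>e\<in>E. c e * normal A e j) = (if j = i then 1 else 0))"

lemma sum_unit_lift:
  assumes "i < d"
  shows "(\<Sum>e\<in>E. unit_lift i e * normal A e j) = (if j = i then 1 else 0)"
proof -
  have "(\<lambda>j. if j = i then 1 else 0 :: int) \<in> coord_space d"
    using assms by (auto simp: coord_space_def)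
  then obtain c :: "'e \<Rightarrow> int" where
    "(\<lambda>j. if j = i then 1 else 0) = (\<lambda>j. \<Sum>e\<in>E. c e * normal A e j)"
    using primitive_spanning unfolding primitive_spanning_def by blast
  then have "\<exists>c. \<forall>j. (\<Sum>e\<in>E. c e * normal A e j) = (if j = i then 1 else 0)" by metis
  then have "\<forall>j. (\<Sum>e\<in>E. unit_lift i e * normal A e j) = (if j = i then 1 else 0)"
    unfolding unit_lift_def by (rule someI_ex)
  then show ?thesis by blast
qed

lemma separating_E: "separating A E"
  unfolding separating_def
proof (intro conjI ballI impI ext)
  fix m i assume m_coords: "m \<in> coord_space d" and zero: "\<forall>e\<in>E. slope A e m = 0"
  show "m i = 0"
  proof (cases "i < d")
    case True
    have "real_of_int (\<Sum>e\<in>E. unit_lift i e * normal A e j) = (if j = i then 1 else 0)" for j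
      by (simp only: sum_unit_lift[OF True]) simp
    then have "(\<Sum>e\<in>E. real_of_int (unit_lift i e) * slope A e m) = m i"
      using True by (simp add: sum_mult_slope if_distrib[of "(*) _"] cong: if_cong)
    then show ?thesis using zero by simp
  next
    case False
    then show ?thesis using m_coords by (simp add: coord_space_def)
  qed
qed simp

text \<open>The relation expressing \<open>a\<^sub>f\<close> in terms of the lifted unit vectors.\<close>

definition unit_relation :: "'e \<Rightarrow> ('e \<Rightarrow>\<^sub>0 int)" where
  "unit_relation f =
     poly_mapping_on E (\<lambda>e. (if e = f then 1 else 0) - (\<Sum>i<d. normal A f i * unit_lift i e))"

lemma lookup_unit_relation:
  "e \<in> E \<Longrightarrow> lookup (unit_relation f) e =
     (if e = f then 1 else 0) - (\<Sum>i<d. normal A f i * unit_lift i e)"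
  by (simp add: unit_relation_def lookup_poly_mapping_on)

lemma sum_lookup_unit_relation:
  fixes w :: "'e \<Rightarrow> 'a::comm_ring_1"
  assumes "f \<in> E"
  shows "(\<Sum>e\<in>E. of_int (lookup (unit_relation f) e) * w e) =
    w f - (\<Sum>i<d. of_int (normal A f i) * (\<Sum>e\<in>E. of_int (unit_lift i e) * w e))"
proof -
  have "(\<Sum>e\<in>E. of_int (lookup (unit_relation f) e) * w e) =
      (\<Sum>e\<in>E. if e = f then w e else 0) -
      (\<Sum>e\<in>E. \<Sum>i<d. of_int (normal A f i) * (of_int (unit_lift i e) * w e))"
    unfolding sum_subtractf[symmetric]
    by (rule sum.cong)
      (auto simp: lookup_unit_relation left_diff_distrib sum_distrib_right mult.assoc)
  also have "(\<Sum>e\<in>E. \<Sum>i<d. of_int (normal A f i) * (of_int (unit_lift i e) * w e)) =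
      (\<Sum>i<d. of_int (normal A f i) * (\<Sum>e\<in>E. of_int (unit_lift i e) * w e))"
    by (subst sum.swap) (simp add: sum_distrib_left)
  finally show ?thesis using assms by simp
qed

lemma unit_relation_in_relations:
  assumes "f \<in> E"
  shows "unit_relation f \<in> relations A"
proof -
  have "(\<Sum>e\<in>E. lookup (unit_relation f) e * normal A e j) = 0" for j
  proof -
    have "(\<Sum>i<d. normal A f i * (\<Sum>e\<in>E. unit_lift i e * normal A e j)) =
        (\<Sum>i<d. if i = j then normal A f i else 0)"
      by (rule sum.cong) (auto simp: sum_unit_lift)
    also have "\<dots> = normal A f j"
      using normal_beyond[OF assms, of j] by auto
    finally show ?thesis
      using sum_lookup_unit_relation[OF assms, of "\<lambda>e. normal A e j"] by simp
  qed
  moreover have "keys (unit_relation f) \<subseteq> E"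
    by (simp add: unit_relation_def keys_poly_mapping_on)
  ultimately show ?thesis by (auto simp: relations_def)
qed

lemma slope_if_relations_vanish:
  assumes "\<And>c. c \<in> relations A \<Longrightarrow> (\<Sum>e\<in>E. real_of_int (lookup c e) * w e) = 0"
  obtains m where "m \<in> coord_space d" "\<And>e. e \<in> E \<Longrightarrow> w e = slope A e m"
proof
  let ?m = "\<lambda>i. if i < d then \<Sum>e\<in>E. real_of_int (unit_lift i e) * w e else 0"
  show "?m \<in> coord_space d" by (simp add: coord_space_def)
  fix f assume f_in_E: "f \<in> E"
  have "w f = (\<Sum>i<d. real_of_int (normal A f i) * (\<Sum>e\<in>E. real_of_int (unit_lift i e) * w e))"
    using assms[OF unit_relation_in_relations[OF f_in_E]] sum_lookup_unit_relation[OF f_in_E, of w]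
    by simp
  also have "\<dots> = slope A f ?m" by (simp add: slope_def mult.commute)
  finally show "w f = slope A f ?m" .
qed

lemma lookup_relation_vec:
  "lookup (relation_vec A c) (e, s) =
     (if e \<in> E then case s of Pos \<Rightarrow> real_of_int (lookup c e) | Neg \<Rightarrow> - real_of_int (lookup c e)
       else 0)"
proof -
  have "lookup (relation_vec A c) (e, s) = (\<Sum>f\<in>E. if f = e then
      (case s of Pos \<Rightarrow> real_of_int (lookup c e) | Neg \<Rightarrow> - real_of_int (lookup c e)) else 0)"
    unfolding relation_vec_def lookup_sum
    by (rule sum.cong; cases s) (auto simp: lookup_minus lookup_single when_def)
  then show ?thesis by simp
qed

lemma subspace_Lam_real: "subspace (Lam_real A)"
  unfolding Lam_real_def by (rule subspace_span)

lemma Lam_realD: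
  assumes "v \<in> Lam_real A"
  shows "keys v \<subseteq> E \<times> UNIV"
    and "lookup v (e, Neg) = - lookup v (e, Pos)"
    and "(\<Sum>e\<in>E. lookup v (e, Pos) * real_of_int (normal A e i)) = 0"
proof -
  let ?T = "{v :: 'e \<times> sign \<Rightarrow>\<^sub>0 real. (\<forall>e s. e \<notin> E \<longrightarrow> lookup v (e, s) = 0) \<and>
     (\<forall>e. lookup v (e, Neg) = - lookup v (e, Pos)) \<and>
     (\<forall>i. (\<Sum>e\<in>E. lookup v (e, Pos) * real_of_int (normal A e i)) = 0)}"
  have "subspace ?T"
    by (rule subspaceI)
      (simp_all add: lookup_add distrib_right sum.distrib mult.assoc flip: sum_distrib_left)
  moreover have "relation_vec A ` relations A \<subseteq> ?T"
  proof (clarsimp simp: lookup_relation_vec)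
    fix c i assume "c \<in> relations A"
    then have "real_of_int (\<Sum>e\<in>E. lookup c e * normal A e i) = 0" by (simp add: relations_def)
    then show "(\<Sum>e\<in>E. real_of_int (lookup c e) * real_of_int (normal A e i)) = 0" by simp
  qed
  ultimately have "v \<in> ?T"
    using assms span_minimal[of "relation_vec A ` relations A" ?T] unfolding Lam_real_def by blast
  then show "keys v \<subseteq> E \<times> UNIV" "lookup v (e, Neg) = - lookup v (e, Pos)"
    "(\<Sum>e\<in>E. lookup v (e, Pos) * real_of_int (normal A e i)) = 0"
    by (auto simp: in_keys_iff)
qed

lemma pairing_Lam_real:
  assumes "u \<in> M_tilde A" "v \<in> Lam_real A"
  shows "pairing u v = 0"
  using linear_eq_0_on_span[OF linear_pairing, of "relation_vec A ` relations A" u v] assms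
  by (auto simp: M_tilde_def Lam_real_def)

lemma slope_if_vanishing_on_Lam_real:
  fixes f :: "('e \<times> sign \<Rightarrow>\<^sub>0 real) \<Rightarrow> real"
  assumes "linear f" and zero: "\<And>v. v \<in> Lam_real A \<Longrightarrow> f v = 0"
  obtains m where "m \<in> coord_space d"
    "\<And>e. e \<in> E \<Longrightarrow> f (single (e, Pos) 1) - f (single (e, Neg) 1) = slope A e m"
proof (rule slope_if_relations_vanish)
  fix c assume "c \<in> relations A"
  then have "f (relation_vec A c) = 0"
    unfolding Lam_real_def by (intro zero[unfolded Lam_real_def] span_base imageI)
  then show "(\<Sum>e\<in>E. real_of_int (lookup c e) * (f (single (e, Pos) 1) - f (single (e, Neg) 1))) = 0"
    unfolding relation_vec_def using \<open>linear f\<close> by (simp add: linear_sum linear_scale linear_diff)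
qed (rule that)

lemma M_tilde_slope:
  assumes "u \<in> M_tilde A"
  obtains m where "m \<in> coord_space d"
    "\<And>e. e \<in> E \<Longrightarrow> real_of_int (lookup u (e, Pos) - lookup u (e, Neg)) = slope A e m"
  using slope_if_vanishing_on_Lam_real[OF linear_pairing pairing_Lam_real[OF assms]]
  by (auto simp: pairing_single)

definition coords :: "'e set \<Rightarrow> ('e \<times> sign) set" where
  "coords B = B \<times> {Pos} \<union> E \<times> {Neg}"

lemma coords_subset: "normal_basis A B \<Longrightarrow> coords B \<subseteq> E \<times> UNIV"
  using normal_basis_subset by (auto simp: coords_def)

lemma finite_coords: "normal_basis A B \<Longrightarrow> finite (coords B)"
  using coords_subset finite_subset finite_EU by blast

lemma inj_on_coords_M_tilde:
  assumes basis: "normal_basis A B"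
  shows "inj_on (\<lambda>u. restrict (lookup u) (coords B)) (M_tilde A)"
proof (rule inj_onI)
  fix u v assume character_u: "u \<in> M_tilde A" and character_v: "v \<in> M_tilde A"
    and "restrict (lookup u) (coords B) = restrict (lookup v) (coords B)"
  then have eq: "lookup u x = lookup v x" if "x \<in> coords B" for x
    using that by (metis restrict_apply')
  obtain m where slope_u: "m \<in> coord_space d"
    "\<And>e. e \<in> E \<Longrightarrow> real_of_int (lookup u (e, Pos) - lookup u (e, Neg)) = slope A e m"
    using M_tilde_slope[OF character_u] by blast
  obtain m' where slope_v: "m' \<in> coord_space d"
    "\<And>e. e \<in> E \<Longrightarrow> real_of_int (lookup v (e, Pos) - lookup v (e, Neg)) = slope A e m'"
    using M_tilde_slope[OF character_v] by blast
  have "slope A e (\<lambda>i. m i - m' i) = 0" if "e \<in> B" for e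
    using that normal_basis_subset[OF basis] eq[of "(e, Pos)"] eq[of "(e, Neg)"] slope_u(2)[of e]
      slope_v(2)[of e]
    by (auto simp: slope_diff coords_def)
  moreover have "(\<lambda>i. m i - m' i) \<in> coord_space d" using slope_u slope_v
    by (simp add: coord_space_def)
  ultimately have "(\<lambda>i. m i - m' i) = (\<lambda>_. 0)"
    using basis separatingD unfolding normal_basis_def by blast
  then have "m = m'" by (auto simp: fun_eq_iff)
  then have "lookup u (e, s) = lookup v (e, s)" if "e \<in> E" for e s
    using that eq[of "(e, Neg)"] slope_u(2)[of e] slope_v(2)[of e]
    by (cases s) (auto simp: coords_def)
  then show "u = v"
    using character_u character_v
    by (intro poly_mapping_eq_onI[of u "E \<times> UNIV"]) (auto simp: M_tilde_def)
qed

definition generators :: "(nat \<Rightarrow> real) \<Rightarrow> ('e \<times> sign) set" where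
  "generators \<xi> = E_pos A \<xi> \<times> {Pos} \<union> E_neg A \<xi> \<times> {Neg}"

lemma generators_subset: "generators \<xi> \<subseteq> E \<times> UNIV"
  by (auto simp: generators_def E_pos_def E_neg_def)

lemma vertex_cone_eq: "vertex_cone A \<xi> = {v + l | v l. v \<in> orthant (generators \<xi>) \<and> l \<in> Lam_real A}"
proof -
  have "(\<lambda>e. single (e, Pos) (1::real)) ` E_pos A \<xi> \<union> (\<lambda>e. single (e, Neg) 1) ` E_neg A \<xi> =
      (\<lambda>x. single x 1) ` generators \<xi>"
    by (auto simp: generators_def)
  then have "vertex_cone A \<xi> = convex_cone hull ((\<lambda>x. single x 1) ` generators \<xi> \<union> Lam_real A)"
    unfolding vertex_cone_def by simp
  also have "convex_cone hull Lam_real A = Lam_real A"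
    unfolding Lam_real_def by (rule hull_same) (rule convex_cone_span)
  then have "convex_cone hull ((\<lambda>x. single x 1) ` generators \<xi> \<union> Lam_real A) =
      {v + l | v l. v \<in> orthant (generators \<xi>) \<and> l \<in> Lam_real A}"
    unfolding convex_cone_hull_Un convex_cone_hull_singles by auto
  finally show ?thesis .
qed

lemma convex_cone_vertex_cone: "convex_cone (vertex_cone A \<xi>)"
  unfolding vertex_cone_def by (rule convex_cone_convex_cone_hull)

lemma single_in_vertex_cone: "x \<in> generators \<xi> \<Longrightarrow> single x 1 \<in> vertex_cone A \<xi>"
  unfolding vertex_cone_eq
  using subspace_0[OF subspace_Lam_real] single_in_orthant[of x "generators \<xi>"]
  by force

lemma Lam_real_subset_vertex_cone: "Lam_real A \<subseteq> vertex_cone A \<xi>"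
  unfolding vertex_cone_def by (rule order_trans[OF _ hull_subset]) simp

lemma keys_vertex_cone:
  assumes "v \<in> vertex_cone A \<xi>"
  shows "keys v \<subseteq> E \<times> UNIV"
proof -
  obtain w l where decomposition: "v = w + l" "w \<in> orthant (generators \<xi>)" "l \<in> Lam_real A"
    using assms unfolding vertex_cone_eq by blast
  have "keys w \<subseteq> E \<times> UNIV" using decomposition(2) generators_subset[of \<xi>]
    by (auto simp: orthant_def)
  then show ?thesis unfolding decomposition(1)
    by (rule keys_add_subset[OF _ Lam_realD(1)[OF decomposition(3)]])
qed

lemma single_in_span_vertex_cone:
  assumes vertex: "\<xi> \<in> vertices A" and x_generator: "x \<in> E \<times> UNIV"
  shows "single x 1 \<in> span (vertex_cone A \<xi>)"
proof (rule ccontr)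
  assume "\<not> ?thesis"
  then obtain f :: "_ \<Rightarrow> real" where separates: "linear f" "\<And>v. v \<in> span (vertex_cone A \<xi>) \<Longrightarrow> f v = 0"
    "f (single x 1) = 1"
    by (rule exists_separating_functional) blast
  let ?f = "\<lambda>x. f (single x 1)"
  have gen: "?f y = 0" if "y \<in> generators \<xi>" for y
    using separates(2) single_in_vertex_cone[OF that] span_base by blast
  have "f v = 0" if "v \<in> Lam_real A" for v
    using that Lam_real_subset_vertex_cone by (intro separates(2) span_base) blast
  then obtain m where slope_f: "m \<in> coord_space d"
    "\<And>e. e \<in> E \<Longrightarrow> ?f (e, Pos) - ?f (e, Neg) = slope A e m"
    using slope_if_vanishing_on_Lam_real[OF separates(1)] by blast
  have "slope A e m = 0" if "e \<in> hyperplanes_at A \<xi>" for e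
    using slope_f(2)[of e] gen[of "(e, Pos)"] gen[of "(e, Neg)"] that
    by (simp add: generators_def E_pos_def E_neg_def hyperplanes_at_def)
  then have "m = (\<lambda>_. 0)"
    using vertex slope_f(1) separatingD vertex_iff_separating[OF finite_E] by blast
  then have eq: "?f (e, Pos) = ?f (e, Neg)" if "e \<in> E" for e
    using slope_f(2)[OF that] by (simp add: slope_0)
  obtain e s where x_eq: "x = (e, s)" "e \<in> E" using x_generator by auto
  have "?f (e, Pos) = 0 \<or> ?f (e, Neg) = 0"
    using gen[of "(e, Pos)"] gen[of "(e, Neg)"] x_eq(2)
    by (cases "aff A e \<xi> \<le> 0") (auto simp: generators_def E_pos_def E_neg_def)
  then show False using eq[OF x_eq(2)] separates(3) x_eq by (cases s) auto
qed

lemma Lam_real_eq_0_if_keys_coords: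
  assumes basis: "normal_basis A B" and lattice: "l \<in> Lam_real A" and keys: "keys l \<subseteq> coords B"
  shows "l = 0"
proof -
  have Pos: "lookup l (e, Pos) = 0" for e
  proof (rule normal_basis_independent[OF basis finite_E])
    show "lookup l (e, Pos) = 0" if "e \<notin> B" for e
      using that keys by (auto simp: coords_def in_keys_iff)
  qed (rule Lam_realD(3)[OF lattice])
  then have "lookup l (e, s) = 0" for e s
    using Lam_realD(2)[OF lattice, of e] by (cases s) auto
  then show "l = 0" by (intro poly_mapping_eqI) auto
qed

lemma card_coords_le_cone_dim:
  assumes basis: "normal_basis A B" and vertex: "\<xi> \<in> vertices A"
  shows "card (coords B) \<le> cone_dim A (vertex_cone A \<xi>)"
proof -
  let ?single = "\<lambda>x :: 'e \<times> sign. single x (1::real)"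
  have "card (?single ` coords B) \<le> cone_dim A (vertex_cone A \<xi>)"
    unfolding cone_dim_def
  proof (rule card_le_dim_diff)
    show "independent (?single ` coords B)"
      by (rule independent_singles[OF finite_coords[OF basis]])
    show "span (?single ` coords B) \<inter> span (Lam_real A) \<subseteq> {0}"
      using Lam_real_eq_0_if_keys_coords[OF basis]
      by (auto simp: span_singles Lam_real_def span_span)
    show "?single ` coords B \<union> Lam_real A \<subseteq> span (vertex_cone A \<xi>)"
      using single_in_span_vertex_cone[OF vertex] coords_subset[OF basis]
        Lam_real_subset_vertex_cone span_superset by blast
    show "vertex_cone A \<xi> \<subseteq> span (?single ` (E \<times> UNIV))"
      using keys_vertex_cone by (auto simp: span_singles)
  qed simp
  moreover have "inj ?single"
    by (rule injI) (metis lookup_single_eq lookup_single_not_eq zero_neq_one)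
  ultimately show ?thesis by (simp add: card_image inj_on_subset)
qed

lemma Lam_real_face_of_vertex_cone: "Lam_real A face_of vertex_cone A \<xi>"
proof -
  let ?f = "\<lambda>v. \<Sum>x\<in>E \<times> UNIV. lookup v x"
  have lin: "linear ?f" by (intro linear_compose_sum ballI linear_lookup)
  have zero: "?f l = 0" if "l \<in> Lam_real A" for l
    unfolding sum_sign using Lam_realD(2)[OF that] by simp
  have nonneg: "?f v \<ge> 0" and kernel: "?f v = 0 \<Longrightarrow> v \<in> Lam_real A"
    if in_cone: "v \<in> vertex_cone A \<xi>" for v
  proof -
    obtain w l where decomposition: "v = w + l" "w \<in> orthant (generators \<xi>)" "l \<in> Lam_real A"
      using in_cone unfolding vertex_cone_eq by blast
    have same_value: "?f w = ?f v"
      using decomposition(1) zero[OF decomposition(3)] linear_add[OF lin, of w l] by simp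
    then show "?f v \<ge> 0" using orthantD(2)[OF decomposition(2)] by (metis sum_nonneg)
    assume "?f v = 0"
    then have "\<forall>x\<in>E \<times> UNIV. lookup w x = 0"
      using same_value orthantD(2)[OF decomposition(2)]
        sum_nonneg_eq_0_iff[OF finite_EU, of "lookup w"] by metis
    then have "w = 0"
      using decomposition(2) generators_subset[of \<xi>]
      by (intro poly_mapping_eq_onI[of w "E \<times> UNIV"]) (auto simp: orthant_def)
    then show "v \<in> Lam_real A" using decomposition by simp
  qed
  have "Lam_real A = {v \<in> vertex_cone A \<xi>. ?f v = 0}"
    using zero kernel Lam_real_subset_vertex_cone by blast
  then show ?thesis
    using face_of_Int_kernel[OF _ lin nonneg] convex_cone_vertex_cone[of \<xi>]
    by (simp add: convex_cone_def)
qed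

lemma Lam_real_in_fan: "Lam_real A \<in> lawrence_fan A"
proof -
  obtain \<xi> where "\<xi> \<in> vertices A" using vertex_exists[OF finite_E separating_E] .
  moreover have "Lam_real A \<noteq> {}" using subspace_0[OF subspace_Lam_real] by blast
  ultimately show ?thesis
    using Lam_real_face_of_vertex_cone unfolding lawrence_fan_def by blast
qed

lemma vertex_cone_in_fan: "\<xi> \<in> vertices A \<Longrightarrow> vertex_cone A \<xi> \<in> lawrence_fan A"
  using convex_cone_vertex_cone[of \<xi>] unfolding lawrence_fan_def
  by (auto simp: convex_cone_def intro!: bexI[of _ \<xi>] face_of_refl)

lemma dual_monoid_Lam_real: "dual_monoid A (Lam_real A) = M_tilde A"
  and perp_lattice_Lam_real: "perp_lattice A (Lam_real A) = M_tilde A"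
  unfolding dual_monoid_def perp_lattice_def using pairing_Lam_real by auto

lemma perp_lattice_vertex_cone:
  assumes vertex: "\<xi> \<in> vertices A"
  shows "perp_lattice A (vertex_cone A \<xi>) = {0}"
proof
  show "perp_lattice A (vertex_cone A \<xi>) \<subseteq> {0}"
  proof
    fix u assume "u \<in> perp_lattice A (vertex_cone A \<xi>)"
    then have vanishing_u: "keys u \<subseteq> E \<times> UNIV" "\<And>v. v \<in> vertex_cone A \<xi> \<Longrightarrow> pairing u v = 0"
      by (auto simp: perp_lattice_def M_tilde_def)
    have "pairing u (single x 1) = 0" if "x \<in> E \<times> UNIV" for x
      using linear_eq_0_on_span[OF linear_pairing vanishing_u(2)
        single_in_span_vertex_cone[OF vertex that]] .
    then have "u = 0"
      using vanishing_u(1)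
      by (intro poly_mapping_eq_onI[of u "E \<times> UNIV"]) (auto simp: pairing_single)
    then show "u \<in> {0}" by simp
  qed
qed (simp add: perp_lattice_def M_tilde_def pairing_def)

lemma dual_monoid_vertex_cone_pointed:
  assumes vertex: "\<xi> \<in> vertices A" and dual_u: "u \<in> dual_monoid A (vertex_cone A \<xi>)"
    and dual_v: "v \<in> dual_monoid A (vertex_cone A \<xi>)" and "u + v = 0"
  shows "u = 0"
proof -
  have "pairing u w = 0" if "w \<in> vertex_cone A \<xi>" for w
  proof -
    have "pairing (u + v) w = 0"
      unfolding \<open>u + v = 0\<close> by (simp add: pairing_def)
    then have "pairing u w + pairing v w = 0" by (simp only: pairing_add)
    moreover have "pairing u w \<ge> 0" "pairing v w \<ge> 0"
      using dual_u dual_v that by (auto simp: dual_monoid_def)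
    ultimately show ?thesis by linarith
  qed
  then show ?thesis
    using dual_u perp_lattice_vertex_cone[OF vertex]
    by (auto simp: perp_lattice_def dual_monoid_def)
qed

abbreviation phi_exp :: "'e \<Rightarrow> ('e \<times> sign \<Rightarrow>\<^sub>0 int)" where
  "phi_exp e \<equiv> single (e, Pos) 1 + single (e, Neg) 1"

lemma lookup_phi_exp: "lookup (phi_exp e) (f, s) = (if f = e then 1 else 0)"
  by (cases s) (auto simp: lookup_add lookup_single when_def)

lemma keys_phi_exp: "keys (phi_exp e) = {(e, Pos), (e, Neg)}"
  using UNIV_sign by (auto simp: in_keys_iff lookup_phi_exp split: if_splits)

lemma inj_phi_exp: "inj phi_exp"
  by (rule injI) (metis lookup_phi_exp zero_neq_one)

lemma pairing_phi_exp: "pairing (phi_exp e) v = lookup v (e, Pos) + lookup v (e, Neg)"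
  unfolding pairing_def keys_phi_exp by (simp add: lookup_phi_exp)

lemma phi_exp_M_tilde: "e \<in> E \<Longrightarrow> phi_exp e \<in> M_tilde A"
  unfolding M_tilde_def keys_phi_exp by (simp add: pairing_phi_exp lookup_relation_vec keys_phi_exp)

lemma phi_exp_dual_monoid: "e \<in> E \<Longrightarrow> phi_exp e \<in> dual_monoid A (vertex_cone A \<xi>)"
  unfolding dual_monoid_def
proof (intro CollectI conjI ballI)
  fix v assume "v \<in> vertex_cone A \<xi>"
  then obtain w l where "v = w + l" "w \<in> orthant (generators \<xi>)" "l \<in> Lam_real A"
    unfolding vertex_cone_eq by blast
  then show "pairing (phi_exp e) v \<ge> 0"
    using Lam_realD(2)[of l e] orthantD(2)[of w] by (simp add: pairing_phi_exp lookup_add)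
qed (rule phi_exp_M_tilde)

end

section \<open>Points of the hypertoric variety\<close>

lemma add_submonoid_dual_monoid: "add_submonoid (dual_monoid A \<sigma>)"
  unfolding add_submonoid_def
proof (intro conjI ballI)
  show "0 \<in> dual_monoid A \<sigma>"
    by (simp add: dual_monoid_def M_tilde_def pairing_def)
  fix x y assume "x \<in> dual_monoid A \<sigma>" "y \<in> dual_monoid A \<sigma>"
  then show "x + y \<in> dual_monoid A \<sigma>"
    using keys_add[of x y] by (auto simp: dual_monoid_def M_tilde_def pairing_add)
qed

lemma dual_monoid_subset_M_tilde: "dual_monoid A \<sigma> \<subseteq> M_tilde A"
  by (auto simp: dual_monoid_def)

lemma hypertoric_atlas_simps [simp]:
  "charts (hypertoric_atlas A) = lawrence_fan A"
  "sub (hypertoric_atlas A) = (face_of)"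
  "mon (hypertoric_atlas A) = dual_monoid A"
  "van (hypertoric_atlas A) = hypertoric_ideal A"
  by (simp_all add: hypertoric_atlas_def closed_subatlas_def lawrence_atlas_def)

lemma pts_hypertoric_atlas:
  "(\<sigma>, q) \<in> pts (hypertoric_atlas A) \<longleftrightarrow> \<sigma> \<in> lawrence_fan A \<and>
     primeideal q (monoid_algebra (dual_monoid A \<sigma>)) \<and>
     (\<forall>u \<in> dual_monoid A \<sigma> - perp_lattice A \<sigma>. monomial u \<in> q) \<and> hypertoric_ideal A \<sigma> \<subseteq> q"
  by (auto simp: hypertoric_atlas_def closed_subatlas_def lawrence_atlas_def)

lemma prime_atlas_hypertoric: "prime_atlas (hypertoric_atlas A)"
proof (rule prime_atlas.intro)
  fix \<sigma> assume "\<sigma> \<in> charts (hypertoric_atlas A :: (_, _, 'k::field) atlas)"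
  then show "sub (hypertoric_atlas A :: (_, _, 'k) atlas) \<sigma> \<sigma>"
    by (auto simp: lawrence_fan_def intro!: face_of_refl face_of_imp_convex)
qed (auto simp: pts_hypertoric_atlas add_submonoid_dual_monoid)

lemma topspace_hypertoric: "topspace (topo (hypertoric A)) = pts (hypertoric_atlas A)"
  unfolding topo_scheme_of by (rule prime_atlas.topspace_zariski[OF prime_atlas_hypertoric])

lemma topspace_hypertoric_Int_orbit:
  "topspace (topo (hypertoric A)) \<inter> orbit A \<sigma> = {x \<in> pts (hypertoric_atlas A). fst x = \<sigma>}"
  unfolding topspace_hypertoric unfolding orbit_def hypertoric_atlas_def closed_subatlas_def by auto

lemma of_int_mult_monomial: "of_int k * monomial u = single u (of_int k :: 'k::field)"
  using mult_single[of 0 "of_int k :: 'k" u 1] by simp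

lemma primitive_vector_nonzero_in_field:
  assumes "primitive_vector n v"
  shows "\<exists>i<n. (of_int (v i) :: 'k::field) \<noteq> 0"
proof (rule ccontr)
  assume zero: "\<not> ?thesis"
  have v_primitive: "v \<in> coord_space n"
    and primitive: "\<And>k w. w \<in> coord_space n \<Longrightarrow> v = (\<lambda>i. k * w i) \<Longrightarrow> \<bar>k\<bar> = 1"
    using assms by (auto simp: primitive_vector_def)
  let ?p = "int (CHAR('k))"
  have "?p dvd v i" for i
    using zero v_primitive
    by (cases "i < n") (auto simp: of_int_eq_0_iff_char_dvd coord_space_def not_less)
  then have "v = (\<lambda>i. ?p * (v i div ?p))" by simp
  moreover have "(\<lambda>i. v i div ?p) \<in> coord_space n" using v_primitive by (simp add: coord_space_def)
  ultimately have "\<bar>?p\<bar> = 1" using primitive by blast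
  then show False using CHAR_not_1[where 'a = 'k] by simp
qed

context spanning_arrangement
begin

definition relation_form :: "('e \<Rightarrow>\<^sub>0 int) \<Rightarrow> (('e \<times> sign \<Rightarrow>\<^sub>0 int) \<Rightarrow>\<^sub>0 'k::field)" where
  "relation_form c = (\<Sum>e\<in>E. of_int (lookup c e) * Phi_pullback e)"

lemma relation_form_single:
  "relation_form c = (\<Sum>e\<in>E. single (phi_exp e) (of_int (lookup c e) :: 'k::field))"
  unfolding relation_form_def Phi_pullback_def of_int_mult_monomial ..

lemma keys_relation_form_subset:
  assumes "\<And>e. e \<in> E \<Longrightarrow> phi_exp e \<in> S"
  shows "keys (relation_form c :: _ \<Rightarrow>\<^sub>0 'k::field) \<subseteq> S"
  unfolding relation_form_single using assms by (intro keys_sum_subset) auto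

lemma lookup_relation_form:
  assumes "e \<in> E"
  shows "lookup (relation_form c) (phi_exp e) = (of_int (lookup c e) :: 'k::field)"
proof -
  have "lookup (relation_form c) (phi_exp e) =
      (\<Sum>f\<in>E. if f = e then of_int (lookup c f) else (0 :: 'k))"
    unfolding relation_form_single lookup_sum
    by (rule sum.cong) (auto simp: lookup_single when_def dest: injD[OF inj_phi_exp])
  then show ?thesis using assms by simp
qed

lemma hypertoric_ideal_relation_form:
  "hypertoric_ideal A \<sigma> = genideal (monoid_algebra (dual_monoid A \<sigma>)) (relation_form ` relations A)"
  unfolding hypertoric_ideal_def relation_form_def by (simp add: image_def Setcompr_eq_image)

lemma relation_form_in_hypertoric_ideal: "c \<in> relations A \<Longrightarrow> relation_form c \<in> hypertoric_ideal A \<sigma>"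
  unfolding hypertoric_ideal_relation_form genideal_def by blast

lemma hypertoric_ideal_subset_iff:
  assumes "monoid_algebra_ideal (dual_monoid A \<sigma>) q"
  shows "hypertoric_ideal A \<sigma> \<subseteq> q \<longleftrightarrow> (\<forall>c\<in>relations A. relation_form c \<in> q)"
  using monoid_algebra_ideal.ideal[OF assms] unfolding hypertoric_ideal_relation_form genideal_def
  by blast

lemma relation_divide:
  assumes relation: "c \<in> relations A" and "p \<noteq> 0" and dvd: "\<And>e. e \<in> E \<Longrightarrow> p dvd lookup c e"
  obtains c' where "c' \<in> relations A" "c = frag_cmul p c'"
proof
  define c' where "c' = poly_mapping_on E (\<lambda>e. lookup c e div p)"
  have keys_c': "keys c' \<subseteq> E"
    unfolding c'_def by (rule keys_poly_mapping_on[OF finite_E])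
  show "c = frag_cmul p c'"
  proof (rule poly_mapping_eq_onI)
    show "keys c \<subseteq> E" using relation by (simp add: relations_def)
    show "keys (frag_cmul p c') \<subseteq> E" using keys_cmul keys_c' by (rule order_trans)
  qed (simp add: c'_def lookup_poly_mapping_on dvd)
  then have "p * (\<Sum>e\<in>E. lookup c' e * normal A e i) = 0" for i
    using relation by (simp add: relations_def sum_distrib_left mult.assoc)
  then show "c' \<in> relations A"
    using \<open>p \<noteq> 0\<close> keys_c' by (simp add: relations_def)
qed

text \<open>Over a field of positive characteristic, a relation is first divided by its content.\<close>

lemma exists_nonzero_relation_form:
  assumes relation: "c \<in> relations A" "c \<noteq> 0"
  shows "\<exists>c'\<in>relations A. (relation_form c' :: _ \<Rightarrow>\<^sub>0 'k::field) \<noteq> 0"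
proof -
  define g where "g = Gcd (lookup c ` E)"
  let ?p = "int (CHAR('k))"
  obtain e where coefficient: "lookup c e \<noteq> 0" using relation(2)
    by (metis lookup_zero poly_mapping_eqI)
  then have "e \<in> E" using relation(1) by (auto simp: relations_def in_keys_iff)
  then have "g \<noteq> 0" using coefficient by (auto simp: g_def)
  then obtain c' where divided: "c' \<in> relations A" "c = frag_cmul g c'"
    using relation_divide[OF relation(1), of g] by (auto simp: g_def)
  have "\<exists>e\<in>E. \<not> ?p dvd lookup c' e"
  proof (rule ccontr)
    assume "\<not> ?thesis"
    then have "g * ?p dvd Gcd (lookup c ` E)"
      by (intro Gcd_greatest) (auto simp: divided(2))
    then have "?p dvd 1"
      using \<open>g \<noteq> 0\<close> dvd_mult_cancel_left[of g ?p 1] by (simp add: g_def)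
    then show False using CHAR_not_1[where 'a = 'k] by simp
  qed
  then obtain f where "f \<in> E" "(of_int (lookup c' f) :: 'k) \<noteq> 0"
    by (auto simp: of_int_eq_0_iff_char_dvd)
  then have "(relation_form c' :: _ \<Rightarrow>\<^sub>0 'k) \<noteq> 0"
    using lookup_relation_form[of f c', where 'k = 'k] by auto
  then show ?thesis using divided(1) by blast
qed

lemma hypertoric_point_of_vertex:
  assumes vertex: "\<xi> \<in> vertices A"
  shows "topspace (topo (hypertoric A :: (_, _, 'k::field) k_space)) \<inter> orbit A (vertex_cone A \<xi>) =
    {(vertex_cone A \<xi>, augmentation_ideal (dual_monoid A (vertex_cone A \<xi>)))}"
proof -
  let ?C = "vertex_cone A \<xi>"
  let ?S = "dual_monoid A ?C"
  let ?I = "augmentation_ideal ?S :: (_ \<Rightarrow>\<^sub>0 'k) set"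
  interpret I: monoid_algebra_prime ?S ?I
    by (rule monoid_algebra_prime_augmentation_ideal[OF add_submonoid_dual_monoid])
      (rule dual_monoid_vertex_cone_pointed[OF vertex])
  have "phi_exp e \<in> ?S - {0}" if "e \<in> E" for e
    using that phi_exp_dual_monoid keys_phi_exp[of e] by fastforce
  then have "relation_form c \<in> ?I" for c
    unfolding augmentation_ideal_def mem_Collect_eq by (rule keys_relation_form_subset)
  then have "hypertoric_ideal A ?C \<subseteq> ?I"
    unfolding hypertoric_ideal_subset_iff[OF I.monoid_algebra_ideal_axioms] by blast
  then have point: "(?C, ?I) \<in> pts (hypertoric_atlas A)"
    using I.primeideal vertex_cone_in_fan[OF vertex]
    by (auto simp: pts_hypertoric_atlas perp_lattice_vertex_cone[OF vertex] augmentation_ideal_def)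
  have unique: "q = ?I" if over_cone: "(?C, q) \<in> pts (hypertoric_atlas A)" for q
  proof (rule monoid_algebra_prime.eq_augmentation_idealI)
    show "monoid_algebra_prime ?S q"
      using over_cone by (intro monoid_algebra_prime.intro add_submonoid_dual_monoid)
        (simp add: pts_hypertoric_atlas)
  qed (use over_cone in \<open>auto simp: pts_hypertoric_atlas perp_lattice_vertex_cone[OF vertex]\<close>)
  have "x = (?C, ?I)" if "x \<in> pts (hypertoric_atlas A)" "fst x = ?C" for x
    using unique[of "snd x"] that by (metis prod.collapse)
  then have "{x \<in> pts (hypertoric_atlas A). fst x = ?C} \<subseteq> {(?C, ?I)}" by blast
  moreover have "{(?C, ?I)} \<subseteq> {x \<in> pts (hypertoric_atlas A). fst x = ?C}"
    using point by simp
  ultimately show ?thesis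
    unfolding topspace_hypertoric_Int_orbit by (rule subset_antisym)
qed

text \<open>The evaluation of \<open>x\<^sub>e\<close> at the generic point \<open>(1, t, t\<^sup>2, \<dots>)\<close> of the moment curve.\<close>

definition generic_form :: "'e \<Rightarrow> 'k::field poly" where
  "generic_form e = (\<Sum>i<d. monom (of_int (normal A e i)) i)"

lemma generic_form_nonzero:
  assumes "e \<in> E"
  shows "generic_form e \<noteq> (0 :: 'k::field poly)"
proof -
  obtain i where coordinate: "i < d" "(of_int (normal A e i) :: 'k) \<noteq> 0"
    using primitive_vector_nonzero_in_field[of d "normal A e", where 'k = 'k] primitive_spanning
      assms
    unfolding primitive_spanning_def by blast
  then have "coeff (generic_form e :: 'k poly) i \<noteq> 0"
    by (simp add: generic_form_def coeff_sum)
  then show ?thesis by auto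
qed

lemma sum_relation_generic_form:
  assumes "c \<in> relations A"
  shows "(\<Sum>e\<in>E. [:of_int (lookup c e):] * generic_form e) = (0 :: 'k::field poly)"
proof -
  have "(\<Sum>e\<in>E. [:of_int (lookup c e):] * generic_form e) =
      (\<Sum>e\<in>E. \<Sum>i<d. monom (of_int (lookup c e * normal A e i) :: 'k) i)"
    by (simp add: generic_form_def sum_distrib_left smult_monom)
  also have "\<dots> = (\<Sum>i<d. monom (of_int (\<Sum>e\<in>E. lookup c e * normal A e i)) i)"
    by (subst sum.swap) (simp only: monom_sum of_int_sum)
  also have "\<dots> = 0" using assms by (simp add: relations_def)
  finally show ?thesis .
qed

definition generic_character :: "('e \<times> sign \<Rightarrow>\<^sub>0 int) \<Rightarrow> 'k::field poly fract" where
  "generic_character u = (\<Prod>e\<in>E. to_fract (generic_form e) powi lookup u (e, Pos))"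

lemma generic_character_0: "generic_character 0 = 1"
  by (simp add: generic_character_def)

lemma generic_character_add:
  "generic_character (u + v) = generic_character u * (generic_character v :: 'k::field poly fract)"
  unfolding generic_character_def prod.distrib[symmetric]
  by (rule prod.cong) (simp_all add: lookup_add power_int_add generic_form_nonzero)

lemma generic_character_phi_exp:
  assumes "e \<in> E"
  shows "generic_character (phi_exp e) = to_fract (generic_form e :: 'k::field poly)"
proof -
  have "generic_character (phi_exp e) =
      (\<Prod>f\<in>E. if f = e then to_fract (generic_form f :: 'k poly) else 1)"
    unfolding generic_character_def by (rule prod.cong) (simp_all add: lookup_phi_exp)
  then show ?thesis using assms by simp
qed

lemma algebra_hom_generic_character:
  assumes "add_submonoid S"
  shows "algebra_hom S (\<lambda>c :: 'k::field. to_fract [:c:]) generic_character"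
  using assms
  by unfold_locales
    (simp_all add: generic_character_0 generic_character_add
      flip: one_pCons to_fract_add to_fract_mult)

lemma hypertoric_meets_torus:
  "topspace (topo (hypertoric A :: (_, _, 'k::field) k_space)) \<inter> orbit A (Lam_real A) \<noteq> {}"
proof -
  have submonoid: "add_submonoid (M_tilde A)"
    using add_submonoid_dual_monoid[of A "Lam_real A"] by (simp add: dual_monoid_Lam_real)
  interpret algebra_hom "M_tilde A" "\<lambda>c :: 'k. to_fract [:c:]" generic_character
    by (rule algebra_hom_generic_character[OF submonoid])
  let ?evaluate = "lin_ext (\<lambda>c :: 'k. to_fract [:c:]) generic_character"
  let ?q = "{f. keys f \<subseteq> M_tilde A \<and> ?evaluate f = 0}"
  interpret q: monoid_algebra_prime "M_tilde A" ?q
    by (rule monoid_algebra_prime_kernel) auto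
  have "relation_form c \<in> ?q" if relation: "c \<in> relations A" for c
  proof -
    have "?evaluate (relation_form c) = to_fract (\<Sum>e\<in>E. [:of_int (lookup c e):] * generic_form e)"
      unfolding relation_form_single
      by (simp add: lin_ext_sum lin_ext_single generic_character_phi_exp del: mult_pCons_left
          flip: to_fract_mult to_fract_sum)
    also have "\<dots> = 0" by (simp only: sum_relation_generic_form[OF relation] to_fract_0)
    finally show ?thesis
      using keys_relation_form_subset[of "M_tilde A" c, where 'k = 'k] phi_exp_M_tilde by simp
  qed
  then have "hypertoric_ideal A (Lam_real A) \<subseteq> ?q"
    using q.monoid_algebra_ideal_axioms
    by (simp add: hypertoric_ideal_subset_iff dual_monoid_Lam_real)
  then have "(Lam_real A, ?q) \<in> pts (hypertoric_atlas A)"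
    using q.primeideal Lam_real_in_fan
    by (simp add: pts_hypertoric_atlas dual_monoid_Lam_real perp_lattice_Lam_real)
  then show ?thesis unfolding topspace_hypertoric_Int_orbit by force
qed

section \<open>Improper intersection with an orbit\<close>

lemma krull_dim_hypertoric_torus_less:
  assumes "c \<in> relations A" "c \<noteq> 0" and basis: "normal_basis A B"
  shows "krull_dim (subtopology (topo (hypertoric A :: (_, _, 'k::field) k_space))
      (orbit A (Lam_real A))) \<le> enat (card (coords B) - 1)"
proof -
  let ?X = "hypertoric_atlas A :: (_, _, 'k) atlas"
  let ?P = "topspace (topo (hypertoric A :: (_, _, 'k) k_space)) \<inter> orbit A (Lam_real A)"
  have points: "?P = {x \<in> pts ?X. fst x = Lam_real A}" by (rule topspace_hypertoric_Int_orbit)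
  obtain c' where nonzero_form: "c' \<in> relations A" "(relation_form c' :: _ \<Rightarrow>\<^sub>0 'k) \<noteq> 0"
    using exists_nonzero_relation_form[OF assms(1,2)] by blast
  have "krull_dim (subtopology (zariski ?X) ?P) \<le> enat (card (coords B) - 1)"
  proof (rule krull_dim_zero_locus_less)
    show "zariski_spectrum (M_tilde A) (subtopology (zariski ?X) ?P) snd"
      using prime_atlas.zariski_spectrum_minimal_chart[OF prime_atlas_hypertoric,
          of "Lam_real A" A ?P]
        Lam_real_in_fan points
      by (simp add: dual_monoid_Lam_real dual_monoid_subset_M_tilde)
    show "add_submonoid (M_tilde A)"
      using add_submonoid_dual_monoid[of A "Lam_real A"] by (simp add: dual_monoid_Lam_real)
    show "M_tilde A \<subseteq> {u. keys u \<subseteq> E \<times> UNIV}" by (auto simp: M_tilde_def)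
    show "inj_on (\<lambda>u. restrict (lookup u) (coords B)) (M_tilde A)"
      by (rule inj_on_coords_M_tilde[OF basis])
    show "keys (relation_form c' :: _ \<Rightarrow>\<^sub>0 'k) \<subseteq> M_tilde A"
      by (rule keys_relation_form_subset[OF phi_exp_M_tilde])
    fix x assume "x \<in> topspace (subtopology (zariski ?X) ?P)"
    then have "x \<in> pts ?X" "fst x = Lam_real A" using points by auto
    then have "(Lam_real A, snd x) \<in> pts ?X" by (metis prod.collapse)
    then show "relation_form c' \<in> snd x"
      using relation_form_in_hypertoric_ideal[OF nonzero_form(1)]
      by (auto simp: pts_hypertoric_atlas)
  qed (use nonzero_form finite_coords[OF basis] in simp_all)
  then show ?thesis by (simp add: topo_scheme_of subtopology_restrict)
qed

lemma improper_intersection: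
  assumes relation: "c \<in> relations A" "c \<noteq> 0"
  shows "\<exists>\<sigma> \<in> lawrence_fan A.
           topspace (topo (hypertoric A :: (_, _, 'k::field) k_space)) \<inter> orbit A \<sigma> \<noteq> {} \<and>
           ereal_of_enat (krull_dim
             (subtopology (topo (hypertoric A :: (_, _, 'k) k_space)) (orbit A \<sigma>)))
           \<noteq> ereal_of_enat (krull_dim (topo (hypertoric A :: (_, _, 'k) k_space)))
               - ereal (real (cone_dim A \<sigma>))"
proof (rule ccontr)
  let ?X = "topo (hypertoric A :: (_, _, 'k) k_space)"
  assume "\<not> ?thesis"
  then have proper: "ereal_of_enat (krull_dim (subtopology ?X (orbit A \<sigma>))) =
      ereal_of_enat (krull_dim ?X) - ereal (real (cone_dim A \<sigma>))"
    if "\<sigma> \<in> lawrence_fan A" "topspace ?X \<inter> orbit A \<sigma> \<noteq> {}" for \<sigma>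
    using that by blast
  obtain \<xi> where vertex: "\<xi> \<in> vertices A" using vertex_exists[OF finite_E separating_E] .
  obtain B where basis: "normal_basis A B" using normal_basis_exists[OF finite_E separating_E] .
  let ?n = "cone_dim A (vertex_cone A \<xi>)"
  note point = hypertoric_point_of_vertex[OF vertex, where 'k = 'k]
  have "krull_dim (subtopology ?X (orbit A (vertex_cone A \<xi>))) = 0"
    by (rule krull_dim_singleton) (use point in simp)
  then have "ereal_of_enat (krull_dim ?X) - ereal (real ?n) = 0"
    using proper[OF vertex_cone_in_fan[OF vertex]] point by simp
  then have dim: "krull_dim ?X = enat ?n" by (cases "krull_dim ?X") auto
  have "ereal_of_enat (krull_dim (subtopology ?X (orbit A (Lam_real A)))) = ereal (real ?n)"
    using proper[OF Lam_real_in_fan hypertoric_meets_torus] dim by (simp add: cone_dim_def)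
  then have "krull_dim (subtopology ?X (orbit A (Lam_real A))) = enat ?n"
    by (cases "krull_dim (subtopology ?X (orbit A (Lam_real A)))") auto
  then have "?n \<le> card (coords B) - 1"
    using krull_dim_hypertoric_torus_less[OF relation basis, where 'k = 'k] by simp
  moreover have "card (coords B) \<le> ?n" by (rule card_coords_le_cone_dim[OF basis vertex])
  moreover have "card (coords B) > 0"
  proof -
    obtain e where "e \<in> keys c" using relation(2) by (metis all_not_in_conv keys_eq_empty)
    then have "(e, Neg) \<in> coords B" using relation(1) by (auto simp: relations_def coords_def)
    then show ?thesis using finite_coords[OF basis] by (metis card_gt_0_iff empty_iff)
  qed
  ultimately show False by linarith
qed

end

section \<open>Germs of fractions in a domain\<close>

locale domain_prime = monoid_algebra_prime S q
  for S :: "'m::comm_monoid_add set" and q :: "('m \<Rightarrow>\<^sub>0 'k::field) set" +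
  assumes no_zero_divisors: "\<And>f g :: 'm \<Rightarrow>\<^sub>0 'k. keys f \<subseteq> S \<Longrightarrow> keys g \<subseteq> S \<Longrightarrow> f * g = 0 \<Longrightarrow> f = 0 \<or> g = 0"
begin

definition fraction :: "('m \<Rightarrow>\<^sub>0 'k) \<Rightarrow> ('m \<Rightarrow>\<^sub>0 'k) \<Rightarrow> bool" where
  "fraction f g \<longleftrightarrow> keys f \<subseteq> S \<and> keys g \<subseteq> S \<and> g \<notin> q"

lemma fraction_mult: "fraction f g \<Longrightarrow> fraction f' g' \<Longrightarrow> fraction (f * f') (g * g')"
  by (simp add: fraction_def keys_mult_subset[OF submonoid] mult_mem_iff)

lemma fraction_add: "fraction f g \<Longrightarrow> fraction f' g' \<Longrightarrow> fraction (f * g' + f' * g) (g * g')"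
  by (simp add: fraction_def keys_mult_subset[OF submonoid] keys_add_subset mult_mem_iff)

lemma cancel:
  assumes "keys h \<subseteq> S" "h \<notin> q" "keys a \<subseteq> S" "keys b \<subseteq> S" "h * a = h * b"
  shows "a = b"
proof -
  have "h * (a - b) = 0" using assms(5) by (simp add: right_diff_distrib)
  then have "h = 0 \<or> a - b = 0"
    by (rule no_zero_divisors[OF assms(1) keys_diff_subset[OF assms(3,4)]])
  then show ?thesis using nonzero_if_notin[OF assms(2)] by simp
qed

lemma mem_germ_iff:
  assumes keys_f: "keys f \<subseteq> S" and keys_g: "keys g \<subseteq> S"
  shows "(f', g') \<in> germ S {0} q f g \<longleftrightarrow> fraction f' g' \<and> f * g' = f' * g"
proof
  assume "(f', g') \<in> germ S {0} q f g"
  then obtain h where annihilator: "keys h \<subseteq> S" "h \<notin> q" "h * (f * g' - f' * g) = 0"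
    and fraction': "fraction f' g'"
    by (auto simp: germ_def carrier_monoid_algebra fraction_def)
  have keys: "keys (f * g') \<subseteq> S" "keys (f' * g) \<subseteq> S"
    using keys_f keys_g fraction' by (simp_all add: fraction_def keys_mult_subset[OF submonoid])
  have "h * (f * g') = h * (f' * g)" using annihilator(3) by (simp add: right_diff_distrib)
  then have "f * g' = f' * g" by (rule cancel[OF annihilator(1,2) keys])
  then show "fraction f' g' \<and> f * g' = f' * g" using fraction' by blast
next
  assume "fraction f' g' \<and> f * g' = f' * g"
  then show "(f', g') \<in> germ S {0} q f g"
    using one_notin submonoid
    by (auto simp: germ_def carrier_monoid_algebra fraction_def add_submonoid_def
      intro!: bexI[of _ 1])
qed

lemma germ_subset:
  assumes fraction: "fraction f g" and fraction': "fraction f' g'" and eq: "f * g' = f' * g"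
  shows "germ S {0} q f g \<subseteq> germ S {0} q f' g'"
proof clarify
  fix a b assume "(a, b) \<in> germ S {0} q f g"
  then have same_germ: "fraction a b" "f * b = a * g"
    using mem_germ_iff fraction by (auto simp: fraction_def)
  have "g * (f' * b) = (f' * g) * b" by (simp only: mult_ac)
  also have "\<dots> = g' * (f * b)" unfolding eq[symmetric] by (simp only: mult_ac)
  also have "\<dots> = g * (a * g')" unfolding same_germ(2) by (simp only: mult_ac)
  finally have "g * (f' * b) = g * (a * g')" .
  moreover have "keys (f' * b) \<subseteq> S" "keys (a * g') \<subseteq> S"
    using fraction' same_germ(1) by (simp_all add: fraction_def keys_mult_subset[OF submonoid])
  ultimately have "f' * b = a * g'"
    using fraction cancel[of g "f' * b" "a * g'"] by (simp add: fraction_def)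
  then show "(a, b) \<in> germ S {0} q f' g'"
    using same_germ(1) fraction' by (simp add: mem_germ_iff fraction_def)
qed

lemma germ_eq_iff:
  assumes "fraction f g" "fraction f' g'"
  shows "germ S {0} q f g = germ S {0} q f' g' \<longleftrightarrow> f * g' = f' * g"
proof
  assume "germ S {0} q f g = germ S {0} q f' g'"
  moreover have "(f', g') \<in> germ S {0} q f' g'"
    using assms by (simp add: mem_germ_iff fraction_def)
  ultimately have "(f', g') \<in> germ S {0} q f g" by simp
  then show "f * g' = f' * g" using assms by (simp add: mem_germ_iff fraction_def)
next
  assume eq: "f * g' = f' * g"
  show "germ S {0} q f g = germ S {0} q f' g'"
    using germ_subset[OF assms eq] germ_subset[OF assms(2,1) eq[symmetric]] by (rule subset_antisym)
qed

text \<open>The operations on germs are defined as unions over all pairs of representatives.\<close>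

lemma UN_germ_constant:
  assumes "fraction f g" "fraction f' g'"
    and const: "\<And>a b a' b'. fraction a b \<Longrightarrow> f * b = a * g \<Longrightarrow> fraction a' b' \<Longrightarrow> f' * b' = a' * g' \<Longrightarrow>
      F a b a' b' = K"
  shows "(\<Union>(a, b)\<in>germ S {0} q f g. \<Union>(a', b')\<in>germ S {0} q f' g'. F a b a' b') = K"
proof -
  have self: "(f, g) \<in> germ S {0} q f g" "(f', g') \<in> germ S {0} q f' g'"
    using assms(1,2) by (simp_all add: mem_germ_iff fraction_def)
  have eq: "F a b a' b' = K"
    if "(a, b) \<in> germ S {0} q f g" "(a', b') \<in> germ S {0} q f' g'" for a b a' b'
    using that assms(1,2) by (intro const) (simp_all add: mem_germ_iff fraction_def)
  then have "(\<Union>(a, b)\<in>germ S {0} q f g. \<Union>(a', b')\<in>germ S {0} q f' g'. F a b a' b') \<subseteq> K"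
    by (intro UN_least) auto
  moreover have "F f g f' g' \<subseteq>
      (\<Union>(a, b)\<in>germ S {0} q f g. \<Union>(a', b')\<in>germ S {0} q f' g'. F a b a' b')"
    using self by blast
  ultimately show ?thesis
    using eq[OF self] by simp
qed

lemma UN_germ_mult:
  assumes fraction: "fraction f g" and fraction': "fraction f' g'"
  shows "(\<Union>(a, b)\<in>germ S {0} q f g. \<Union>(a', b')\<in>germ S {0} q f' g'. germ S {0} q (a * a') (b * b')) =
    germ S {0} q (f * f') (g * g')"
proof (rule UN_germ_constant[OF fraction fraction'])
  fix a b a' b'
  assume equal: "fraction a b" "f * b = a * g" and equal': "fraction a' b'" "f' * b' = a' * g'"
  have "a * a' * (g * g') = (a * g) * (a' * g')" by (simp only: mult_ac)
  also have "\<dots> = f * f' * (b * b')" unfolding equal(2)[symmetric] equal'(2)[symmetric]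
    by (simp only: mult_ac)
  finally show "germ S {0} q (a * a') (b * b') = germ S {0} q (f * f') (g * g')"
    by (simp add: germ_eq_iff fraction_mult fraction fraction' equal(1) equal'(1))
qed

lemma UN_germ_add:
  assumes fraction: "fraction f g" and fraction': "fraction f' g'"
  shows "(\<Union>(a, b)\<in>germ S {0} q f g. \<Union>(a', b')\<in>germ S {0} q f' g'.
      germ S {0} q (a * b' + a' * b) (b * b')) = germ S {0} q (f * g' + f' * g) (g * g')"
proof (rule UN_germ_constant[OF fraction fraction'])
  fix a b a' b'
  assume equal: "fraction a b" "f * b = a * g" and equal': "fraction a' b'" "f' * b' = a' * g'"
  have "(a * b' + a' * b) * (g * g') = (a * g) * (b' * g') + (a' * g') * (b * g)"
    by (simp add: algebra_simps)
  also have "\<dots> = (f * g' + f' * g) * (b * b')"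
    unfolding equal(2)[symmetric] equal'(2)[symmetric] by (simp add: algebra_simps)
  finally show "germ S {0} q (a * b' + a' * b) (b * b') = germ S {0} q (f * g' + f' * g) (g * g')"
    by (simp add: germ_eq_iff fraction_add fraction fraction' equal(1) equal'(1))
qed

end

section \<open>Sections of the structure sheaf\<close>

lemma structure_sheaf_simps:
  "mult (structure_sheaf X W) s t = (\<lambda>x\<in>W. germ_mult X x (s x) (t x))"
  "add (structure_sheaf X W) s t = (\<lambda>x\<in>W. germ_add X x (s x) (t x))"
  "one (structure_sheaf X W) = (\<lambda>x\<in>W. germ_at X x 1 1)"
  by (simp_all add: structure_sheaf_def)

lemma section_extensional: "s \<in> carrier (structure_sheaf X W) \<Longrightarrow> s \<in> extensional W"
  by (simp add: structure_sheaf_def)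

lemma sectionI:
  assumes "s \<in> extensional W"
    and "\<And>x. x \<in> W \<Longrightarrow> \<exists>i\<in>charts X. \<exists>f g V. keys f \<subseteq> mon X i \<and> keys g \<subseteq> mon X i \<and>
      openin (zariski X) V \<and> x \<in> V \<and> V \<subseteq> W \<inter> chart_open X i \<and>
      (\<forall>y\<in>V. g \<notin> snd y \<and> s y = germ_at X y f g)"
  shows "s \<in> carrier (structure_sheaf X W)"
  using assms unfolding structure_sheaf_def by (simp add: Bex_def carrier_monoid_algebra)

lemma section_locally_fraction:
  assumes "s \<in> carrier (structure_sheaf X W)" "x \<in> W"
  obtains i f g V where "i \<in> charts X" "keys f \<subseteq> mon X i" "keys g \<subseteq> mon X i"
    "openin (zariski X) V" "x \<in> V" "V \<subseteq> W" "V \<subseteq> chart_open X i"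
    "\<forall>y\<in>V. g \<notin> snd y \<and> s y = germ_at X y f g"
  using assms unfolding structure_sheaf_def by (simp add: Bex_def carrier_monoid_algebra) meson

locale integral_atlas = prime_atlas X
  for X :: "('i, 'm::comm_monoid_add, 'k::field) atlas" +
  assumes van_zero: "\<And>i. i \<in> charts X \<Longrightarrow> van X i = {0}"
    and no_zero_divisors: "\<And>i f g. i \<in> charts X \<Longrightarrow> keys f \<subseteq> mon X i \<Longrightarrow> keys g \<subseteq> mon X i \<Longrightarrow>
      f * g = (0 :: 'm \<Rightarrow>\<^sub>0 'k) \<Longrightarrow> f = 0 \<or> g = 0"
    and mon_antimono: "\<And>i j. i \<in> charts X \<Longrightarrow> j \<in> charts X \<Longrightarrow> sub X i j \<Longrightarrow> mon X j \<subseteq> mon X i"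
begin

lemma domain_prime_point: "x \<in> pts X \<Longrightarrow> domain_prime (mon X (fst x)) (snd x)"
  using point_prime no_zero_divisors[OF point_chart]
  by (intro domain_prime.intro domain_prime_axioms.intro) blast+

definition fraction_at :: "'i \<times> ('m \<Rightarrow>\<^sub>0 'k) set \<Rightarrow> ('m \<Rightarrow>\<^sub>0 'k) \<Rightarrow> ('m \<Rightarrow>\<^sub>0 'k) \<Rightarrow> bool" where
  "fraction_at x f g \<longleftrightarrow> keys f \<subseteq> mon X (fst x) \<and> keys g \<subseteq> mon X (fst x) \<and> g \<notin> snd x"

lemma fraction_at_eq: "x \<in> pts X \<Longrightarrow> fraction_at x = domain_prime.fraction (mon X (fst x)) (snd x)"
  by (simp add: fun_eq_iff fraction_at_def domain_prime.fraction_def domain_prime_point)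

lemma fraction_at_const: "x \<in> pts X \<Longrightarrow> fraction_at x (single 0 c) 1"
  using monoid_algebra_prime.one_notin[OF point_prime]
    keys_const_subset[OF submonoid[OF point_chart]]
    keys_const_subset[OF submonoid[OF point_chart], of x 1]
  by (simp add: fraction_at_def)

lemma fraction_at_mult:
  "x \<in> pts X \<Longrightarrow> fraction_at x f g \<Longrightarrow> fraction_at x f' g' \<Longrightarrow> fraction_at x (f * f') (g * g')"
  by (simp add: fraction_at_eq domain_prime.fraction_mult[OF domain_prime_point])

lemma fraction_at_add:
  "x \<in> pts X \<Longrightarrow> fraction_at x f g \<Longrightarrow> fraction_at x f' g' \<Longrightarrow>
    fraction_at x (f * g' + f' * g) (g * g')"
  by (simp add: fraction_at_eq domain_prime.fraction_add[OF domain_prime_point])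

lemma germ_at_eq_iff:
  assumes "x \<in> pts X" "fraction_at x f g" "fraction_at x f' g'"
  shows "germ_at X x f g = germ_at X x f' g' \<longleftrightarrow> f * g' = f' * g"
  using domain_prime.germ_eq_iff[OF domain_prime_point[OF assms(1)]] assms
  by (simp add: fraction_at_eq van_zero point_chart)

lemma germ_mult_germ_at:
  assumes "x \<in> pts X" "fraction_at x f g" "fraction_at x f' g'"
  shows "germ_mult X x (germ_at X x f g) (germ_at X x f' g') = germ_at X x (f * f') (g * g')"
  using domain_prime.UN_germ_mult[OF domain_prime_point[OF assms(1)]] assms
  by (simp add: germ_mult_def fraction_at_eq van_zero point_chart)

lemma germ_add_germ_at:
  assumes "x \<in> pts X" "fraction_at x f g" "fraction_at x f' g'"
  shows "germ_add X x (germ_at X x f g) (germ_at X x f' g') =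
    germ_at X x (f * g' + f' * g) (g * g')"
  using domain_prime.UN_germ_add[OF domain_prime_point[OF assms(1)]] assms
  by (simp add: germ_add_def fraction_at_eq van_zero point_chart)

lemma fraction_at_chart_open:
  assumes "x \<in> chart_open X i" "i \<in> charts X" "keys f \<subseteq> mon X i" "keys g \<subseteq> mon X i" "g \<notin> snd x"
  shows "fraction_at x f g"
proof -
  have "mon X i \<subseteq> mon X (fst x)"
    using assms(1) by (intro mon_antimono[OF point_chart assms(2)]) (auto simp: chart_open_def)
  then show ?thesis using assms(3-5) by (auto simp: fraction_at_def)
qed

end

section \<open>Comparison of atlases\<close>

text \<open>A homeomorphism of integral atlases is an isomorphism of schemes if it matches the primes
  under a map \<open>\<iota>\<close> of polynomials such that locally all fractions of \<open>X\<close> are fractions of images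
  under \<open>\<iota>\<close>.\<close>

locale atlas_comparison = X: integral_atlas X + Z: integral_atlas Z
  for X :: "('i, 'm::comm_monoid_add, 'k::field) atlas"
    and Z :: "('j, 'n::comm_monoid_add, 'k) atlas" +
  fixes \<phi> :: "'i \<times> ('m \<Rightarrow>\<^sub>0 'k) set \<Rightarrow> 'j \<times> ('n \<Rightarrow>\<^sub>0 'k) set" and \<iota> :: "('n \<Rightarrow>\<^sub>0 'k) \<Rightarrow> ('m \<Rightarrow>\<^sub>0 'k)"
  assumes homeomorphic: "homeomorphic_map (zariski X) (zariski Z) \<phi>"
    and hom_add: "\<And>f g. \<iota> (f + g) = \<iota> f + \<iota> g" and hom_mult: "\<And>f g. \<iota> (f * g) = \<iota> f * \<iota> g"
    and hom_const: "\<And>c. \<iota> (single 0 c) = single 0 c"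
    and hom_inj: "\<And>j. j \<in> charts Z \<Longrightarrow> inj_on \<iota> {f. keys f \<subseteq> mon Z j}"
    and keys_hom: "\<And>x f. x \<in> pts X \<Longrightarrow> keys f \<subseteq> mon Z (fst (\<phi> x)) \<Longrightarrow> keys (\<iota> f) \<subseteq> mon X (fst x)"
    and hom_mem_iff: "\<And>x f. x \<in> pts X \<Longrightarrow> keys f \<subseteq> mon Z (fst (\<phi> x)) \<Longrightarrow> \<iota> f \<in> snd x \<longleftrightarrow> f \<in> snd (\<phi> x)"
    and hom_fractions: "\<And>i f g. i \<in> charts X \<Longrightarrow> keys f \<subseteq> mon X i \<Longrightarrow> keys g \<subseteq> mon X i \<Longrightarrow>
      \<exists>j\<in>charts Z. \<exists>f' g'. keys f' \<subseteq> mon Z j \<and> keys g' \<subseteq> mon Z j \<and> f * \<iota> g' = \<iota> f' * g \<and>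
        (\<forall>x\<in>chart_open X i. \<phi> x \<in> chart_open Z j \<and> (g \<notin> snd x \<longrightarrow> g' \<notin> snd (\<phi> x)))"
begin

lemma point_image: "x \<in> pts X \<Longrightarrow> \<phi> x \<in> pts Z"
  using homeomorphic_imp_surjective_map[OF homeomorphic] X.topspace_zariski Z.topspace_zariski
  by blast

lemma point_preimage:
  assumes "y \<in> pts Z"
  obtains x where "x \<in> pts X" "\<phi> x = y"
proof -
  have "\<phi> ` pts X = pts Z"
    using homeomorphic_imp_surjective_map[OF homeomorphic]
    by (simp add: X.topspace_zariski Z.topspace_zariski)
  then have "y \<in> \<phi> ` pts X" using assms by simp
  then show thesis using that by blast
qed

lemma inj_on_points: "inj_on \<phi> (pts X)"
  using homeomorphic_imp_injective_map[OF homeomorphic] by (simp add: X.topspace_zariski)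

definition preimage :: "('j \<times> ('n \<Rightarrow>\<^sub>0 'k) set) set \<Rightarrow> ('i \<times> ('m \<Rightarrow>\<^sub>0 'k) set) set" where
  "preimage V = {x \<in> pts X. \<phi> x \<in> V}"

lemma preimageD: "x \<in> preimage V \<Longrightarrow> x \<in> pts X" "x \<in> preimage V \<Longrightarrow> \<phi> x \<in> V"
  by (simp_all add: preimage_def)

lemma openin_preimage: "openin (zariski Z) V \<Longrightarrow> openin (zariski X) (preimage V)"
  using openin_continuous_map_preimage[OF homeomorphic_imp_continuous_map[OF homeomorphic], of V]
  by (simp add: preimage_def X.topspace_zariski)

lemma fraction_at_hom: "x \<in> pts X \<Longrightarrow> Z.fraction_at (\<phi> x) f g \<Longrightarrow> X.fraction_at x (\<iota> f) (\<iota> g)"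
  by (simp add: X.fraction_at_def Z.fraction_at_def keys_hom hom_mem_iff)

definition germs_correspond ::
  "'i \<times> ('m \<Rightarrow>\<^sub>0 'k) set \<Rightarrow> (('n \<Rightarrow>\<^sub>0 'k) \<times> ('n \<Rightarrow>\<^sub>0 'k)) set \<Rightarrow> (('m \<Rightarrow>\<^sub>0 'k) \<times> ('m \<Rightarrow>\<^sub>0 'k)) set \<Rightarrow> bool"
  where "germs_correspond x \<sigma> \<tau> \<longleftrightarrow> (\<exists>f g. Z.fraction_at (\<phi> x) f g \<and>
    \<sigma> = germ_at Z (\<phi> x) f g \<and> \<tau> = germ_at X x (\<iota> f) (\<iota> g))"

lemma germs_correspondI:
  "Z.fraction_at (\<phi> x) f g \<Longrightarrow> germs_correspond x (germ_at Z (\<phi> x) f g) (germ_at X x (\<iota> f) (\<iota> g))"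
  unfolding germs_correspond_def by blast

lemma germs_correspondE:
  assumes "germs_correspond x \<sigma> \<tau>"
  obtains f g where "Z.fraction_at (\<phi> x) f g"
    "\<sigma> = germ_at Z (\<phi> x) f g" "\<tau> = germ_at X x (\<iota> f) (\<iota> g)"
  using assms unfolding germs_correspond_def by blast

lemma germs_correspond_eq_iff:
  assumes point: "x \<in> pts X" and "germs_correspond x \<sigma> \<tau>" "germs_correspond x \<sigma>' \<tau>'"
  shows "\<sigma> = \<sigma>' \<longleftrightarrow> \<tau> = \<tau>'"
proof -
  obtain f g where fraction: "Z.fraction_at (\<phi> x) f g"
    and \<sigma>_eq: "\<sigma> = germ_at Z (\<phi> x) f g" and \<tau>_eq: "\<tau> = germ_at X x (\<iota> f) (\<iota> g)"
    using assms(2) by (rule germs_correspondE)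
  obtain f' g' where fraction': "Z.fraction_at (\<phi> x) f' g'"
    and \<sigma>'_eq: "\<sigma>' = germ_at Z (\<phi> x) f' g'" and \<tau>'_eq: "\<tau>' = germ_at X x (\<iota> f') (\<iota> g')"
    using assms(3) by (rule germs_correspondE)
  have chart: "fst (\<phi> x) \<in> charts Z" by (rule Z.point_chart[OF point_image[OF point]])
  have "keys (f * g') \<subseteq> mon Z (fst (\<phi> x))" "keys (f' * g) \<subseteq> mon Z (fst (\<phi> x))"
    using fraction fraction'
    by (simp_all add: Z.fraction_at_def keys_mult_subset[OF Z.submonoid[OF chart]])
  then have "\<iota> (f * g') = \<iota> (f' * g) \<longleftrightarrow> f * g' = f' * g"
    by (intro inj_on_eq_iff[OF hom_inj[OF chart]]) simp_all
  then show ?thesis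
    unfolding \<sigma>_eq \<sigma>'_eq \<tau>_eq \<tau>'_eq Z.germ_at_eq_iff[OF point_image[OF point] fraction fraction']
      X.germ_at_eq_iff[OF point fraction_at_hom[OF point fraction]
        fraction_at_hom[OF point fraction']]
    by (simp add: hom_mult)
qed

lemma germs_correspond_mult:
  assumes point: "x \<in> pts X" and "germs_correspond x \<sigma> \<tau>" "germs_correspond x \<sigma>' \<tau>'"
  shows "germs_correspond x (germ_mult Z (\<phi> x) \<sigma> \<sigma>') (germ_mult X x \<tau> \<tau>')"
  using assms(2,3)
proof (elim germs_correspondE)
  fix f g f' g'
  assume fractions: "Z.fraction_at (\<phi> x) f g" "Z.fraction_at (\<phi> x) f' g'"
    and "\<sigma> = germ_at Z (\<phi> x) f g" "\<tau> = germ_at X x (\<iota> f) (\<iota> g)"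
      "\<sigma>' = germ_at Z (\<phi> x) f' g'" "\<tau>' = germ_at X x (\<iota> f') (\<iota> g')"
  then show ?thesis
    using germs_correspondI[OF Z.fraction_at_mult[OF point_image[OF point] fractions]] point
    by (simp add: Z.germ_mult_germ_at X.germ_mult_germ_at point_image fraction_at_hom hom_mult)
qed

lemma germs_correspond_add:
  assumes point: "x \<in> pts X" and "germs_correspond x \<sigma> \<tau>" "germs_correspond x \<sigma>' \<tau>'"
  shows "germs_correspond x (germ_add Z (\<phi> x) \<sigma> \<sigma>') (germ_add X x \<tau> \<tau>')"
  using assms(2,3)
proof (elim germs_correspondE)
  fix f g f' g'
  assume fractions: "Z.fraction_at (\<phi> x) f g" "Z.fraction_at (\<phi> x) f' g'"
    and "\<sigma> = germ_at Z (\<phi> x) f g" "\<tau> = germ_at X x (\<iota> f) (\<iota> g)"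
      "\<sigma>' = germ_at Z (\<phi> x) f' g'" "\<tau>' = germ_at X x (\<iota> f') (\<iota> g')"
  then show ?thesis
    using germs_correspondI[OF Z.fraction_at_add[OF point_image[OF point] fractions]] point
    by (simp add: Z.germ_add_germ_at X.germ_add_germ_at point_image fraction_at_hom hom_mult
      hom_add)
qed

lemma germs_correspond_const:
  assumes point: "x \<in> pts X"
  shows "germs_correspond x (germ_at Z (\<phi> x) (single 0 c) 1) (germ_at X x (single 0 c) 1)"
  using germs_correspondI[OF Z.fraction_at_const[OF point_image[OF point], of c]] hom_const[of 1]
  by (simp add: hom_const)

definition pullback ::
  "('j \<times> ('n \<Rightarrow>\<^sub>0 'k) set) set \<Rightarrow> ('j \<times> ('n \<Rightarrow>\<^sub>0 'k) set \<Rightarrow> (('n \<Rightarrow>\<^sub>0 'k) \<times> ('n \<Rightarrow>\<^sub>0 'k)) set) \<Rightarrow>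
   'i \<times> ('m \<Rightarrow>\<^sub>0 'k) set \<Rightarrow> (('m \<Rightarrow>\<^sub>0 'k) \<times> ('m \<Rightarrow>\<^sub>0 'k)) set" where
  "pullback V s = (\<lambda>x\<in>preimage V. THE \<tau>. germs_correspond x (s (\<phi> x)) \<tau>)"

lemma pullback_eqI:
  assumes "x \<in> preimage V" "germs_correspond x (s (\<phi> x)) \<tau>"
  shows "pullback V s x = \<tau>"
proof -
  have "(THE \<tau>. germs_correspond x (s (\<phi> x)) \<tau>) = \<tau>"
    using assms(2) germs_correspond_eq_iff[OF preimageD(1)[OF assms(1)]]
    by (intro the_equality) blast+
  then show ?thesis using assms(1) by (simp add: pullback_def)
qed

lemma pullback_extensional: "pullback V s \<in> extensional (preimage V)"
  by (simp add: pullback_def)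

lemma section_locally_correspond:
  assumes carrier: "s \<in> carrier (structure_sheaf Z V)" and in_preimage: "x \<in> preimage V"
  obtains f g W where "keys (\<iota> f) \<subseteq> mon X (fst x)" "keys (\<iota> g) \<subseteq> mon X (fst x)"
    "openin (zariski X) W" "x \<in> W" "W \<subseteq> preimage V \<inter> chart_open X (fst x)"
    "\<forall>z\<in>W. Z.fraction_at (\<phi> z) f g \<and> s (\<phi> z) = germ_at Z (\<phi> z) f g"
proof -
  have point: "x \<in> pts X" by (rule preimageD(1)[OF in_preimage])
  obtain j f g V' where chart: "j \<in> charts Z" "keys f \<subseteq> mon Z j" "keys g \<subseteq> mon Z j"
    and nbhd: "openin (zariski Z) V'" "\<phi> x \<in> V'" "V' \<subseteq> V" "V' \<subseteq> chart_open Z j"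
      "\<forall>y\<in>V'. g \<notin> snd y \<and> s y = germ_at Z y f g"
    by (rule section_locally_fraction[OF carrier preimageD(2)[OF in_preimage]])
  let ?W = "preimage V' \<inter> chart_open X (fst x)"
  have fraction: "Z.fraction_at (\<phi> z) f g" if "\<phi> z \<in> V'" for z
    using that nbhd(4,5) by (intro Z.fraction_at_chart_open[OF _ chart]) blast+
  then have "keys (\<iota> f) \<subseteq> mon X (fst x)" "keys (\<iota> g) \<subseteq> mon X (fst x)"
    using fraction_at_hom[OF point, of f g] nbhd(2) by (simp_all add: X.fraction_at_def)
  moreover have "openin (zariski X) ?W"
    by (intro openin_Int openin_preimage nbhd(1) X.openin_chart_open X.point_chart point)
  moreover have "x \<in> ?W" using point nbhd(2) X.point_in_chart_open by (simp add: preimage_def)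
  ultimately show thesis
    using fraction nbhd(3,5) by (intro that[of f g ?W]) (auto simp: preimage_def)
qed

lemma pullback_correspond:
  assumes "s \<in> carrier (structure_sheaf Z V)" "x \<in> preimage V"
  shows "germs_correspond x (s (\<phi> x)) (pullback V s x)"
proof -
  obtain f g where "Z.fraction_at (\<phi> x) f g" "s (\<phi> x) = germ_at Z (\<phi> x) f g"
    using section_locally_correspond[OF assms] by metis
  then have "germs_correspond x (s (\<phi> x)) (germ_at X x (\<iota> f) (\<iota> g))"
    using germs_correspondI by simp
  then show ?thesis using pullback_eqI[OF assms(2)] by simp
qed

lemma pullback_section:
  assumes carrier: "s \<in> carrier (structure_sheaf Z V)"
  shows "pullback V s \<in> carrier (structure_sheaf X (preimage V))"
proof (rule sectionI[OF pullback_extensional])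
  fix x assume in_preimage: "x \<in> preimage V"
  obtain f g W where keys_fg: "keys (\<iota> f) \<subseteq> mon X (fst x)" "keys (\<iota> g) \<subseteq> mon X (fst x)"
    and nbhd: "openin (zariski X) W" "x \<in> W" "W \<subseteq> preimage V \<inter> chart_open X (fst x)"
    and germs: "\<forall>z\<in>W. Z.fraction_at (\<phi> z) f g \<and> s (\<phi> z) = germ_at Z (\<phi> z) f g"
    by (rule section_locally_correspond[OF carrier in_preimage])
  have "\<iota> g \<notin> snd z \<and> pullback V s z = germ_at X z (\<iota> f) (\<iota> g)" if "z \<in> W" for z
  proof
    have z_in_preimage: "z \<in> preimage V" using nbhd(3) that by blast
    have fraction: "Z.fraction_at (\<phi> z) f g" and s_z: "s (\<phi> z) = germ_at Z (\<phi> z) f g"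
      using germs that by blast+
    show "\<iota> g \<notin> snd z"
      using fraction_at_hom[OF preimageD(1)[OF z_in_preimage] fraction]
      by (simp add: X.fraction_at_def)
    show "pullback V s z = germ_at X z (\<iota> f) (\<iota> g)"
      by (rule pullback_eqI[OF z_in_preimage]) (simp only: s_z germs_correspondI[OF fraction])
  qed
  then show "\<exists>i\<in>charts X. \<exists>f g W. keys f \<subseteq> mon X i \<and> keys g \<subseteq> mon X i \<and>
      openin (zariski X) W \<and> x \<in> W \<and> W \<subseteq> preimage V \<inter> chart_open X i \<and>
      (\<forall>y\<in>W. g \<notin> snd y \<and> pullback V s y = germ_at X y f g)"
    using keys_fg nbhd X.point_chart[OF preimageD(1)[OF in_preimage]] by blast
qed

lemma pullback_eq_extensionalI:
  assumes "t \<in> extensional (preimage V)" "\<And>x. x \<in> preimage V \<Longrightarrow> germs_correspond x (s (\<phi> x)) (t x)"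
  shows "pullback V s = t"
  using assms by (intro extensionalityI[OF pullback_extensional]) (simp_all add: pullback_eqI)

lemma pullback_ring_hom:
  "pullback V \<in> ring_hom (structure_sheaf Z V) (structure_sheaf X (preimage V))"
proof (rule ring_hom_memI)
  fix s assume section_s: "s \<in> carrier (structure_sheaf Z V)"
  show "pullback V s \<in> carrier (structure_sheaf X (preimage V))"
    by (rule pullback_section[OF section_s])
  fix t assume section_t: "t \<in> carrier (structure_sheaf Z V)"
  note correspond = preimageD(1) pullback_correspond[OF section_s] pullback_correspond[OF section_t]
  show "pullback V (s \<otimes>\<^bsub>structure_sheaf Z V\<^esub> t) =
      pullback V s \<otimes>\<^bsub>structure_sheaf X (preimage V)\<^esub> pullback V t"
    by (rule pullback_eq_extensionalI)
      (simp_all add: structure_sheaf_simps preimageD germs_correspond_mult correspond)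
  show "pullback V (s \<oplus>\<^bsub>structure_sheaf Z V\<^esub> t) =
      pullback V s \<oplus>\<^bsub>structure_sheaf X (preimage V)\<^esub> pullback V t"
    by (rule pullback_eq_extensionalI)
      (simp_all add: structure_sheaf_simps preimageD germs_correspond_add correspond)
next
  show "pullback V \<one>\<^bsub>structure_sheaf Z V\<^esub> = \<one>\<^bsub>structure_sheaf X (preimage V)\<^esub>"
    using germs_correspond_const[of _ 1]
    by (intro pullback_eq_extensionalI) (simp_all add: structure_sheaf_simps preimageD)
qed

lemma inj_on_pullback:
  assumes V_subset: "V \<subseteq> pts Z"
  shows "inj_on (pullback V) (carrier (structure_sheaf Z V))"
proof (rule inj_onI)
  fix s t assume section_s: "s \<in> carrier (structure_sheaf Z V)"
    and section_t: "t \<in> carrier (structure_sheaf Z V)"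
    and eq: "pullback V s = pullback V t"
  show "s = t"
  proof (rule extensionalityI[OF section_extensional[OF section_s]
    section_extensional[OF section_t]])
    fix y assume "y \<in> V"
    then obtain x where preimage: "x \<in> pts X" "\<phi> x = y" using point_preimage V_subset by blast
    then have "x \<in> preimage V" using \<open>y \<in> V\<close> by (simp add: preimage_def)
    then show "s y = t y"
      using germs_correspond_eq_iff[OF preimage(1) pullback_correspond[OF section_s]
        pullback_correspond[OF section_t]] preimage(2) eq
      by simp
  qed
qed

lemma section_locally_image:
  assumes carrier: "t \<in> carrier (structure_sheaf X (preimage V))" and in_preimage: "x \<in> preimage V"
  obtains j f g W where "j \<in> charts Z" "keys f \<subseteq> mon Z j" "keys g \<subseteq> mon Z j"
    "openin (zariski X) W" "x \<in> W" "W \<subseteq> preimage V" "\<phi> ` W \<subseteq> chart_open Z j"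
    "\<forall>z\<in>W. Z.fraction_at (\<phi> z) f g \<and> t z = germ_at X z (\<iota> f) (\<iota> g)"
proof -
  obtain i f' g' W where chart_X: "i \<in> charts X" "keys f' \<subseteq> mon X i" "keys g' \<subseteq> mon X i"
    and nbhd: "openin (zariski X) W" "x \<in> W" "W \<subseteq> preimage V" "W \<subseteq> chart_open X i"
      "\<forall>y\<in>W. g' \<notin> snd y \<and> t y = germ_at X y f' g'"
    by (rule section_locally_fraction[OF carrier in_preimage])
  obtain j f g where chart_Z: "j \<in> charts Z" "keys f \<subseteq> mon Z j" "keys g \<subseteq> mon Z j"
    and eq: "f' * \<iota> g = \<iota> f * g'"
    and chart: "\<And>z. z \<in> chart_open X i \<Longrightarrow> \<phi> z \<in> chart_open Z j \<and> (g' \<notin> snd z \<longrightarrow> g \<notin> snd (\<phi> z))"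
    using hom_fractions[OF chart_X] by blast
  have fraction: "Z.fraction_at (\<phi> z) f g" if "z \<in> W" for z
    using chart[of z] nbhd(4,5) that by (intro Z.fraction_at_chart_open[OF _ chart_Z]) blast+
  have "t z = germ_at X z (\<iota> f) (\<iota> g)" if z_in_W: "z \<in> W" for z
  proof -
    have "z \<in> pts X" using nbhd(3) z_in_W preimageD(1) by blast
    moreover have "X.fraction_at z f' g'"
      using nbhd(4,5) z_in_W by (intro X.fraction_at_chart_open[OF _ chart_X]) blast+
    ultimately have "germ_at X z f' g' = germ_at X z (\<iota> f) (\<iota> g)"
      using eq fraction_at_hom[OF _ fraction[OF z_in_W]] by (simp add: X.germ_at_eq_iff)
    then show ?thesis using nbhd(5) z_in_W by simp
  qed
  moreover have "\<phi> ` W \<subseteq> chart_open Z j" using chart nbhd(4) by blast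
  ultimately show thesis using that[OF chart_Z nbhd(1-3)] fraction by blast
qed

definition pushforward ::
  "('j \<times> ('n \<Rightarrow>\<^sub>0 'k) set) set \<Rightarrow> ('i \<times> ('m \<Rightarrow>\<^sub>0 'k) set \<Rightarrow> (('m \<Rightarrow>\<^sub>0 'k) \<times> ('m \<Rightarrow>\<^sub>0 'k)) set) \<Rightarrow>
   'j \<times> ('n \<Rightarrow>\<^sub>0 'k) set \<Rightarrow> (('n \<Rightarrow>\<^sub>0 'k) \<times> ('n \<Rightarrow>\<^sub>0 'k)) set" where
  "pushforward V t = (\<lambda>y\<in>V. THE \<sigma>. \<exists>x\<in>preimage V. \<phi> x = y \<and> germs_correspond x \<sigma> (t x))"

lemma pushforward_eqI:
  assumes "x \<in> preimage V" "germs_correspond x \<sigma> (t x)"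
  shows "pushforward V t (\<phi> x) = \<sigma>"
proof -
  have "(\<exists>z\<in>preimage V. \<phi> z = \<phi> x \<and> germs_correspond z \<sigma>' (t z)) \<longleftrightarrow> germs_correspond x \<sigma>' (t x)"
    for \<sigma>'
    using assms(1) inj_onD[OF inj_on_points, of _ x] preimageD(1) by blast
  then have "pushforward V t (\<phi> x) = (THE \<sigma>. germs_correspond x \<sigma> (t x))"
    using preimageD(2)[OF assms(1)] by (simp add: pushforward_def)
  also have "\<dots> = \<sigma>"
    using germs_correspond_eq_iff[OF preimageD(1)[OF assms(1)] _ assms(2)] assms(2)
    by (intro the_equality) blast+
  finally show ?thesis .
qed

lemma pushforward_germ_at:
  assumes "x \<in> preimage V" "Z.fraction_at (\<phi> x) f g" "t x = germ_at X x (\<iota> f) (\<iota> g)"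
  shows "pushforward V t (\<phi> x) = germ_at Z (\<phi> x) f g"
  using germs_correspondI[OF assms(2)] assms(3) by (intro pushforward_eqI[OF assms(1)]) simp

lemma pushforward_section:
  assumes V_subset: "V \<subseteq> pts Z" and carrier: "t \<in> carrier (structure_sheaf X (preimage V))"
  shows "pushforward V t \<in> carrier (structure_sheaf Z V)"
proof (rule sectionI)
  show "pushforward V t \<in> extensional V" by (simp add: pushforward_def)
  fix y assume y_in_V: "y \<in> V"
  then obtain x where preimage: "x \<in> pts X" "\<phi> x = y" using point_preimage V_subset by blast
  then have "x \<in> preimage V" using y_in_V by (simp add: preimage_def)
  then obtain j f g W where chart: "j \<in> charts Z" "keys f \<subseteq> mon Z j" "keys g \<subseteq> mon Z j"
    and nbhd: "openin (zariski X) W" "x \<in> W" "W \<subseteq> preimage V" "\<phi> ` W \<subseteq> chart_open Z j"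
    and germs: "\<forall>z\<in>W. Z.fraction_at (\<phi> z) f g \<and> t z = germ_at X z (\<iota> f) (\<iota> g)"
    by (rule section_locally_image[OF carrier])
  have "openin (zariski Z) (\<phi> ` W)"
    using homeomorphic_imp_open_map[OF homeomorphic] nbhd(1) by (simp add: open_map_def)
  moreover have "y \<in> \<phi> ` W" using nbhd(2) preimage(2) by blast
  moreover have "\<phi> ` W \<subseteq> V \<inter> chart_open Z j" using nbhd(3,4) preimageD(2) by blast
  moreover have "g \<notin> snd (\<phi> z) \<and> pushforward V t (\<phi> z) = germ_at Z (\<phi> z) f g" if "z \<in> W" for z
    using pushforward_germ_at[where t = t, OF subsetD[OF nbhd(3) that]] germs that
    by (simp add: Z.fraction_at_def)
  then have "\<forall>y\<in>\<phi> ` W. g \<notin> snd y \<and> pushforward V t y = germ_at Z y f g" by blast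
  ultimately show "\<exists>j\<in>charts Z. \<exists>f g W. keys f \<subseteq> mon Z j \<and> keys g \<subseteq> mon Z j \<and>
      openin (zariski Z) W \<and> y \<in> W \<and> W \<subseteq> V \<inter> chart_open Z j \<and>
      (\<forall>y\<in>W. g \<notin> snd y \<and> pushforward V t y = germ_at Z y f g)"
    using chart by blast
qed

lemma pullback_pushforward:
  assumes carrier: "t \<in> carrier (structure_sheaf X (preimage V))"
  shows "pullback V (pushforward V t) = t"
proof (rule pullback_eq_extensionalI[OF section_extensional[OF carrier]])
  fix x assume in_preimage: "x \<in> preimage V"
  obtain f g where fraction: "Z.fraction_at (\<phi> x) f g" "t x = germ_at X x (\<iota> f) (\<iota> g)"
    using section_locally_image[OF carrier in_preimage] by metis
  then show "germs_correspond x (pushforward V t (\<phi> x)) (t x)"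
    using germs_correspondI[OF fraction(1)]
      pushforward_germ_at[where t = t, OF in_preimage fraction]
    by simp
qed

lemma pullback_ring_iso:
  assumes "V \<subseteq> pts Z"
  shows "pullback V \<in> ring_iso (structure_sheaf Z V) (structure_sheaf X (preimage V))"
proof -
  have "pullback V ` carrier (structure_sheaf Z V) = carrier (structure_sheaf X (preimage V))"
  proof
    show "pullback V ` carrier (structure_sheaf Z V) \<subseteq> carrier (structure_sheaf X (preimage V))"
      by (intro image_subsetI pullback_section)
    show "carrier (structure_sheaf X (preimage V)) \<subseteq> pullback V ` carrier (structure_sheaf Z V)"
      using pushforward_section[OF assms] pullback_pushforward by (metis image_eqI subsetI)
  qed
  then show ?thesis
    using pullback_ring_hom inj_on_pullback[OF assms] by (simp add: ring_iso_def bij_betw_def)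
qed

lemma pullback_const: "pullback V (const (scheme_of Z) V c) = const (scheme_of X) (preimage V) c"
  using germs_correspond_const
  by (intro pullback_eq_extensionalI) (simp_all add: scheme_of_def preimageD)

lemma pullback_restrict:
  assumes "V' \<subseteq> V" "s \<in> carrier (structure_sheaf Z V)"
  shows "pullback V' (restrict s V') = restrict (pullback V s) (preimage V')"
proof (rule pullback_eq_extensionalI)
  fix x assume in_preimage: "x \<in> preimage V'"
  then have "x \<in> preimage V" using assms(1) by (auto simp: preimage_def)
  then show "germs_correspond x (restrict s V' (\<phi> x)) (restrict (pullback V s) (preimage V') x)"
    using pullback_correspond[OF assms(2)] in_preimage by (simp add: preimageD)
qed simp

theorem k_isomorphic_scheme_of: "k_isomorphic (scheme_of X) (scheme_of Z)"
proof -
  have preimage: "{x \<in> topspace (zariski X). \<phi> x \<in> V} = preimage V" for V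
    by (simp add: X.topspace_zariski preimage_def)
  have "pullback V \<in> ring_iso (structure_sheaf Z V) (structure_sheaf X (preimage V)) \<and>
      (\<forall>c. pullback V (const (scheme_of Z) V c) = const (scheme_of X) (preimage V) c) \<and>
      (\<forall>V' s. openin (zariski Z) V' \<and> V' \<subseteq> V \<and> s \<in> carrier (structure_sheaf Z V) \<longrightarrow>
        pullback V' (restrict s V') = restrict (pullback V s) (preimage V'))"
    if "openin (zariski Z) V" for V
    using openin_subset[OF that] pullback_ring_iso pullback_const pullback_restrict
    by (simp add: Z.topspace_zariski)
  then show ?thesis
    unfolding k_isomorphic_def Let_def topo_scheme_of sheaf_scheme_of
    using homeomorphic by (intro exI[of _ \<phi>] exI[of _ pullback]) (simp add: preimage)
qed

end

section \<open>Affine space as a toric variety\<close>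

lemma affine_atlas_simps [simp]:
  "charts (affine_atlas n) = UNIV" "sub (affine_atlas n) i j = True"
  "mon (affine_atlas n) i = {u. keys u \<subseteq> {..<n}}" "van (affine_atlas n) i = {0}"
  by (simp_all add: affine_atlas_def Let_def)

lemma pts_affine_atlas:
  "y \<in> pts (affine_atlas n) \<longleftrightarrow> monoid_algebra_prime {u. keys u \<subseteq> {..<n}} (snd y)"
  by (simp add: affine_atlas_def Let_def monoid_algebra_prime_def add_submonoid_keys_subset)

lemma chart_open_affine: "chart_open (affine_atlas n) i = pts (affine_atlas n)"
  by (auto simp: chart_open_def)

lemma integral_atlas_affine: "integral_atlas (affine_atlas n)"
  by (intro integral_atlas.intro prime_atlas.intro integral_atlas_axioms.intro)
    (simp_all add: pts_affine_atlas add_submonoid_keys_subset monoid_algebra_prime.primeideal)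

definition orthant_monoid :: "'x set \<Rightarrow> 'x set \<Rightarrow> ('x \<Rightarrow>\<^sub>0 int) set" where
  "orthant_monoid Y G = {u. keys u \<subseteq> Y \<and> (\<forall>x\<in>G. lookup u x \<ge> 0)}"

lemma add_submonoid_orthant_monoid: "add_submonoid (orthant_monoid Y G)"
  unfolding add_submonoid_def
proof (intro conjI ballI)
  fix u v assume "u \<in> orthant_monoid Y G" "v \<in> orthant_monoid Y G"
  then show "u + v \<in> orthant_monoid Y G"
    using keys_add[of u v] by (auto simp: orthant_monoid_def lookup_add)
qed (simp add: orthant_monoid_def)

lemma orthant_monoid_antimono: "G \<subseteq> H \<Longrightarrow> orthant_monoid Y H \<subseteq> orthant_monoid Y G"
  by (auto simp: orthant_monoid_def)

lemma lookup_orthant_monoid_nonneg: "u \<in> orthant_monoid Y Y \<Longrightarrow> lookup u y \<ge> 0"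
  using in_keys_iff[of y u] by (cases "y \<in> Y") (auto simp: orthant_monoid_def)

lemma single_in_orthant_monoid: "y \<in> Y \<Longrightarrow> c \<ge> 0 \<Longrightarrow> single y c \<in> orthant_monoid Y G"
  by (auto simp: orthant_monoid_def lookup_single when_def split: if_splits)

lemma diff_single_in_orthant_monoid:
  assumes "u \<in> orthant_monoid Y Y" "y \<in> Y" "lookup u y \<noteq> 0"
  shows "u - single y 1 \<in> orthant_monoid Y Y"
proof -
  have "lookup u y \<ge> 1" using lookup_orthant_monoid_nonneg[OF assms(1), of y] assms(3) by simp
  then show ?thesis
    using assms(1,2) keys_diff_subset[of u Y "single y 1"]
    by (auto simp: orthant_monoid_def lookup_minus lookup_single when_def)
qed

definition orthant_units :: "'x set \<Rightarrow> 'x set \<Rightarrow> ('x \<Rightarrow>\<^sub>0 int) set" where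
  "orthant_units Y G = {u \<in> orthant_monoid Y Y. keys u \<subseteq> Y - G}"

lemma lookup_orthant_units: "u \<in> orthant_units Y G \<Longrightarrow> x \<in> G \<Longrightarrow> lookup u x = 0"
  using in_keys_iff[of x u] by (auto simp: orthant_units_def)

lemma orthant_units_antimono: "G \<subseteq> H \<Longrightarrow> orthant_units Y H \<subseteq> orthant_units Y G"
  by (auto simp: orthant_units_def)

lemma monoid_localization_orthant:
  assumes "finite Y" "G \<subseteq> Y"
  shows "monoid_localization (orthant_monoid Y Y) (orthant_units Y G) (orthant_monoid Y G)"
proof
  show "add_submonoid (orthant_units Y G)"
    using add_submonoid_orthant_monoid[of Y Y] add_submonoid_keys_subset[of "Y - G"]
    unfolding orthant_units_def add_submonoid_def by blast
  show "\<exists>v\<in>orthant_monoid Y G. u + v = 0" if "u \<in> orthant_units Y G" for u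
    using that lookup_orthant_units[OF that]
    by (intro bexI[of _ "- u"]) (auto simp: orthant_units_def orthant_monoid_def)
  show "\<exists>u\<in>orthant_units Y G. u + v \<in> orthant_monoid Y Y" if v_exponent: "v \<in> orthant_monoid Y G"
    for v
  proof
    let ?u = "poly_mapping_on (Y - G) (\<lambda>y. \<bar>lookup v y\<bar>)"
    have lookup: "lookup ?u y = (if y \<in> Y - G then \<bar>lookup v y\<bar> else 0)" for y
      by (rule lookup_poly_mapping_on) (use \<open>finite Y\<close> in simp)
    have keys: "keys ?u \<subseteq> Y - G"
      by (rule keys_poly_mapping_on) (use \<open>finite Y\<close> in simp)
    then show "?u \<in> orthant_units Y G"
      by (auto simp: orthant_units_def orthant_monoid_def lookup)
    have "keys (?u + v) \<subseteq> Y"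
      using keys v_exponent by (intro keys_add_subset) (auto simp: orthant_monoid_def)
    then show "?u + v \<in> orthant_monoid Y Y"
      using v_exponent by (auto simp: orthant_monoid_def lookup_add lookup)
  qed
qed (use assms in
    \<open>auto simp: add_submonoid_orthant_monoid orthant_monoid_antimono orthant_units_def\<close>)

lemma monomial_single_power:
  "monomial (single y 1) ^ n = (monomial (single y (int n)) :: _ \<Rightarrow>\<^sub>0 'k::field)"
  by (induction n) (simp_all add: mult_single single_add)

lemma monomial_sum: "monomial (sum F I) = (\<Prod>i\<in>I. monomial (F i) :: _ \<Rightarrow>\<^sub>0 'k::field)"
  by (induction I rule: infinite_finite_induct) (simp_all add: monomial_add)

lemma variable_in_prime_if_monomial:
  assumes prime_p: "monoid_algebra_prime (orthant_monoid Y Y) (p :: (_ \<Rightarrow>\<^sub>0 'k::field) set)"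
    and u_in_p: "u \<in> orthant_monoid Y Y" "monomial u \<in> p"
  obtains y where "y \<in> keys u" "monomial (single y 1) \<in> p"
proof -
  interpret p: monoid_algebra_prime "orthant_monoid Y Y" p by (rule prime_p)
  have keys_subset: "y \<in> Y" if "y \<in> keys u" for y using that u_in_p(1)
    by (auto simp: orthant_monoid_def)
  have "(\<Prod>y\<in>keys u. monomial (single y (lookup u y)) :: _ \<Rightarrow>\<^sub>0 'k) \<in> p"
    using u_in_p(2) by (simp flip: monomial_sum poly_mapping_sum_single)
  then obtain y
    where variable_in_p: "y \<in> keys u" "(monomial (single y (lookup u y)) :: _ \<Rightarrow>\<^sub>0 'k) \<in> p"
    using keys_subset lookup_orthant_monoid_nonneg[OF u_in_p(1)]
    by (elim p.prod_mem_imp[rotated 2]) (auto intro!: single_in_orthant_monoid)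
  have "monomial (single y (lookup u y)) = (monomial (single y 1) ^ nat (lookup u y) :: _ \<Rightarrow>\<^sub>0 'k)"
    using lookup_orthant_monoid_nonneg[OF u_in_p(1), of y] by (simp add: monomial_single_power)
  then have "monomial (single y 1) \<in> p"
    using variable_in_p(2) p.power_notin[of "monomial (single y 1)" "nat (lookup u y)"]
      single_in_orthant_monoid[OF keys_subset[OF variable_in_p(1)], of 1 Y] by auto
  then show thesis using that variable_in_p(1) by blast
qed

text \<open>The charts are the open subsets of affine space, with coordinates indexed by \<open>Y\<close>, on
  which the coordinates outside \<open>rays i\<close> are invertible.\<close>

locale orthant_atlas =
  fixes X :: "('i, 'x \<Rightarrow>\<^sub>0 int, 'k::field) atlas" and Y :: "'x set" and rays :: "'i \<Rightarrow> 'x set"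
  assumes finite_Y: "finite Y"
    and bij_rays: "bij_betw rays (charts X) (Pow Y)"
    and sub_iff: "\<And>i j. i \<in> charts X \<Longrightarrow> j \<in> charts X \<Longrightarrow> sub X i j \<longleftrightarrow> rays i \<subseteq> rays j"
    and mon_eq: "\<And>i. i \<in> charts X \<Longrightarrow> mon X i = orthant_monoid Y (rays i)"
    and van_eq: "\<And>i. i \<in> charts X \<Longrightarrow> van X i = {0}"
    and pts_iff: "\<And>i q. (i, q) \<in> pts X \<longleftrightarrow> i \<in> charts X \<and> primeideal q (monoid_algebra (mon X i)) \<and>
      (\<forall>u\<in>mon X i. (\<exists>x\<in>rays i. lookup u x \<noteq> 0) \<longrightarrow> monomial u \<in> q)"
begin

lemma rays_subset: "i \<in> charts X \<Longrightarrow> rays i \<subseteq> Y"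
  using bij_rays bij_betwE by blast

lemma ptsD:
  assumes "x \<in> pts X"
  shows "fst x \<in> charts X" and "primeideal (snd x) (monoid_algebra (mon X (fst x)))"
    and "u \<in> mon X (fst x) \<Longrightarrow> z \<in> rays (fst x) \<Longrightarrow> lookup u z \<noteq> 0 \<Longrightarrow> monomial u \<in> snd x"
  using assms pts_iff[of "fst x" "snd x"] by auto

lemma integral_atlas: "integral_atlas X"
proof (intro integral_atlas.intro prime_atlas.intro integral_atlas_axioms.intro)
  fix i and f g :: "_ \<Rightarrow>\<^sub>0 'k"
  assume "i \<in> charts X" "keys f \<subseteq> mon X i" "keys g \<subseteq> mon X i" "f * g = 0"
  then show "f = 0 \<or> g = 0"
    by (intro group_algebra_no_zero_divisors[OF finite_Y]) (auto simp: mon_eq orthant_monoid_def)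
next
  show "mon X j \<subseteq> mon X i" if "i \<in> charts X" "j \<in> charts X" "sub X i j" for i j
    using that orthant_monoid_antimono by (simp add: mon_eq sub_iff)
qed (simp_all add: ptsD(1,2) sub_iff van_eq mon_eq[THEN arg_cong[where f = add_submonoid]]
    add_submonoid_orthant_monoid)

sublocale integral_atlas X by (rule integral_atlas)

lemma localization:
  "i \<in> charts X \<Longrightarrow> monoid_localization (orthant_monoid Y Y) (orthant_units Y (rays i)) (mon X i)"
  unfolding mon_eq by (rule monoid_localization_orthant[OF finite_Y rays_subset])

lemma orthant_monoid_subset_mon: "i \<in> charts X \<Longrightarrow> orthant_monoid Y Y \<subseteq> mon X i"
  unfolding mon_eq by (rule orthant_monoid_antimono[OF rays_subset])

lemma unit_mult_mem_iff:
  assumes in_chart: "x \<in> chart_open X i" and chart: "i \<in> charts X"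
    and unit: "u \<in> orthant_units Y (rays i)" and keys_f: "keys f \<subseteq> mon X i"
  shows "monomial u * f \<in> snd x \<longleftrightarrow> f \<in> snd x"
proof (rule monoid_localization.monomial_mult_mem_iff)
  have point: "x \<in> pts X" and "sub X (fst x) i" using in_chart by (auto simp: chart_open_def)
  then have "rays (fst x) \<subseteq> rays i" using sub_iff point_chart chart by blast
  then show "u \<in> orthant_units Y (rays (fst x))" using unit orthant_units_antimono by blast
  show "keys f \<subseteq> mon X (fst x)"
    using keys_f mon_antimono[OF point_chart[OF point] chart] \<open>sub X (fst x) i\<close> by blast
  show "monoid_localization (orthant_monoid Y Y) (orthant_units Y (rays (fst x))) (mon X (fst x))"
    by (rule localization[OF point_chart[OF point]])
  show "monoid_algebra_prime (mon X (fst x)) (snd x)" by (rule point_prime[OF point])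
qed

lemma mem_rays_iff:
  assumes point: "x \<in> pts X" and y_in_Y: "y \<in> Y"
  shows "y \<in> rays (fst x) \<longleftrightarrow> monomial (single y 1) \<in> snd x"
proof
  have exponent: "single y 1 \<in> orthant_monoid Y Y"
    by (rule single_in_orthant_monoid[OF y_in_Y]) simp
  show "monomial (single y 1) \<in> snd x" if "y \<in> rays (fst x)"
    using ptsD(3)[OF point _ that] exponent orthant_monoid_subset_mon[OF point_chart[OF point]]
    by auto
  show "y \<in> rays (fst x)" if "monomial (single y 1) \<in> snd x"
  proof (rule ccontr)
    assume "y \<notin> rays (fst x)"
    then have "single y 1 \<in> orthant_units Y (rays (fst x))"
      using y_in_Y exponent by (simp add: orthant_units_def)
    from monoid_localization.monomial_notin[OF localization[OF point_chart[OF point]]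
      point_prime[OF point] this]
    show False using that by contradiction
  qed
qed

definition complement_exponent :: "'i \<Rightarrow> ('x \<Rightarrow>\<^sub>0 int)" where
  "complement_exponent i = poly_mapping_on (Y - rays i) (\<lambda>_. 1)"

lemma lookup_complement_exponent:
  "lookup (complement_exponent i) y = (if y \<in> Y - rays i then 1 else 0)"
  unfolding complement_exponent_def by (rule lookup_poly_mapping_on) (simp add: finite_Y)

lemma complement_exponent_units: "complement_exponent i \<in> orthant_units Y (rays i)"
  by (auto simp: orthant_units_def orthant_monoid_def in_keys_iff lookup_complement_exponent
      split: if_splits)

lemma mem_chart_open_iff:
  assumes point: "x \<in> pts X" and chart: "i \<in> charts X"
  shows "x \<in> chart_open X i \<longleftrightarrow> monomial (complement_exponent i) \<notin> snd x"
proof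
  assume in_chart: "x \<in> chart_open X i"
  have "keys (1 :: _ \<Rightarrow>\<^sub>0 'k) \<subseteq> mon X i" using keys_const_subset[OF submonoid[OF chart], of 1]
    by simp
  then have "monomial (complement_exponent i) * 1 \<notin> snd x"
    using unit_mult_mem_iff[OF in_chart chart complement_exponent_units]
      monoid_algebra_prime.one_notin[OF point_prime[OF point]]
    by blast
  then show "monomial (complement_exponent i) \<notin> snd x" by simp
next
  assume notin: "monomial (complement_exponent i) \<notin> snd x"
  have "complement_exponent i \<in> mon X (fst x)"
    using complement_exponent_units[of i] orthant_monoid_subset_mon[OF point_chart[OF point]]
    by (auto simp: orthant_units_def)
  then have zero: "lookup (complement_exponent i) y = 0" if "y \<in> rays (fst x)" for y
    using ptsD(3)[OF point _ that] notin by blast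
  have "rays (fst x) \<subseteq> rays i"
  proof
    fix y assume "y \<in> rays (fst x)"
    then show "y \<in> rays i"
      using zero[of y] rays_subset[OF point_chart[OF point]]
      by (auto simp: lookup_complement_exponent split: if_splits)
  qed
  then show "x \<in> chart_open X i" using point chart by (simp add: chart_open_def sub_iff point_chart)
qed

lemma basic_open_eq_nonvanishing:
  assumes chart: "i \<in> charts X" and keys_f: "keys f \<subseteq> mon X i"
  obtains h where "keys h \<subseteq> orthant_monoid Y Y" "basic_open X i f = {x \<in> pts X. h \<notin> snd x}"
proof -
  obtain u where clears: "u \<in> orthant_units Y (rays i)" "keys (monomial u * f) \<subseteq> orthant_monoid Y Y"
    "keys (monomial u * f) \<subseteq> orthant_monoid Y Y"
    by (rule monoid_localization.clear_denominators[OF localization[OF chart] keys_f keys_f])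
  let ?h = "monomial (complement_exponent i) * (monomial u * f)"
  have keys_complement: "keys (monomial (complement_exponent i) :: _ \<Rightarrow>\<^sub>0 'k) \<subseteq> orthant_monoid Y Y"
    using complement_exponent_units[of i] by (auto simp: orthant_units_def)
  have "x \<in> basic_open X i f \<longleftrightarrow> ?h \<notin> snd x" if point: "x \<in> pts X" for x
  proof -
    note sub = orthant_monoid_subset_mon[OF point_chart[OF point]]
    have "?h \<in> snd x \<longleftrightarrow> monomial (complement_exponent i) \<in> snd x \<or> monomial u * f \<in> snd x"
      using monoid_algebra_prime.mult_mem_iff[OF point_prime[OF point]] keys_complement clears(2)
        sub by blast
    then show ?thesis
      using mem_chart_open_iff[OF point chart] unit_mult_mem_iff[of x, OF _ chart clears(1) keys_f]
      by (auto simp: basic_open_def)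
  qed
  then have "basic_open X i f = {x \<in> pts X. ?h \<notin> snd x}"
    by (auto simp: basic_open_def chart_open_def)
  then show thesis
    using that keys_mult_subset[OF add_submonoid_orthant_monoid keys_complement clears(2)] by blast
qed

lemma openin_nonvanishing:
  assumes "keys h \<subseteq> orthant_monoid Y Y"
  shows "openin (zariski X) {x \<in> pts X. h \<notin> snd x}"
proof -
  have "Y \<in> rays ` charts X" using bij_betw_imp_surj_on[OF bij_rays] by simp
  then obtain i where big_chart: "i \<in> charts X" "rays i = Y" by auto
  have "basic_open X i h = {x \<in> pts X. h \<notin> snd x}"
    using rays_subset point_chart big_chart by (auto simp: basic_open_def chart_open_def sub_iff)
  then show ?thesis using openin_basic_open[OF big_chart(1), of h] assms big_chart
    by (simp add: mon_eq)
qed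

lemma point_eqI:
  assumes x_point: "x \<in> pts X" and x'_point: "x' \<in> pts X"
    and eq: "\<And>f. keys f \<subseteq> orthant_monoid Y Y \<Longrightarrow> f \<in> snd x \<longleftrightarrow> f \<in> snd x'"
  shows "x = x'"
proof -
  have "y \<in> rays (fst x) \<longleftrightarrow> y \<in> rays (fst x')" if "y \<in> Y" for y
    unfolding mem_rays_iff[OF x_point that] mem_rays_iff[OF x'_point that]
    by (rule eq) (simp add: single_in_orthant_monoid that)
  then have "rays (fst x) = rays (fst x')"
    using rays_subset point_chart x_point x'_point by blast
  then have fst: "fst x = fst x'"
    using inj_onD[OF bij_betw_imp_inj_on[OF bij_rays]] point_chart x_point x'_point by blast
  have "snd x = snd x'"
    using monoid_localization.prime_eqI[OF localization[OF point_chart[OF x_point]]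
      point_prime[OF x_point] _ eq] point_prime[OF x'_point] fst by simp
  with fst show ?thesis by (simp add: prod_eq_iff)
qed

lemma point_of_prime:
  assumes prime_p: "monoid_algebra_prime (orthant_monoid Y Y) p"
  obtains x where "x \<in> pts X" "\<And>f. keys f \<subseteq> orthant_monoid Y Y \<Longrightarrow> f \<in> snd x \<longleftrightarrow> f \<in> p"
proof -
  interpret p: monoid_algebra_prime "orthant_monoid Y Y" p by (rule prime_p)
  have "{y \<in> Y. monomial (single y 1) \<in> p} \<in> rays ` charts X"
    using bij_betw_imp_surj_on[OF bij_rays] by auto
  then obtain i where chart: "i \<in> charts X" and rays: "rays i = {y \<in> Y. monomial (single y 1) \<in> p}"
    by auto
  interpret L: monoid_localization "orthant_monoid Y Y" "orthant_units Y (rays i)" "mon X i"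
    by (rule localization[OF chart])
  have unit: "monomial u \<notin> p" if "u \<in> orthant_units Y (rays i)" for u
    using variable_in_prime_if_monomial[OF prime_p, of u] that rays
    by (auto simp: orthant_units_def)
  have "monomial v \<in> L.extension p" if v_in_mon: "v \<in> mon X i"
    and z_in_rays: "z \<in> rays i" "lookup v z \<noteq> 0" for v z
  proof -
    obtain u where clears: "u \<in> orthant_units Y (rays i)" "u + v \<in> orthant_monoid Y Y"
      using L.denominators[OF v_in_mon] by blast
    have "lookup u z = 0" by (rule lookup_orthant_units[OF clears(1) z_in_rays(1)])
    then have "u + v - single z 1 \<in> orthant_monoid Y Y"
      using clears(2) z_in_rays rays
      by (intro diff_single_in_orthant_monoid) (auto simp: lookup_add)
    then have "monomial (u + v - single z 1) * monomial (single z 1) \<in> p"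
      using z_in_rays(1) rays by (intro p.mult_mem) auto
    then have "monomial u * monomial v \<in> p" by (simp add: mult_single)
    then show ?thesis using clears(1) v_in_mon by (auto simp: L.extension_def)
  qed
  moreover have "primeideal (L.extension p) (monoid_algebra (mon X i))"
    by (rule monoid_algebra_prime.primeideal[OF L.monoid_algebra_prime_extension[OF prime_p unit]])
  ultimately have "(i, L.extension p) \<in> pts X" using chart by (auto simp: pts_iff)
  then show thesis
    using that[of "(i, L.extension p)"] L.mem_extension_iff[OF prime_p unit] by simp
qed

abbreviation affine :: "(unit, nat \<Rightarrow>\<^sub>0 nat, 'k) atlas" where
  "affine \<equiv> affine_atlas (card Y)"

abbreviation affine_exponents :: "(nat \<Rightarrow>\<^sub>0 nat) set" where
  "affine_exponents \<equiv> {u. keys u \<subseteq> {..<card Y}}"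

definition coordinate_index :: "'x \<Rightarrow> nat" where
  "coordinate_index = (SOME b. bij_betw b Y {..<card Y})"

lemma bij_coordinate_index: "bij_betw coordinate_index Y {..<card Y}"
  using ex_bij_betw_finite_nat[OF finite_Y] unfolding coordinate_index_def atLeast0LessThan
  by (rule someI_ex)

definition to_orthant :: "(nat \<Rightarrow>\<^sub>0 nat) \<Rightarrow> ('x \<Rightarrow>\<^sub>0 int)" where
  "to_orthant = relabel coordinate_index Y int"

definition from_orthant :: "('x \<Rightarrow>\<^sub>0 int) \<Rightarrow> (nat \<Rightarrow>\<^sub>0 nat)" where
  "from_orthant = relabel (inv_into Y coordinate_index) {..<card Y} nat"

lemma to_orthant_in_orthant_monoid: "to_orthant u \<in> orthant_monoid Y Y"
  by (simp add: to_orthant_def orthant_monoid_def keys_relabel lookup_relabel finite_Y)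

lemma to_orthant_0: "to_orthant 0 = 0"
  and to_orthant_add: "to_orthant (u + v) = to_orthant u + to_orthant v"
  by (simp_all add: to_orthant_def relabel_0 relabel_add)

lemma from_orthant_in_affine_exponents: "from_orthant u \<in> affine_exponents"
  by (simp add: from_orthant_def keys_relabel)

lemma from_orthant_0: "from_orthant 0 = 0"
  by (simp add: from_orthant_def relabel_0)

lemma from_orthant_add:
  assumes "u \<in> orthant_monoid Y Y" "v \<in> orthant_monoid Y Y"
  shows "from_orthant (u + v) = from_orthant u + from_orthant v"
  by (rule poly_mapping_eqI)
    (simp add: from_orthant_def lookup_relabel lookup_add nat_add_distrib
      lookup_orthant_monoid_nonneg[OF assms(1)] lookup_orthant_monoid_nonneg[OF assms(2)])

lemma to_orthant_from_orthant: "u \<in> orthant_monoid Y Y \<Longrightarrow> to_orthant (from_orthant u) = u"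
  unfolding to_orthant_def from_orthant_def
  by (rule relabel_relabel_inverse[OF finite_Y _ _ bij_coordinate_index])
    (auto simp: orthant_monoid_def)

lemma from_orthant_to_orthant:
  assumes "u \<in> affine_exponents"
  shows "from_orthant (to_orthant u) = u"
proof (rule poly_mapping_eq_onI)
  show "keys (from_orthant (to_orthant u)) \<subseteq> {..<card Y}" using from_orthant_in_affine_exponents
    by simp
  show "keys u \<subseteq> {..<card Y}" using assms by simp
  fix k assume k_less: "k \<in> {..<card Y}"
  then have "inv_into Y coordinate_index k \<in> Y"
    "coordinate_index (inv_into Y coordinate_index k) = k"
    using bij_betw_inv_into_right[OF bij_coordinate_index]
      bij_betw_apply[OF bij_betw_inv_into[OF bij_coordinate_index]] by simp_all
  then show "lookup (from_orthant (to_orthant u)) k = lookup u k"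
    using k_less by (simp add: from_orthant_def to_orthant_def lookup_relabel finite_Y)
qed

abbreviation to_laurent :: "((nat \<Rightarrow>\<^sub>0 nat) \<Rightarrow>\<^sub>0 'k) \<Rightarrow> (('x \<Rightarrow>\<^sub>0 int) \<Rightarrow>\<^sub>0 'k)" where
  "to_laurent \<equiv> map_exponents to_orthant"

abbreviation from_laurent :: "(('x \<Rightarrow>\<^sub>0 int) \<Rightarrow>\<^sub>0 'k) \<Rightarrow> ((nat \<Rightarrow>\<^sub>0 nat) \<Rightarrow>\<^sub>0 'k)" where
  "from_laurent \<equiv> map_exponents from_orthant"

lemma keys_to_laurent: "keys (to_laurent f) \<subseteq> orthant_monoid Y Y"
  using keys_map_exponents[of to_orthant f] to_orthant_in_orthant_monoid by blast

lemma keys_from_laurent: "keys (from_laurent f) \<subseteq> affine_exponents"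
  using keys_map_exponents[of from_orthant f] from_orthant_in_affine_exponents by blast

lemma to_laurent_from_laurent: "keys f \<subseteq> orthant_monoid Y Y \<Longrightarrow> to_laurent (from_laurent f) = f"
  by (rule map_exponents_inverse) (use to_orthant_from_orthant in blast)

lemma from_laurent_to_laurent: "keys f \<subseteq> affine_exponents \<Longrightarrow> from_laurent (to_laurent f) = f"
  by (rule map_exponents_inverse) (use from_orthant_to_orthant in blast)

lemma to_laurent_mult: "to_laurent (f * g) = to_laurent f * to_laurent g"
  by (rule map_exponents_mult[of UNIV])
    (simp_all add: add_submonoid_def to_orthant_0 to_orthant_add)

definition contract ::
  "'i \<times> (('x \<Rightarrow>\<^sub>0 int) \<Rightarrow>\<^sub>0 'k) set \<Rightarrow> unit \<times> ((nat \<Rightarrow>\<^sub>0 nat) \<Rightarrow>\<^sub>0 'k) set" where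
  "contract x = ((), {f. keys f \<subseteq> affine_exponents \<and> to_laurent f \<in> snd x})"

lemma mem_contract_iff: "keys f \<subseteq> affine_exponents \<Longrightarrow> f \<in> snd (contract x) \<longleftrightarrow> to_laurent f \<in> snd x"
  by (simp add: contract_def)

lemma contract_pts:
  assumes point: "x \<in> pts X"
  shows "contract x \<in> pts affine"
proof -
  have "to_orthant ` affine_exponents \<subseteq> mon X (fst x)"
    using to_orthant_in_orthant_monoid orthant_monoid_subset_mon[OF point_chart[OF point]] by blast
  then show ?thesis
    unfolding pts_affine_atlas contract_def snd_conv
    by (intro monoid_algebra_prime_vimage[OF _ _ _ point_prime[OF point]])
      (simp_all add: add_submonoid_keys_subset to_orthant_0 to_orthant_add)
qed

lemma inj_on_contract: "inj_on contract (pts X)"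
proof (rule inj_onI)
  fix x x' assume points: "x \<in> pts X" "x' \<in> pts X" and eq: "contract x = contract x'"
  have "f \<in> snd x \<longleftrightarrow> f \<in> snd x'" if "keys f \<subseteq> orthant_monoid Y Y" for f
    using mem_contract_iff[OF keys_from_laurent, of f x]
      mem_contract_iff[OF keys_from_laurent, of f x'] eq
    by (simp add: to_laurent_from_laurent[OF that])
  then show "x = x'" by (rule point_eqI[OF points])
qed

lemma contract_surj:
  assumes point: "y \<in> pts affine"
  obtains x where "x \<in> pts X" "contract x = y"
proof -
  interpret y: monoid_algebra_prime affine_exponents "snd y" using point
    by (simp add: pts_affine_atlas)
  have "monoid_algebra_prime (orthant_monoid Y Y)
      {f. keys f \<subseteq> orthant_monoid Y Y \<and> from_laurent f \<in> snd y}"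
    using from_orthant_in_affine_exponents
    by (intro monoid_algebra_prime_vimage[OF _ _ _ y.monoid_algebra_prime_axioms])
      (auto simp: add_submonoid_orthant_monoid from_orthant_0 from_orthant_add)
  then obtain x where preimage: "x \<in> pts X" "\<And>f. keys f \<subseteq> orthant_monoid Y Y \<Longrightarrow>
      f \<in> snd x \<longleftrightarrow> f \<in> {f. keys f \<subseteq> orthant_monoid Y Y \<and> from_laurent f \<in> snd y}"
    by (rule point_of_prime) blast
  have "f \<in> snd (contract x) \<longleftrightarrow> f \<in> snd y" if keys_f: "keys f \<subseteq> affine_exponents" for f
    using preimage(2)[OF keys_to_laurent, of f] keys_to_laurent[of f]
    by (simp add: mem_contract_iff[OF keys_f] from_laurent_to_laurent[OF keys_f])
  moreover have "f \<in> snd (contract x) \<Longrightarrow> keys f \<subseteq> affine_exponents" for f by (simp add: contract_def)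
  ultimately have "snd (contract x) = snd y" using y.keys_subset by blast
  then show thesis using that preimage(1) by (simp add: prod_eq_iff)
qed

lemma homeomorphic_contract: "homeomorphic_map (zariski X) (zariski affine) contract"
proof -
  interpret Z: integral_atlas affine by (rule integral_atlas_affine)
  define lift where "lift = inv_into (pts X) contract"
  have lift_contract: "lift (contract x) = x" if "x \<in> pts X" for x
    unfolding lift_def by (rule inv_into_f_f[OF inj_on_contract that])
  have lift: "lift y \<in> pts X \<and> contract (lift y) = y" if point: "y \<in> pts affine" for y
    using contract_surj[OF point] lift_contract by metis
  have "continuous_map (zariski X) (zariski affine) contract"
  proof (rule continuous_map_into_zariski)
    fix i and f :: "_ \<Rightarrow>\<^sub>0 'k" assume "keys f \<subseteq> mon affine i"
    then have "{x \<in> topspace (zariski X). contract x \<in> basic_open affine i f} =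
        {x \<in> pts X. to_laurent f \<notin> snd x}"
      using contract_pts
      by (auto simp: topspace_zariski basic_open_def chart_open_affine mem_contract_iff)
    then show "openin (zariski X) {x \<in> topspace (zariski X). contract x \<in> basic_open affine i f}"
      using openin_nonvanishing[OF keys_to_laurent] by simp
  qed (simp add: topspace_zariski Z.topspace_zariski contract_pts)
  moreover have "continuous_map (zariski affine) (zariski X) lift"
  proof (rule continuous_map_into_zariski)
    fix i and f :: "_ \<Rightarrow>\<^sub>0 'k" assume "i \<in> charts X" "keys f \<subseteq> mon X i"
    then obtain h
      where nonvanishing_h: "keys h \<subseteq> orthant_monoid Y Y"
        "basic_open X i f = {x \<in> pts X. h \<notin> snd x}"
      by (rule basic_open_eq_nonvanishing)
    have "lift y \<in> basic_open X i f \<longleftrightarrow> from_laurent h \<notin> snd y" if "y \<in> pts affine" for y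
      using mem_contract_iff[OF keys_from_laurent, of h "lift y"] lift[OF that]
      by (simp add: nonvanishing_h(2) to_laurent_from_laurent[OF nonvanishing_h(1)])
    then have "{y \<in> topspace (zariski affine). lift y \<in> basic_open X i f} =
        {y \<in> pts affine. from_laurent h \<notin> snd y}"
      by (auto simp: Z.topspace_zariski)
    also have "\<dots> = basic_open affine () (from_laurent h)"
      by (simp add: basic_open_def chart_open_affine)
    finally show "openin (zariski affine)
        {y \<in> topspace (zariski affine). lift y \<in> basic_open X i f}"
      using openin_basic_open[of "()" affine "from_laurent h"] keys_from_laurent by simp
  qed (simp add: topspace_zariski Z.topspace_zariski lift)
  ultimately have "homeomorphic_maps (zariski X) (zariski affine) contract lift"
    unfolding homeomorphic_maps_def topspace_zariski Z.topspace_zariski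
    using lift_contract lift by blast
  then show ?thesis using homeomorphic_map_maps by blast
qed

lemma laurent_fractions:
  assumes chart: "i \<in> charts X" and keys_f: "keys f \<subseteq> mon X i" and keys_g: "keys g \<subseteq> mon X i"
  shows "\<exists>f' g'. keys f' \<subseteq> affine_exponents \<and> keys g' \<subseteq> affine_exponents \<and>
    f * to_laurent g' = to_laurent f' * g \<and> (\<forall>x\<in>chart_open X i. g \<notin> snd x \<longrightarrow> g' \<notin> snd (contract x))"
proof -
  obtain u where clears: "u \<in> orthant_units Y (rays i)" "keys (monomial u * f) \<subseteq> orthant_monoid Y Y"
    "keys (monomial u * g) \<subseteq> orthant_monoid Y Y"
    by (rule monoid_localization.clear_denominators[OF localization[OF chart] keys_f keys_g])
  let ?f = "from_laurent (monomial u * f)" and ?g = "from_laurent (monomial u * g)"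
  have "?g \<notin> snd (contract x)" if "x \<in> chart_open X i" "g \<notin> snd x" for x
    using unit_mult_mem_iff[OF that(1) chart clears(1) keys_g] that(2)
    by (simp add: mem_contract_iff[OF keys_from_laurent] to_laurent_from_laurent[OF clears(3)])
  moreover have "f * to_laurent ?g = to_laurent ?f * g"
    unfolding to_laurent_from_laurent[OF clears(2)] to_laurent_from_laurent[OF clears(3)]
    by (simp only: mult_ac)
  ultimately show ?thesis using keys_from_laurent by blast
qed

lemma k_isomorphic_affine_space: "k_isomorphic (scheme_of X) (affine_space (card Y))"
proof -
  have "atlas_comparison X affine contract to_laurent"
  proof (intro atlas_comparison.intro atlas_comparison_axioms.intro)
    fix i and f g :: "_ \<Rightarrow>\<^sub>0 'k" assume "i \<in> charts X" "keys f \<subseteq> mon X i" "keys g \<subseteq> mon X i"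
    from laurent_fractions[OF this] show "\<exists>j\<in>charts affine. \<exists>f' g'. keys f' \<subseteq> mon affine j \<and>
        keys g' \<subseteq> mon affine j \<and> f * to_laurent g' = to_laurent f' * g \<and>
        (\<forall>x\<in>chart_open X i. contract x \<in> chart_open affine j \<and> (g \<notin> snd x \<longrightarrow> g' \<notin> snd (contract x)))"
      using contract_pts by (simp add: chart_open_affine) (auto simp: chart_open_def)
  next
    show "inj_on to_laurent {f. keys f \<subseteq> mon affine j}" for j
      by (rule inj_on_inverseI[where g = from_laurent]) (simp add: from_laurent_to_laurent)
    show "keys (to_laurent f) \<subseteq> mon X (fst x)" if "x \<in> pts X" for x f
      using keys_to_laurent[of f] orthant_monoid_subset_mon[OF point_chart[OF that]] by blast
  qed (simp_all add: integral_atlas_affine integral_atlas homeomorphic_contract map_exponents_add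
      to_laurent_mult map_exponents_single to_orthant_0 mem_contract_iff)
  then show ?thesis by (rule atlas_comparison.k_isomorphic_scheme_of)
qed

end

section \<open>Arrangements without relations\<close>

lemma pairing_uminus: "pairing (- u) v = - pairing u v"
  by (simp add: pairing_def sum_negf)

lemma pairing_nonneg_on_orthant_iff:
  "(\<forall>v\<in>orthant G. pairing u v \<ge> 0) \<longleftrightarrow> (\<forall>x\<in>G. lookup u x \<ge> 0)"
proof (intro iffI ballI)
  show "lookup u x \<ge> 0" if "\<forall>v\<in>orthant G. pairing u v \<ge> 0" "x \<in> G" for x
    using that single_in_orthant[of x G] pairing_single[of u x] by fastforce
  fix v assume nonneg: "\<forall>x\<in>G. lookup u x \<ge> 0" and v_in_orthant: "v \<in> orthant G"
  have "real_of_int (lookup u x) * lookup v x \<ge> 0" for x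
    using nonneg orthantD[OF v_in_orthant, of x] by (cases "x \<in> G") simp_all
  then show "pairing u v \<ge> 0" unfolding pairing_def by (rule sum_nonneg)
qed

lemma pairing_zero_on_orthant_iff:
  "(\<forall>v\<in>orthant G. pairing u v = 0) \<longleftrightarrow> (\<forall>x\<in>G. lookup u x = 0)"
proof -
  have "(\<forall>v\<in>orthant G. pairing u v = 0) \<longleftrightarrow>
      (\<forall>v\<in>orthant G. pairing u v \<ge> 0) \<and> (\<forall>v\<in>orthant G. pairing (- u) v \<ge> 0)"
    by (auto simp: pairing_uminus intro: antisym)
  also have "\<dots> \<longleftrightarrow> (\<forall>x\<in>G. lookup u x = 0)"
    unfolding pairing_nonneg_on_orthant_iff by (auto intro: antisym)
  finally show ?thesis .
qed

locale relation_free_arrangement = spanning_arrangement +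
  assumes no_relations: "\<And>c. c \<in> relations A \<Longrightarrow> c = 0"
begin

lemma relations_eq: "relations A = {0}"
  using no_relations by (auto simp: relations_def)

text \<open>The matrix of the \<open>a\<^sub>e\<close> and that of lifts of the unit vectors are inverse to each other, so
  that their two products have the same trace.\<close>

lemma card_idx_eq_rk: "card E = d"
proof -
  have "(\<Sum>i<d. normal A e i * unit_lift i e) = 1" if "e \<in> E" for e
    using lookup_unit_relation[OF that, of e] no_relations[OF unit_relation_in_relations[OF that]]
    by simp
  then have "int (card E) = (\<Sum>e\<in>E. \<Sum>i<d. normal A e i * unit_lift i e)" by simp
  also have "\<dots> = (\<Sum>i<d. \<Sum>e\<in>E. unit_lift i e * normal A e i)"
    by (subst sum.swap) (simp add: mult.commute)
  also have "\<dots> = int d" by (simp add: sum_unit_lift)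
  finally show ?thesis by simp
qed

lemma relation_vec_eq_0: "c \<in> relations A \<Longrightarrow> relation_vec A c = 0"
  using no_relations[of c] by (simp add: relation_vec_def)

lemma Lam_real_eq: "Lam_real A = {0}"
proof -
  have "relation_vec A ` relations A = {0}"
    by (auto simp: relations_eq relation_vec_def)
  then show ?thesis unfolding Lam_real_def by simp
qed

lemma M_tilde_eq: "M_tilde A = {u. keys u \<subseteq> E \<times> UNIV}"
  by (auto simp: M_tilde_def relation_vec_eq_0 pairing_def)

lemma vertex_on_all_hyperplanes:
  assumes vertex: "\<xi> \<in> vertices A" and e_in_E: "e \<in> E"
  shows "aff A e \<xi> = 0"
proof (rule ccontr)
  assume nonzero: "aff A e \<xi> \<noteq> 0"
  let ?w = "\<lambda>f. if f = e then 1 else 0 :: real"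
  have "(\<Sum>f\<in>E. real_of_int (lookup c f) * ?w f) = 0" if "c \<in> relations A" for c
    using no_relations[OF that] by simp
  then obtain m where m_coords: "m \<in> coord_space d" "\<And>f. f \<in> E \<Longrightarrow> ?w f = slope A f m"
    using slope_if_relations_vanish[of ?w] by blast
  have "slope A f m = 0" if "f \<in> hyperplanes_at A \<xi>" for f
    using m_coords(2)[of f] that nonzero by (auto simp: hyperplanes_at_def split: if_splits)
  then have "m = (\<lambda>_. 0)"
    using vertex m_coords(1) separatingD vertex_iff_separating[OF finite_E] by blast
  then show False using m_coords(2)[OF e_in_E] by (simp add: slope_0)
qed

lemma vertex_cone_eq_orthant:
  assumes "\<xi> \<in> vertices A"
  shows "vertex_cone A \<xi> = orthant (E \<times> UNIV)"
proof -
  have "generators \<xi> = E \<times> UNIV"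
    using vertex_on_all_hyperplanes[OF assms] UNIV_sign
    by (auto simp: generators_def E_pos_def E_neg_def)
  then show ?thesis by (simp add: vertex_cone_eq Lam_real_eq)
qed

lemma lawrence_fan_eq: "lawrence_fan A = orthant ` Pow (E \<times> UNIV)"
proof
  show "lawrence_fan A \<subseteq> orthant ` Pow (E \<times> UNIV)"
  proof
    fix \<sigma> assume "\<sigma> \<in> lawrence_fan A"
    then have "\<sigma> face_of orthant (E \<times> UNIV)" "\<sigma> \<noteq> {}"
      by (auto simp: lawrence_fan_def vertex_cone_eq_orthant)
    then obtain G where "G \<subseteq> E \<times> UNIV" "\<sigma> = orthant G" by (rule face_of_orthant)
    then show "\<sigma> \<in> orthant ` Pow (E \<times> UNIV)" by blast
  qed
  obtain \<xi> where vertex: "\<xi> \<in> vertices A" using vertex_exists[OF finite_E separating_E] .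
  have "orthant G \<in> lawrence_fan A" if "G \<subseteq> E \<times> UNIV" for G
    using vertex orthant_face_of[OF that finite_EU] convex_cone_nonempty[OF convex_cone_orthant]
    by (auto simp: lawrence_fan_def vertex_cone_eq_orthant[OF vertex] intro!: bexI[of _ \<xi>])
  then show "orthant ` Pow (E \<times> UNIV) \<subseteq> lawrence_fan A" by blast
qed

lemma dual_monoid_orthant: "dual_monoid A (orthant G) = orthant_monoid (E \<times> UNIV) G"
  by (auto simp: dual_monoid_def M_tilde_eq pairing_nonneg_on_orthant_iff orthant_monoid_def)

lemma mem_perp_lattice_orthant_iff:
  "u \<in> perp_lattice A (orthant G) \<longleftrightarrow> keys u \<subseteq> E \<times> UNIV \<and> (\<forall>x\<in>G. lookup u x = 0)"
  by (simp add: perp_lattice_def M_tilde_eq pairing_zero_on_orthant_iff)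

lemma hypertoric_ideal_eq: "hypertoric_ideal A \<sigma> = ({0} :: (_ \<Rightarrow>\<^sub>0 'k::field) set)"
proof -
  interpret ring "monoid_algebra (dual_monoid A \<sigma>) :: (_ \<Rightarrow>\<^sub>0 'k) ring"
    by (rule cring.axioms(1)[OF cring_dual_monoid])
  have zero: "relation_form ` relations A =
      ({\<zero>\<^bsub>monoid_algebra (dual_monoid A \<sigma>)\<^esub>} :: (_ \<Rightarrow>\<^sub>0 'k) set)"
    by (simp add: relations_eq relation_form_def monoid_algebra_def)
  show ?thesis
    unfolding hypertoric_ideal_relation_form zero using genideal_zero
    by (simp add: monoid_algebra_def)
qed

lemma orthant_atlas_hypertoric:
  "orthant_atlas (hypertoric_atlas A :: (_, _, 'k::field) atlas)
    (E \<times> UNIV) (\<lambda>\<sigma>. {x. single x 1 \<in> \<sigma>})"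
proof (rule orthant_atlas.intro)
  let ?X = "hypertoric_atlas A :: (_, _, 'k) atlas"
  let ?rays = "\<lambda>\<sigma>. {x. single x (1::real) \<in> \<sigma>}"
  have orthant: "\<sigma> = orthant (?rays \<sigma>)" if "\<sigma> \<in> lawrence_fan A" for \<sigma>
    using that by (auto simp: lawrence_fan_eq single_in_orthant)
  show "finite (E \<times> (UNIV :: sign set))" by simp
  show "bij_betw ?rays (charts ?X) (Pow (E \<times> UNIV))"
    by (rule bij_betw_byWitness[where f' = orthant]) (auto simp: lawrence_fan_eq single_in_orthant)
  show mon: "mon ?X \<sigma> = orthant_monoid (E \<times> UNIV) (?rays \<sigma>)" if "\<sigma> \<in> charts ?X" for \<sigma>
    using dual_monoid_orthant[of "?rays \<sigma>"] orthant that by simp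
  show "van ?X \<sigma> = {0}" for \<sigma> by (simp add: hypertoric_ideal_eq)
  show "sub ?X \<sigma> \<tau> \<longleftrightarrow> ?rays \<sigma> \<subseteq> ?rays \<tau>"
    if \<sigma>_chart: "\<sigma> \<in> charts ?X" and \<tau>_chart: "\<tau> \<in> charts ?X" for \<sigma> \<tau>
  proof -
    obtain G where \<sigma>_eq: "\<sigma> = orthant G" using \<sigma>_chart by (auto simp: lawrence_fan_eq)
    obtain H where \<tau>_eq: "\<tau> = orthant H" "H \<subseteq> E \<times> UNIV" using \<tau>_chart
      by (auto simp: lawrence_fan_eq)
    have "orthant G face_of orthant H \<longleftrightarrow> G \<subseteq> H"
      using orthant_face_of[of G H] finite_subset[OF \<tau>_eq(2) finite_EU] orthant_subset_iff[of G H]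
        face_of_imp_subset[of "orthant G" "orthant H"] by blast
    then show ?thesis by (simp add: \<sigma>_eq \<tau>_eq(1) single_in_orthant)
  qed
  show "(\<sigma>, q) \<in> pts ?X \<longleftrightarrow> \<sigma> \<in> charts ?X \<and> primeideal q (monoid_algebra (mon ?X \<sigma>)) \<and>
      (\<forall>u\<in>mon ?X \<sigma>. (\<exists>x\<in>?rays \<sigma>. lookup u x \<noteq> 0) \<longrightarrow> monomial u \<in> q)" for \<sigma> q
  proof (cases "\<sigma> \<in> lawrence_fan A \<and> primeideal q (monoid_algebra (dual_monoid A \<sigma>))")
    case True
    then have "u \<in> dual_monoid A \<sigma> - perp_lattice A \<sigma> \<longleftrightarrow>
        u \<in> dual_monoid A \<sigma> \<and> (\<exists>x\<in>?rays \<sigma>. lookup u x \<noteq> 0)" for u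
      using orthant[of \<sigma>] mem_perp_lattice_orthant_iff[of u "?rays \<sigma>"]
      by (auto simp: dual_monoid_def M_tilde_def)
    moreover have "monoid_algebra_prime (dual_monoid A \<sigma>) q"
      using True add_submonoid_dual_monoid by (auto intro: monoid_algebra_prime.intro)
    then have "0 \<in> q"
      by (rule monoid_algebra_ideal.zero_mem[OF monoid_algebra_prime_imp_ideal])
    ultimately show ?thesis
      using True by (auto simp: pts_hypertoric_atlas hypertoric_ideal_eq)
  next
    case False
    then show ?thesis by (auto simp: pts_hypertoric_atlas)
  qed
qed

lemma hypertoric_isomorphic_affine_space:
  "k_isomorphic (hypertoric A :: (_, _, 'k::field) k_space) (affine_space (2 * rk A))"
proof -
  have "card (E \<times> (UNIV :: sign set)) = 2 * rk A"
    by (simp add: card_cartesian_product card_idx_eq_rk UNIV_sign)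
  then show ?thesis
    using orthant_atlas.k_isomorphic_affine_space[OF orthant_atlas_hypertoric, where 'k = 'k]
    by simp
qed

end

theorem corollary5p3:
  fixes v :: "'k::field \<Rightarrow> ereal"
    and A :: "'e arrangement"
  assumes "nonarch_valuation v" and "valuation_complete v"
    and "primitive_spanning A"
    and "\<not> k_isomorphic (hypertoric A :: (_, _, 'k) k_space) (affine_space (2 * rk A))"
  shows "\<exists>\<sigma> \<in> lawrence_fan A.
           topspace (topo (hypertoric A :: (_, _, 'k) k_space)) \<inter> orbit A \<sigma> \<noteq> {} \<and>
           ereal_of_enat (krull_dim
             (subtopology (topo (hypertoric A :: (_, _, 'k) k_space)) (orbit A \<sigma>)))
           \<noteq> ereal_of_enat (krull_dim (topo (hypertoric A :: (_, _, 'k) k_space)))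
               - ereal (real (cone_dim A \<sigma>))"
proof -
  interpret spanning_arrangement A by (rule spanning_arrangement.intro) fact
  have "\<exists>c\<in>relations A. c \<noteq> 0"
  proof (rule ccontr)
    assume "\<not> ?thesis"
    then interpret relation_free_arrangement A by unfold_locales blast
    show False using hypertoric_isomorphic_affine_space assms(4) by blast
  qed
  then show ?thesis using improper_intersection by blast
qed

end
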